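(* Consider the perturbed learning automata Markov chain described in the context, with transition probability functions $P_\lambda$ ($\lambda>0$), unperturbed kernel $P$, one-tremble kernel $Q$, and set of pure strategy states $\mathcal{S}$. There exists a unique probability vector $\pi=(\pi_s)_{s\in\mathcal{S}}$ such that for any collection of invariant probability measures $\{\mu_\lambda\in\mathfrak{P}(\mathcal{Z}):\mu_\lambda P_\lambda=\mu_\lambda,\ \lambda>0\}$ the following hold: (a) $\lim_{\lambda\to 0}\mu_\lambda(\cdot)=\hat\mu(\cdot):=\sum_{s\in\mathcal{S}}\pi_s\,\delta_s(\cdot)$, where convergence is weak convergence of probability measures and $\delta_s$ is the Dirac measure at $s$; (b) $\pi$ is an invariant distribution of the finite-state Markov chain $\hat P$ on $\mathcal{S}$ defined, for $s,s'\in\mathcal{S}$, by $$\hat P_{ss'}:=\lim_{t\to\infty} (QP^t)(s,\mathcal{N}_\delta(s')),$$ for some $\delta>0$ sufficiently small.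
   Context: Finite game: players $\mathcal{I}=\{1,\dots,n\}$, finite action sets $\mathcal{A}_i$, $\mathcal{A}=\mathcal{A}_1\times\cdots\times\mathcal{A}_n$, utilities $u_i:\mathcal{A}\to\mathbb{R}$ with $u_i(\alpha)>0$ for all $i,\alpha$ (positive-utility property). Let $\mathcal{X}_i=\Delta(|\mathcal{A}_i|)$ be the probability simplex, with actions identified with unit vectors $e_{\alpha_i}$; $\mathcal{X}=\mathcal{X}_1\times\cdots\times\mathcal{X}_n$, $\mathcal{Z}=\mathcal{A}\times\mathcal{X}$ (discrete topology on $\mathcal{A}$, Euclidean on $\mathcal{X}$, product topology on $\mathcal{Z}$); $\mathfrak{P}(\mathcal{Z})$ denotes Borel probability measures on $\mathcal{Z}$. The step size $\epsilon>0$ is small enough that $0<\epsilon u_i(\alpha)<1$ for all $i,\alpha$. Perturbed learning automata with perturbation $\lambda>0$: from state $(\alpha(t),x(t))$, each agent $i$ independently selects $\alpha_i(t+1)$ distributed according to $x_i(t)$ with probability $1-\lambda$ and uniformly on $\mathcal{A}_i$ with probability $\lambda$ ("trembling"); then $x_i(t+1)=x_i(t)+\epsilon u_i(\alpha(t+1))(e_{\alpha_i(t+1)}-x_i(t))$. This is a Markov chain on $\mathcal{Z}$ with transition probability function (t.p.f.) $P_\lambda$; $P$ is the t.p.f. for $\lambda=0$ (unperturbed process), and $P^t$ its $t$-step kernel. $Q$ is the t.p.f. of one step in which exactly one agent trembles (the trembling agent is equally likely to be any of the $n$ agents, it picks its action uniformly from its action set, every other agent picks its action according to its strategy, and then strategies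 are updated by the rule above); $QP^t(z,D)=\int Q(z,dy)P^t(y,D)$. A pure strategy state is $(\alpha,x)\in\mathcal{Z}$ with $x_i=e_{\alpha_i}$ for all $i$; $\mathcal{S}$ is the set of pure strategy states. $\mathcal{N}_\delta(z)=\{y\in\mathcal{Z}:|x-y|<\delta\}$. *)

theory Defs
  imports "HOL-Probability.Probability"
begin

text \<open>States: pairs (action profile, strategy profile). Players are the elements of a
finite type 'i, actions are natural numbers, the action set of player i is A i.
A strategy of player i is a function nat => real (a probability vector supported on A i).\<close>

type_synonym 'i state = "('i \<Rightarrow> nat) \<times> ('i \<Rightarrow> nat \<Rightarrow> real)"

definition prob_simplex :: "nat set \<Rightarrow> (nat \<Rightarrow> real) set" where
  "prob_simplex S = {p. (\<forall>a. 0 \<le> p a) \<and> (\<forall>a. a \<notin> S \<longrightarrow> p a = 0) \<and> sum p S = 1}"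

definition unitv :: "nat \<Rightarrow> nat \<Rightarrow> real" where
  "unitv a = (\<lambda>b. if b = a then 1 else 0)"

definition states :: "('i \<Rightarrow> nat set) \<Rightarrow> 'i state set" where
  "states A = {(\<alpha>, x). (\<forall>i. \<alpha> i \<in> A i) \<and> (\<forall>i. x i \<in> prob_simplex (A i))}"

definition pure_states :: "('i \<Rightarrow> nat set) \<Rightarrow> 'i state set" where
  "pure_states A = {(\<alpha>, x). (\<forall>i. \<alpha> i \<in> A i) \<and> (\<forall>i. x i = unitv (\<alpha> i))}"

definition la_update :: "real \<Rightarrow> ('i \<Rightarrow> ('i \<Rightarrow> nat) \<Rightarrow> real) \<Rightarrow> ('i \<Rightarrow> nat \<Rightarrow> real)
    \<Rightarrow> ('i \<Rightarrow> nat) \<Rightarrow> 'i state" where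
  "la_update \<epsilon> u x \<alpha>' = (\<alpha>', \<lambda>i a. x i a + \<epsilon> * u i \<alpha>' * (unitv (\<alpha>' i) a - x i a))"

text \<open>Transition probability function P_lambda of perturbed learning automata
(each agent independently trembles with probability l). P = pla_kernel A u eps 0.\<close>
definition pla_kernel :: "('i::finite \<Rightarrow> nat set) \<Rightarrow> ('i \<Rightarrow> ('i \<Rightarrow> nat) \<Rightarrow> real) \<Rightarrow> real \<Rightarrow> real
    \<Rightarrow> 'i state \<Rightarrow> 'i state pmf" where
  "pla_kernel A u \<epsilon> l z =
     map_pmf (la_update \<epsilon> u (snd z))
       (Pi_pmf UNIV 0 (\<lambda>i. bind_pmf (bernoulli_pmf l)
          (\<lambda>b. if b then pmf_of_set (A i) else embed_pmf (snd z i))))"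

definition tremble_kernel :: "('i::finite \<Rightarrow> nat set) \<Rightarrow> ('i \<Rightarrow> ('i \<Rightarrow> nat) \<Rightarrow> real) \<Rightarrow> real
    \<Rightarrow> 'i state \<Rightarrow> 'i state pmf" where
  "tremble_kernel A u \<epsilon> z =
     bind_pmf (pmf_of_set UNIV) (\<lambda>j.
       map_pmf (la_update \<epsilon> u (snd z))
         (Pi_pmf UNIV 0 (\<lambda>i. if i = j then pmf_of_set (A i) else embed_pmf (snd z i))))"

primrec kpow :: "('a \<Rightarrow> 'a pmf) \<Rightarrow> nat \<Rightarrow> 'a \<Rightarrow> 'a pmf" where
  "kpow K 0 z = return_pmf z"
| "kpow K (Suc t) z = bind_pmf (kpow K t z) K"

definition strat_dist :: "('i::finite \<Rightarrow> nat set) \<Rightarrow> ('i \<Rightarrow> nat \<Rightarrow> real) \<Rightarrow> ('i \<Rightarrow> nat \<Rightarrow> real) \<Rightarrow> real" where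
  "strat_dist A x y = sqrt (\<Sum>i\<in>UNIV. \<Sum>a\<in>A i. (x i a - y i a)^2)"

definition nbhd :: "('i::finite \<Rightarrow> nat set) \<Rightarrow> real \<Rightarrow> 'i state \<Rightarrow> 'i state set" where
  "nbhd A \<delta> z = {y \<in> states A. strat_dist A (snd y) (snd z) < \<delta>}"

definition invariant_measure :: "('a \<Rightarrow> 'a pmf) \<Rightarrow> 'a measure \<Rightarrow> bool" where
  "invariant_measure K \<mu> \<longleftrightarrow>
     (\<forall>D \<in> sets \<mu>. emeasure \<mu> D = (\<integral>\<^sup>+ z. emeasure (measure_pmf (K z)) D \<partial>\<mu>))"

definition QPt :: "('i::finite \<Rightarrow> nat set) \<Rightarrow> ('i \<Rightarrow> ('i \<Rightarrow> nat) \<Rightarrow> real) \<Rightarrow> real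
    \<Rightarrow> nat \<Rightarrow> 'i state \<Rightarrow> 'i state set \<Rightarrow> real" where
  "QPt A u \<epsilon> t z D = measure_pmf.prob (bind_pmf (tremble_kernel A u \<epsilon> z) (kpow (pla_kernel A u \<epsilon> 0) t)) D"

definition hatP :: "('i::finite \<Rightarrow> nat set) \<Rightarrow> ('i \<Rightarrow> ('i \<Rightarrow> nat) \<Rightarrow> real) \<Rightarrow> real
    \<Rightarrow> real \<Rightarrow> 'i state \<Rightarrow> 'i state \<Rightarrow> real" where
  "hatP A u \<epsilon> \<delta> s s' = lim (\<lambda>t. QPt A u \<epsilon> t s (nbhd A \<delta> s'))"

end

theory Submission
  imports Defs
begin

text \<open>
  Playing a fixed profile for ever from a state in which each of its actions has probability at
  least \<open>b > 0\<close> has probability bounded below, because the strategies approach the pure strategy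
  geometrically. Hence for continuous \<open>f\<close> the unperturbed iterates \<open>P\<^sup>t f\<close> converge uniformly to a
  continuous harmonic function \<open>H f\<close>, and a continuous harmonic function is determined by its values
  on the pure states: \<open>H f = (\<Sum>s. f s * absorb s)\<close>, where \<open>absorb s z\<close> is the probability of
  absorption in \<open>s\<close>. In particular the limiting matrix is \<open>limP s s' = Q (absorb s') s\<close>.

  Write \<open>T l\<close> for the perturbed operator and \<open>n\<close> for the number of players. From
  \<open>T l = P + l n (Q - P) + O(l\<^sup>2)\<close> and the invariance of \<open>\<mu>\<^sub>l\<close> one gets
  \<open>\<integral> f d\<mu>\<^sub>l = \<integral> H f d\<mu>\<^sub>l + o(1)\<close> and, for harmonic \<open>h\<close>, \<open>\<integral> h d\<mu>\<^sub>l = \<integral> Q h d\<mu>\<^sub>l + O(l)\<close>. So every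
  limit point of the vectors \<open>\<integral> absorb s d\<mu>\<^sub>l\<close> is an invariant distribution of \<open>limP\<close>. Since \<open>limP\<close> is
  irreducible (one tremble can change any single coordinate), there is only one.

  Uniqueness of \<open>\<pi>\<close> also needs that invariant measures exist: action histories are coded as real
  numbers on which the strategies depend continuously, Helly's selection theorem is applied to the
  Cesaro averages of the coded chain, and the limit is pushed forward to the state space.
\<close>

text \<open>Every mixture of Dirac measures at pure states is invariant under \<open>P\<close>, so
  the unperturbed chain alone cannot single out a limit; the first-order term in \<open>l\<close>
  makes the selection. Test functions that are continuous and harmonic reduce the problem to finite
  dimension, since on the states they are the combinations of the finitely many
  \<open>absorb s\<close>. All constants must be uniform over the states, although a fixed profile
  may be arbitrarily unlikely at some of them. Hence the profile to be repeated is chosen separately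
  at each state, as one whose actions are all likely there. The condition on \<pi> is an implication
  from families of invariant measures: if there were no family, every probability vector would
  satisfy it. The coding of histories works because each update contracts the strategies by a factor
  of at most \<open>rate\<close>, so that old actions are forgotten geometrically.\<close>

lemma tendsto_funI:
  fixes f :: "'a \<Rightarrow> 'b \<Rightarrow> 'c::topological_space"
  assumes "\<And>i. ((\<lambda>x. f x i) \<longlongrightarrow> l i) F"
  shows "(f \<longlongrightarrow> l) F"
proof -
  have "limitin (product_topology (\<lambda>i::'b. euclidean :: 'c topology) UNIV) f l F"
    using assms by (simp add: limitin_componentwise)
  then show ?thesis by (simp add: euclidean_product_topology)
qed

text \<open>First-order Taylor expansion at \<open>l = 0\<close>. A new factor multiplies the old
  remainder by a number in [0,1] and adds a term of size at most \<open>l\<^sup>2 * card I\<close>;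
  the quadratic constant survives because n + n^2 \<le> (n + 1)^2.\<close>

lemma prod_linear_expansion:
  fixes a b :: "'a \<Rightarrow> real" and l :: real
  assumes "finite I" "\<And>i. i \<in> I \<Longrightarrow> 0 \<le> a i \<and> a i \<le> 1 \<and> 0 \<le> b i \<and> b i \<le> 1" "0 \<le> l" "l \<le> 1"
  shows "\<bar>(\<Prod>i\<in>I. (1 - l) * a i + l * b i) - (\<Prod>i\<in>I. a i)
           - l * (\<Sum>j\<in>I. (b j - a j) * (\<Prod>i\<in>I - {j}. a i))\<bar> \<le> (card I)\<^sup>2 * l\<^sup>2"
  using assms(1,2)
proof (induction I rule: finite_induct)
  case empty
  then show ?case by simp
next
  case (insert k I)
  define M where "M = (\<Prod>i\<in>I. a i)"
  define L where "L = (\<Sum>j\<in>I. (b j - a j) * (\<Prod>i\<in>I - {j}. a i))"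
  define W where "W = (\<Prod>i\<in>I. (1 - l) * a i + l * b i)"
  define d where "d = b k - a k"
  have k: "0 \<le> a k" "a k \<le> 1" "0 \<le> b k" "b k \<le> 1" using insert.prems[of k] by auto
  have IH: "\<bar>W - M - l * L\<bar> \<le> (card I)\<^sup>2 * l\<^sup>2"
    unfolding W_def M_def L_def using insert by auto
  have L: "\<bar>L\<bar> \<le> card I"
  proof -
    have "\<bar>L\<bar> \<le> (\<Sum>j\<in>I. \<bar>(b j - a j) * (\<Prod>i\<in>I - {j}. a i)\<bar>)"
      unfolding L_def by (rule sum_abs)
    also have "\<dots> \<le> (\<Sum>j\<in>I. 1)"
    proof (rule sum_mono)
      fix j assume j: "j \<in> I"
      have "\<bar>b j - a j\<bar> \<le> 1" using insert.prems[of j] j by auto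
      moreover have "\<bar>\<Prod>i\<in>I - {j}. a i\<bar> \<le> 1"
        unfolding abs_prod using insert.prems by (intro prod_le_1) auto
      ultimately show "\<bar>(b j - a j) * (\<Prod>i\<in>I - {j}. a i)\<bar> \<le> 1"
        unfolding abs_mult by (intro mult_le_one) auto
    qed
    finally show ?thesis by simp
  qed
  have sum_eq: "(\<Sum>j\<in>insert k I. (b j - a j) * (\<Prod>i\<in>insert k I - {j}. a i)) = d * M + a k * L"
  proof -
    have "(\<Sum>j\<in>I. (b j - a j) * (\<Prod>i\<in>insert k I - {j}. a i)) = (\<Sum>j\<in>I. a k * ((b j - a j) * (\<Prod>i\<in>I - {j}. a i)))"
    proof (rule sum.cong[OF refl])
      fix j assume j: "j \<in> I"
      then have "insert k I - {j} = insert k (I - {j})" using insert.hyps by auto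
      then show "(b j - a j) * (\<Prod>i\<in>insert k I - {j}. a i) = a k * ((b j - a j) * (\<Prod>i\<in>I - {j}. a i))"
        using insert.hyps by simp
    qed
    then have "(\<Sum>j\<in>I. (b j - a j) * (\<Prod>i\<in>insert k I - {j}. a i)) = a k * L"
      by (simp add: L_def sum_distrib_left)
    moreover have "insert k I - {k} = I" using insert.hyps by auto
    ultimately show ?thesis using insert.hyps by (simp add: d_def M_def)
  qed
  have "(\<Prod>i\<in>insert k I. (1 - l) * a i + l * b i) - (\<Prod>i\<in>insert k I. a i)
      - l * (\<Sum>j\<in>insert k I. (b j - a j) * (\<Prod>i\<in>insert k I - {j}. a i))
      = ((1 - l) * a k + l * b k) * W - a k * M - l * (d * M + a k * L)"
    using insert.hyps by (simp add: sum_eq W_def M_def)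
  \<comment> \<open>Write \<open>W\<close> as \<open>M + l * L\<close> plus the old remainder:
    orders 0 and 1 cancel, and the product of the two first-order terms is all that is new.\<close>
  also have "\<dots> = l\<^sup>2 * (d * L) + ((1 - l) * a k + l * b k) * (W - M - l * L)"
    by (simp add: d_def algebra_simps power2_eq_square)
  also have "\<bar>\<dots>\<bar> \<le> l\<^sup>2 * card I + (card I)\<^sup>2 * l\<^sup>2"
  proof -
    have "\<bar>d * L\<bar> \<le> 1 * real (card I)"
      unfolding abs_mult using L k by (intro mult_mono) (auto simp: d_def)
    then have 1: "\<bar>l\<^sup>2 * (d * L)\<bar> \<le> l\<^sup>2 * card I"
      by (simp add: abs_mult mult_left_mono)
    have "(1 - l) * a k + l * b k \<le> (1 - l) * 1 + l * 1"
      using k assms by (intro add_mono mult_left_mono) auto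
    then have "\<bar>(1 - l) * a k + l * b k\<bar> \<le> 1" using k assms by simp
    then have 2: "\<bar>((1 - l) * a k + l * b k) * (W - M - l * L)\<bar> \<le> 1 * ((card I)\<^sup>2 * l\<^sup>2)"
      unfolding abs_mult by (intro mult_mono IH) auto
    show ?thesis using 1 2 by linarith
  qed
  also have "\<dots> \<le> (card (insert k I))\<^sup>2 * l\<^sup>2"
  proof -
    have "real (card I) + (card I)\<^sup>2 \<le> (card (insert k I))\<^sup>2"
      using insert.hyps by (simp add: power2_eq_square algebra_simps)
    then have "l\<^sup>2 * (real (card I) + (card I)\<^sup>2) \<le> l\<^sup>2 * (card (insert k I))\<^sup>2"
      by (intro mult_left_mono) auto
    then show ?thesis by (simp add: algebra_simps)
  qed
  finally show ?case by simp
qed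

section \<open>Averaging operators of the learning dynamics\<close>

locale pla =
  fixes A :: "'i::finite \<Rightarrow> nat set"
    and u :: "'i \<Rightarrow> ('i \<Rightarrow> nat) \<Rightarrow> real"
    and \<epsilon> :: real
  assumes finA [simp]: "\<And>i. finite (A i)"
    and A_ne [simp]: "\<And>i. A i \<noteq> {}"
    and step_pos: "\<And>i \<alpha>. (\<And>j. \<alpha> j \<in> A j) \<Longrightarrow> 0 < \<epsilon> * u i \<alpha>"
    and step_less_1: "\<And>i \<alpha>. (\<And>j. \<alpha> j \<in> A j) \<Longrightarrow> \<epsilon> * u i \<alpha> < 1"
begin

definition profs :: "('i \<Rightarrow> nat) set" where "profs = {\<alpha>. \<forall>i. \<alpha> i \<in> A i}"

definition strats :: "('i \<Rightarrow> nat \<Rightarrow> real) set" where "strats = {x. \<forall>i. x i \<in> prob_simplex (A i)}"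

abbreviation upd :: "('i \<Rightarrow> nat \<Rightarrow> real) \<Rightarrow> ('i \<Rightarrow> nat) \<Rightarrow> 'i state" where
  "upd \<equiv> la_update \<epsilon> u"

text \<open>The drawing weights \<open>p\<close> are kept apart from the strategy \<open>x\<close>:
  a trembling agent draws from altered weights, but its update still starts from its own
  strategy.\<close>

definition avg :: "('i \<Rightarrow> nat \<Rightarrow> real) \<Rightarrow> ('i state \<Rightarrow> real) \<Rightarrow> ('i \<Rightarrow> nat \<Rightarrow> real) \<Rightarrow> real" where
  "avg p f x = (\<Sum>\<alpha>\<in>profs. (\<Prod>i\<in>UNIV. p i (\<alpha> i)) * f (upd x \<alpha>))"

definition trem :: "real \<Rightarrow> ('i \<Rightarrow> nat \<Rightarrow> real) \<Rightarrow> 'i \<Rightarrow> nat \<Rightarrow> real" where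
  "trem l x i a = (if a \<in> A i then (1 - l) * x i a + l * (1 / card (A i)) else 0)"

definition one_trem :: "'i \<Rightarrow> ('i \<Rightarrow> nat \<Rightarrow> real) \<Rightarrow> 'i \<Rightarrow> nat \<Rightarrow> real" where
  "one_trem j x i a = (if i = j then (if a \<in> A i then 1 / card (A i) else 0) else x i a)"

text \<open>The kernels in their action on functions, as finite sums over profiles. They are matched
  with the pmf kernels on \<open>states A\<close> only; elsewhere the weights may be negative or
  fail to sum to 1.\<close>

definition T :: "real \<Rightarrow> ('i state \<Rightarrow> real) \<Rightarrow> 'i state \<Rightarrow> real" where
  "T l f z = avg (trem l (snd z)) f (snd z)"

definition P :: "('i state \<Rightarrow> real) \<Rightarrow> 'i state \<Rightarrow> real" where
  "P f z = avg (snd z) f (snd z)"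

definition Q :: "('i state \<Rightarrow> real) \<Rightarrow> 'i state \<Rightarrow> real" where
  "Q f z = (\<Sum>j\<in>UNIV. avg (one_trem j (snd z)) f (snd z)) / CARD('i)"

lemma profs_PiE: "profs = PiE UNIV A" by (auto simp: profs_def PiE_def)

lemma finite_profs [simp]: "finite profs"
  unfolding profs_PiE by (rule finite_PiE) auto

lemma profs_ne: "profs \<noteq> {}"
  unfolding profs_PiE by (simp add: PiE_eq_empty_iff)

lemma profsD: "\<alpha> \<in> profs \<Longrightarrow> \<alpha> i \<in> A i" by (simp add: profs_def)

lemma states_eq: "states A = profs \<times> strats"
  by (auto simp: states_def profs_def strats_def)

lemma snd_states: "z \<in> states A \<Longrightarrow> snd z \<in> strats" by (auto simp: states_eq)

lemma stratsD:
  assumes "x \<in> strats"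
  shows "0 \<le> x i a" "a \<notin> A i \<Longrightarrow> x i a = 0" "sum (x i) (A i) = 1" "x i a \<le> 1"
proof -
  show *: "0 \<le> x i a" "a \<notin> A i \<Longrightarrow> x i a = 0" "sum (x i) (A i) = 1" for a
    using assms by (auto simp: strats_def prob_simplex_def)
  show "x i a \<le> 1"
  proof (cases "a \<in> A i")
    case True
    then have "x i a \<le> sum (x i) (A i)" using * by (intro member_le_sum) auto
    then show ?thesis using * by simp
  qed (use * in simp)
qed

lemma card_A_pos: "0 < real (card (A i))" by (simp add: card_gt_0_iff)

lemma trem_strats:
  assumes "x \<in> strats" "0 \<le> l" "l \<le> 1" shows "trem l x \<in> strats"
proof -
  have "(\<Sum>a\<in>A i. trem l x i a) = (\<Sum>a\<in>A i. (1 - l) * x i a + l * (1 / card (A i)))" for i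
    by (rule sum.cong) (auto simp: trem_def)
  also have "\<dots> i = (1 - l) * sum (x i) (A i) + l" for i
    using card_A_pos[of i] by (simp add: sum.distrib sum_distrib_left)
  finally have "(\<Sum>a\<in>A i. trem l x i a) = 1" for i using stratsD[OF assms(1)] by simp
  then show ?thesis using assms stratsD[OF assms(1)]
    by (auto simp: strats_def prob_simplex_def trem_def)
qed

lemma one_trem_strats:
  assumes "x \<in> strats" shows "one_trem j x \<in> strats"
proof -
  have "(\<Sum>a\<in>A i. one_trem j x i a) = (\<Sum>a\<in>A i. if i = j then 1 / card (A i) else x i a)" for i
    by (rule sum.cong) (auto simp: one_trem_def)
  also have "\<dots> i = 1" for i using card_A_pos[of i] stratsD[OF assms(1)] by (cases "i = j") auto
  finally have "(\<Sum>a\<in>A i. one_trem j x i a) = 1" for i .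
  then show ?thesis using stratsD[OF assms(1)]
    by (auto simp: strats_def prob_simplex_def one_trem_def)
qed

lemma trem_0: "x \<in> strats \<Longrightarrow> trem 0 x = x"
  by (intro ext) (auto simp: trem_def stratsD)

lemma T_0: "z \<in> states A \<Longrightarrow> T 0 f z = P f z"
  by (simp add: T_def P_def trem_0 snd_states)

lemma upd_states:
  assumes "x \<in> strats" "\<alpha> \<in> profs" shows "upd x \<alpha> \<in> states A"
proof -
  have s: "0 < \<epsilon> * u i \<alpha>" "\<epsilon> * u i \<alpha> < 1" for i
    using assms step_pos step_less_1 by (auto simp: profs_def)
  have e: "snd (upd x \<alpha>) i a = (1 - \<epsilon> * u i \<alpha>) * x i a + \<epsilon> * u i \<alpha> * unitv (\<alpha> i) a" for i a
    by (simp add: la_update_def algebra_simps)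
  have "sum (unitv (\<alpha> i)) (A i) = 1" for i
    using assms profsD[of \<alpha> i] by (simp add: unitv_def)
  then have "sum (snd (upd x \<alpha>) i) (A i) = 1" for i
    using stratsD[OF assms(1)] by (simp add: e sum.distrib flip: sum_distrib_left)
  moreover have "0 \<le> snd (upd x \<alpha>) i a" for i a
    using s[of i] stratsD[OF assms(1)] by (simp add: e unitv_def)
  moreover have "a \<notin> A i \<Longrightarrow> snd (upd x \<alpha>) i a = 0" for i a
    using profsD[OF assms(2)] stratsD[OF assms(1)] by (auto simp: e unitv_def)
  ultimately have "snd (upd x \<alpha>) \<in> strats" by (simp add: strats_def prob_simplex_def)
  then show ?thesis using assms by (simp add: states_eq la_update_def)
qed

lemma fst_upd [simp]: "fst (upd x \<alpha>) = \<alpha>" by (simp add: la_update_def)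

lemma sum_weights:
  assumes "p \<in> strats" shows "(\<Sum>\<alpha>\<in>profs. \<Prod>i\<in>UNIV. p i (\<alpha> i)) = 1"
proof -
  have "(\<Sum>\<alpha>\<in>profs. \<Prod>i\<in>UNIV. p i (\<alpha> i)) = (\<Prod>i\<in>UNIV. \<Sum>a\<in>A i. p i a)"
    unfolding profs_PiE by (rule prod_sum_PiE[symmetric]) auto
  then show ?thesis using stratsD[OF assms] by simp
qed

lemma weight_nonneg: "p \<in> strats \<Longrightarrow> 0 \<le> (\<Prod>i\<in>UNIV. p i (\<alpha> i))"
  by (intro prod_nonneg) (auto simp: stratsD)

lemma avg_const: "p \<in> strats \<Longrightarrow> avg p (\<lambda>_. c) x = c"
  by (simp add: avg_def sum_weights flip: sum_distrib_right)

lemma avg_cmult: "avg p (\<lambda>z. c * f z) x = c * avg p f x"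
  by (simp add: avg_def sum_distrib_left algebra_simps)

lemma avg_diff: "avg p (\<lambda>z. f z - g z) x = avg p f x - avg p g x"
  by (simp add: avg_def algebra_simps sum_subtractf)

lemma avg_sum: "avg p (\<lambda>z. \<Sum>k\<in>I. f k z) x = (\<Sum>k\<in>I. avg p (f k) x)"
  unfolding avg_def sum_distrib_left by (rule sum.swap)

lemma avg_mono:
  assumes "p \<in> strats" "x \<in> strats" "\<And>z. z \<in> states A \<Longrightarrow> f z \<le> g z"
  shows "avg p f x \<le> avg p g x"
  unfolding avg_def using assms
  by (intro sum_mono mult_left_mono) (auto simp: upd_states weight_nonneg)

lemma avg_cong:
  assumes "x \<in> strats" "\<And>z. z \<in> states A \<Longrightarrow> f z = g z"
  shows "avg p f x = avg p g x"
  unfolding avg_def using assms by (intro sum.cong) (auto simp: upd_states)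

lemma avg_abs_le:
  assumes "p \<in> strats" "x \<in> strats"
  shows "\<bar>avg p f x\<bar> \<le> avg p (\<lambda>z. \<bar>f z\<bar>) x"
  unfolding avg_def
  by (rule order.trans[OF sum_abs]) (auto simp: abs_mult abs_prod stratsD assms)

lemma avg_single_le:
  assumes "p \<in> strats" "x \<in> strats" "\<And>z. z \<in> states A \<Longrightarrow> 0 \<le> f z" "\<alpha> \<in> profs"
  shows "(\<Prod>i\<in>UNIV. p i (\<alpha> i)) * f (upd x \<alpha>) \<le> avg p f x"
  unfolding avg_def using assms
  by (intro member_le_sum) (auto simp: upd_states weight_nonneg)

lemma Pt_mono:
  assumes "\<And>z. z \<in> states A \<Longrightarrow> f z \<le> g z" "z \<in> states A"
  shows "(P ^^ t) f z \<le> (P ^^ t) g z"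
  using assms(2)
proof (induction t arbitrary: z)
  case 0 then show ?case using assms by simp
next
  case (Suc t)
  then show ?case by (auto simp: P_def intro!: avg_mono snd_states)
qed

lemma Pt_const: "z \<in> states A \<Longrightarrow> (P ^^ t) (\<lambda>_. c) z = c"
proof (induction t arbitrary: z)
  case (Suc t)
  then have "P ((P ^^ t) (\<lambda>_. c)) z = P (\<lambda>_. c) z"
    unfolding P_def by (intro avg_cong) (auto simp: snd_states)
  then show ?case using Suc by (simp add: P_def[of "\<lambda>_. c"] avg_const snd_states)
qed simp

lemma Pt_diff: "(P ^^ t) (\<lambda>z. f z - g z) = (\<lambda>z. (P ^^ t) f z - (P ^^ t) g z)"
  by (induction t) (auto simp: P_def avg_diff)

lemma Pt_cmult: "(P ^^ t) (\<lambda>z. c * f z) = (\<lambda>z. c * (P ^^ t) f z)"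
  by (induction t) (auto simp: P_def avg_cmult)

lemma Pt_abs_le:
  assumes "z \<in> states A"
  shows "\<bar>(P ^^ t) f z\<bar> \<le> (P ^^ t) (\<lambda>z. \<bar>f z\<bar>) z"
proof -
  have "(P ^^ t) f z \<le> (P ^^ t) (\<lambda>z. \<bar>f z\<bar>) z" using assms by (intro Pt_mono) auto
  moreover have "(P ^^ t) (\<lambda>z. - 1 * \<bar>f z\<bar>) z \<le> (P ^^ t) f z" using assms by (intro Pt_mono) auto
  ultimately show ?thesis unfolding Pt_cmult by linarith
qed

lemma Pt_bound:
  assumes "z \<in> states A" "\<And>z. z \<in> states A \<Longrightarrow> \<bar>f z\<bar> \<le> B"
  shows "\<bar>(P ^^ t) f z\<bar> \<le> B"
proof -
  note Pt_abs_le[OF assms(1), of t f]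
  also have "(P ^^ t) (\<lambda>z. \<bar>f z\<bar>) z \<le> (P ^^ t) (\<lambda>_. B) z" using assms by (intro Pt_mono) auto
  finally show ?thesis using Pt_const[OF assms(1)] by simp
qed

section \<open>Repeated play of one profile\<close>

definition traj :: "('i \<Rightarrow> nat) \<Rightarrow> nat \<Rightarrow> 'i state \<Rightarrow> 'i state" where
  "traj \<alpha> m z = ((\<lambda>z. upd (snd z) \<alpha>) ^^ m) z"

text \<open>The probability that the unperturbed process started in \<open>z\<close> plays \<alpha>
  in each of its next \<open>m\<close> steps.\<close>

definition stay :: "('i \<Rightarrow> nat) \<Rightarrow> nat \<Rightarrow> 'i state \<Rightarrow> real" where
  "stay \<alpha> m z = (\<Prod>t<m. \<Prod>i\<in>UNIV. snd (traj \<alpha> t z) i (\<alpha> i))"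

text \<open>Union bound for the probability that the next profile differs from \<alpha>. Being a sum
  over the players, it contracts under play of \<alpha> as each summand does.\<close>

definition gap :: "('i \<Rightarrow> nat) \<Rightarrow> 'i state \<Rightarrow> real" where
  "gap \<alpha> z = (\<Sum>i\<in>UNIV. 1 - snd z i (\<alpha> i))"

lemma traj_0 [simp]: "traj \<alpha> 0 z = z" by (simp add: traj_def)

lemma traj_Suc: "traj \<alpha> (Suc m) z = upd (snd (traj \<alpha> m z)) \<alpha>" by (simp add: traj_def)

lemma traj_add: "traj \<alpha> (m + n) z = traj \<alpha> n (traj \<alpha> m z)"
  unfolding traj_def by (subst add.commute) (simp only: funpow_add o_apply)

lemma traj_Suc': "traj \<alpha> (Suc m) z = traj \<alpha> m (upd (snd z) \<alpha>)"
  unfolding traj_def by (subst funpow_Suc_right) simp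

lemma traj_states: "\<alpha> \<in> profs \<Longrightarrow> z \<in> states A \<Longrightarrow> traj \<alpha> m z \<in> states A"
  by (induction m) (auto simp: traj_Suc upd_states snd_states)

lemma stay_Suc': "stay \<alpha> (Suc m) z = (\<Prod>i\<in>UNIV. snd z i (\<alpha> i)) * stay \<alpha> m (upd (snd z) \<alpha>)"
  by (simp add: stay_def prod.lessThan_Suc_shift traj_Suc' del: prod.lessThan_Suc)

lemma stay_add: "stay \<alpha> (m + n) z = stay \<alpha> m z * stay \<alpha> n (traj \<alpha> m z)"
proof (induction m arbitrary: z)
  case 0
  then show ?case by (simp add: stay_def[where m=0])
next
  case (Suc m)
  then show ?case by (simp add: stay_Suc' traj_Suc')
qed

lemma stay_nonneg: "\<alpha> \<in> profs \<Longrightarrow> z \<in> states A \<Longrightarrow> 0 \<le> stay \<alpha> m z"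
  unfolding stay_def by (intro prod_nonneg) (auto intro!: prod_nonneg simp: stratsD(1)[OF snd_states] traj_states)

lemma stay_le_1: "\<alpha> \<in> profs \<Longrightarrow> z \<in> states A \<Longrightarrow> stay \<alpha> m z \<le> 1"
  unfolding stay_def
  by (intro prod_le_1) (auto intro!: prod_nonneg prod_le_1 simp: stratsD[OF snd_states] traj_states)

lemma Pt_stay_le:
  assumes "\<alpha> \<in> profs" "z \<in> states A" "\<And>z. z \<in> states A \<Longrightarrow> 0 \<le> f z"
  shows "stay \<alpha> m z * f (traj \<alpha> m z) \<le> (P ^^ m) f z"
  using assms(2)
proof (induction m arbitrary: z)
  case 0 then show ?case by (simp add: stay_def)
next
  case (Suc m)
  let ?w = "\<Prod>i\<in>UNIV. snd z i (\<alpha> i)"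
  have x: "snd z \<in> strats" using Suc by (simp add: snd_states)
  have "stay \<alpha> (Suc m) z * f (traj \<alpha> (Suc m) z) = ?w * (stay \<alpha> m (upd (snd z) \<alpha>) * f (traj \<alpha> m (upd (snd z) \<alpha>)))"
    by (simp add: stay_Suc' traj_Suc')
  also have "\<dots> \<le> ?w * (P ^^ m) f (upd (snd z) \<alpha>)"
    using Suc.IH[of "upd (snd z) \<alpha>"] x assms by (intro mult_left_mono) (auto simp: upd_states weight_nonneg)
  also have "\<dots> \<le> avg (snd z) ((P ^^ m) f) (snd z)"
    using x assms(1,3) Pt_mono[of "\<lambda>_. 0" f _ m] by (intro avg_single_le) (auto simp: Pt_const)
  finally show ?case by (simp add: P_def[of "(P ^^ m) f"])
qed

text \<open>The value after m steps splits into the event of playing a fixed profile m times and the rest.\<close>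
lemma Pt_le_stay:
  assumes "\<alpha> \<in> profs" "z \<in> states A" "\<And>z. z \<in> states A \<Longrightarrow> f z \<le> b"
  shows "(P ^^ m) f z \<le> (1 - stay \<alpha> m z) * b + stay \<alpha> m z * f (traj \<alpha> m z)"
proof -
  have "stay \<alpha> m z * (b - f (traj \<alpha> m z)) \<le> (P ^^ m) (\<lambda>z. b - f z) z"
    using assms by (intro Pt_stay_le) auto
  then show ?thesis using assms by (simp add: Pt_diff Pt_const algebra_simps)
qed

text \<open>Worst factor by which one update shrinks the distance to the unit vector of the played
  action; a maximum over a finite set, hence still below 1.\<close>

definition rate :: real where "rate = Max ((\<lambda>(i, \<alpha>). 1 - \<epsilon> * u i \<alpha>) ` (UNIV \<times> profs))"

lemma rate_ge: "\<alpha> \<in> profs \<Longrightarrow> 1 - \<epsilon> * u i \<alpha> \<le> rate"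
  unfolding rate_def by (rule Max_ge) auto

lemma rate_less_1: "rate < 1"
  unfolding rate_def using profs_ne step_pos by (subst Max_less_iff) (auto dest: profsD)

lemma rate_nonneg: "0 \<le> rate"
proof -
  obtain \<alpha> where a: "\<alpha> \<in> profs" using profs_ne by auto
  show ?thesis using rate_ge[OF a, of undefined] step_less_1[OF profsD[OF a], of undefined] by linarith
qed

lemma upd_own: "snd (upd x \<alpha>) i (\<alpha> i) = 1 - (1 - \<epsilon> * u i \<alpha>) * (1 - x i (\<alpha> i))"
  by (simp add: la_update_def unitv_def algebra_simps)

lemma upd_own_ge:
  assumes "x \<in> strats" "\<alpha> \<in> profs"
  shows "x i (\<alpha> i) \<le> snd (upd x \<alpha>) i (\<alpha> i)" "1 - snd (upd x \<alpha>) i (\<alpha> i) \<le> rate * (1 - x i (\<alpha> i))"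
proof -
  have s: "0 < \<epsilon> * u i \<alpha>" "\<epsilon> * u i \<alpha> < 1" using assms step_pos step_less_1 by (auto simp: profs_def)
  have y: "0 \<le> 1 - x i (\<alpha> i)" using stratsD[OF assms(1)] by simp
  have "(1 - \<epsilon> * u i \<alpha>) * (1 - x i (\<alpha> i)) \<le> 1 * (1 - x i (\<alpha> i))"
    using s y by (intro mult_right_mono) auto
  then show "x i (\<alpha> i) \<le> snd (upd x \<alpha>) i (\<alpha> i)" unfolding upd_own by simp
  show "1 - snd (upd x \<alpha>) i (\<alpha> i) \<le> rate * (1 - x i (\<alpha> i))"
    unfolding upd_own using y rate_ge[OF assms(2), of i] by (simp add: mult_right_mono)
qed

lemma gap_nonneg: "z \<in> states A \<Longrightarrow> 0 \<le> gap \<alpha> z"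
  unfolding gap_def by (intro sum_nonneg) (simp add: stratsD snd_states)

lemma gap_le: "z \<in> states A \<Longrightarrow> gap \<alpha> z \<le> CARD('i)"
  unfolding gap_def by (rule order.trans[OF sum_mono[where g="\<lambda>_. 1"]]) (auto simp: stratsD snd_states)

lemma gap_upd: "\<lbrakk>\<alpha> \<in> profs; z \<in> states A\<rbrakk> \<Longrightarrow> gap \<alpha> (upd (snd z) \<alpha>) \<le> rate * gap \<alpha> z"
  unfolding gap_def sum_distrib_left by (intro sum_mono upd_own_ge) (auto simp: snd_states)

lemma gap_traj:
  assumes "\<alpha> \<in> profs" "z \<in> states A" shows "gap \<alpha> (traj \<alpha> m z) \<le> rate ^ m * gap \<alpha> z"
proof (induction m)
  case (Suc m)
  have "gap \<alpha> (traj \<alpha> (Suc m) z) \<le> rate * gap \<alpha> (traj \<alpha> m z)"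
    unfolding traj_Suc using assms by (intro gap_upd traj_states)
  also have "\<dots> \<le> rate * (rate ^ m * gap \<alpha> z)" using Suc rate_nonneg by (intro mult_left_mono)
  finally show ?case by simp
qed simp

text \<open>Add up the probabilities of deviating: the one at step t is at most the gap there, hence
  at most \<open>rate ^ t * gap \<alpha> z\<close>, and the geometric series gives one bound for all
  \<open>m\<close>.\<close>

lemma stay_ge_gap:
  assumes "\<alpha> \<in> profs" "z \<in> states A" shows "1 - gap \<alpha> z / (1 - rate) \<le> stay \<alpha> m z"
  using assms(2)
proof (induction m arbitrary: z)
  case 0
  then show ?case using gap_nonneg[OF 0] rate_less_1 by (simp add: stay_def)
next
  case (Suc m)
  let ?y = "upd (snd z) \<alpha>" and ?w = "\<Prod>i\<in>UNIV. snd z i (\<alpha> i)"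
  have y: "?y \<in> states A" using Suc assms by (simp add: upd_states snd_states)
  have w: "1 - gap \<alpha> z \<le> ?w"
    using Weierstrass_prod_ineq[of UNIV "\<lambda>i. 1 - snd z i (\<alpha> i)"] Suc.prems
    by (auto simp: gap_def stratsD snd_states)
  have w1: "?w \<le> 1" using Suc.prems by (intro prod_le_1) (auto simp: stratsD snd_states)
  have w0: "0 \<le> ?w" using Suc.prems by (simp add: weight_nonneg snd_states)
  have g: "gap \<alpha> ?y \<le> rate * gap \<alpha> z" "0 \<le> gap \<alpha> ?y"
    using gap_upd[OF assms(1) Suc.prems] gap_nonneg[OF y] by auto
  have 1: "1 - gap \<alpha> ?y / (1 - rate) \<le> stay \<alpha> m ?y" by (rule Suc.IH[OF y])
  have 2: "?w - gap \<alpha> ?y / (1 - rate) \<le> ?w * (1 - gap \<alpha> ?y / (1 - rate))"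
  proof -
    have "0 \<le> gap \<alpha> ?y / (1 - rate)" using g rate_less_1 by simp
    then have "?w * (gap \<alpha> ?y / (1 - rate)) \<le> 1 * (gap \<alpha> ?y / (1 - rate))"
      using w1 by (intro mult_right_mono) auto
    then show ?thesis by (simp add: algebra_simps)
  qed
  have "gap \<alpha> ?y / (1 - rate) \<le> rate * gap \<alpha> z / (1 - rate)"
    using g rate_less_1 by (intro divide_right_mono) auto
  \<comment> \<open>Prepending a term to the geometric series reproduces its closed form, so the
    induction closes.\<close>
  moreover have "gap \<alpha> z + rate * gap \<alpha> z / (1 - rate) = gap \<alpha> z / (1 - rate)"
    using rate_less_1 by (simp add: field_simps)
  ultimately have "1 - gap \<alpha> z / (1 - rate) \<le> ?w - gap \<alpha> ?y / (1 - rate)" using w by linarith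
  also note 2
  also have "?w * (1 - gap \<alpha> ?y / (1 - rate)) \<le> ?w * stay \<alpha> m ?y"
    using 1 w0 by (rule mult_left_mono)
  finally show ?case by (simp add: stay_Suc')
qed

lemma traj_own_ge:
  assumes "\<alpha> \<in> profs" "z \<in> states A" shows "snd z i (\<alpha> i) \<le> snd (traj \<alpha> m z) i (\<alpha> i)"
proof (induction m)
  case (Suc m)
  also have "snd (traj \<alpha> m z) i (\<alpha> i) \<le> snd (traj \<alpha> (Suc m) z) i (\<alpha> i)"
    unfolding traj_Suc using assms by (intro upd_own_ge snd_states traj_states)
  finally show ?case .
qed simp

text \<open>During the first \<open>m0\<close> steps every own probability stays at least
  \<open>b\<close>, since replaying an action never lowers its probability. \<open>m0\<close> is
  chosen so that the gap then left costs at most half of the mass over all later steps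
  together.\<close>

lemma stay_uniform_ge:
  assumes "0 < b"
  shows "\<exists>c>0. \<exists>m0. \<forall>m\<ge>m0. \<forall>\<alpha>\<in>profs. \<forall>z\<in>states A. (\<forall>i. b \<le> snd z i (\<alpha> i)) \<longrightarrow> c \<le> stay \<alpha> m z"
proof -
  have "(\<lambda>m. rate ^ m) \<longlonglongrightarrow> 0"
    using rate_less_1 rate_nonneg by (intro LIMSEQ_power_zero) auto
  then have "(\<lambda>m. rate ^ m * CARD('i) / (1 - rate)) \<longlonglongrightarrow> 0 * CARD('i) / (1 - rate)"
    using rate_less_1 by (intro tendsto_divide tendsto_mult_right tendsto_const) auto
  then have "eventually (\<lambda>m. rate ^ m * CARD('i) / (1 - rate) < 1/2) sequentially"
    by (rule order_tendstoD) simp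
  then obtain m0 where m0: "rate ^ m0 * CARD('i) / (1 - rate) < 1/2"
    by (auto simp: eventually_sequentially)
  have main: "(b ^ CARD('i)) ^ m0 * (1/2) \<le> stay \<alpha> m z"
    if m: "m \<ge> m0" and a: "\<alpha> \<in> profs" and z: "z \<in> states A" and b: "\<forall>i. b \<le> snd z i (\<alpha> i)" for m \<alpha> z
  proof -
    have "(b ^ CARD('i)) ^ m0 = (\<Prod>t<m0. \<Prod>i\<in>(UNIV::'i set). b)" by simp
    also have "\<dots> \<le> stay \<alpha> m0 z"
      unfolding stay_def using assms b traj_own_ge[OF a z]
      by (intro prod_mono conjI prod_nonneg) (auto intro: order.trans less_imp_le)
    finally have 1: "(b ^ CARD('i)) ^ m0 \<le> stay \<alpha> m0 z" .
    have "gap \<alpha> (traj \<alpha> m0 z) \<le> rate ^ m0 * CARD('i)"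
      using gap_traj[OF a z, of m0] gap_le[OF z, of \<alpha>] rate_nonneg
      by (meson mult_left_mono order.trans zero_le_power)
    then have "gap \<alpha> (traj \<alpha> m0 z) / (1 - rate) \<le> 1/2"
      using m0 rate_less_1 by (smt (verit) divide_right_mono)
    then have 2: "1/2 \<le> stay \<alpha> (m - m0) (traj \<alpha> m0 z)"
      using stay_ge_gap[OF a traj_states[OF a z], of m0 "m - m0"] by simp
    have "stay \<alpha> m z = stay \<alpha> m0 z * stay \<alpha> (m - m0) (traj \<alpha> m0 z)"
      using stay_add[of \<alpha> m0 "m - m0" z] m by simp
    then show ?thesis using mult_mono[OF 1 2] assms stay_nonneg[OF a z, of m0] by simp
  qed
  show ?thesis
    using assms main by (intro exI[of _ "(b ^ CARD('i)) ^ m0 * (1/2)"] conjI exI[of _ m0]) auto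
qed

text \<open>Pigeonhole: if all actions of player i were below the bound, their total would be below
  1. The sum of all the cardinalities gives one bound common to the players.\<close>

lemma exists_likely_profile:
  assumes "z \<in> states A"
  shows "\<exists>\<alpha>\<in>profs. \<forall>i. 1 / (\<Sum>i\<in>UNIV. card (A i)) \<le> snd z i (\<alpha> i)"
proof -
  have x: "snd z \<in> strats" using assms by (rule snd_states)
  let ?b = "1 / real (\<Sum>i\<in>UNIV. card (A i))"
  have "\<exists>a\<in>A i. ?b \<le> snd z i a" for i
  proof (rule ccontr)
    assume "\<not> ?thesis"
    then have "(\<Sum>a\<in>A i. snd z i a) < (\<Sum>a\<in>A i. ?b)" by (intro sum_strict_mono) auto
    then have "1 < card (A i) * ?b" using stratsD[OF x] by simp
    moreover have c: "card (A i) \<le> (\<Sum>i\<in>UNIV. card (A i))" by (intro member_le_sum) auto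
    ultimately show False using card_A_pos[of i] by (simp add: field_simps del: of_nat_sum)
  qed
  then obtain \<alpha> where "\<And>i. \<alpha> i \<in> A i \<and> ?b \<le> snd z i (\<alpha> i)" by metis
  then show ?thesis by (auto simp: profs_def)
qed

subsection \<open>Uniform convergence of the unperturbed process\<close>

text \<open>Boundedness is part of the notion, so that sup-norm estimates are available without
  invoking compactness of \<open>states A\<close>.\<close>

definition good :: "('i state \<Rightarrow> real) \<Rightarrow> bool" where
  "good f \<longleftrightarrow> continuous_on (states A) f \<and> bounded (f ` states A)"

definition pure :: "('i \<Rightarrow> nat) \<Rightarrow> 'i state" where "pure \<alpha> = (\<alpha>, \<lambda>i. unitv (\<alpha> i))"

lemma pure_states_eq: "pure_states A = pure ` profs"
  by (auto simp: pure_states_def pure_def profs_def image_iff)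

lemma finite_pure_states [simp]: "finite (pure_states A)" by (simp add: pure_states_eq)

lemma pure_in_states: "\<alpha> \<in> profs \<Longrightarrow> pure \<alpha> \<in> states A"
  by (auto simp: states_def pure_def profs_def prob_simplex_def unitv_def)

lemma pure_states_subset: "s \<in> pure_states A \<Longrightarrow> s \<in> states A"
  by (auto simp: pure_states_eq pure_in_states)

lemma goodE:
  assumes "good f"
  obtains B where "0 \<le> B" "\<And>z. z \<in> states A \<Longrightarrow> \<bar>f z\<bar> \<le> B"
proof -
  obtain B where "\<And>z. z \<in> states A \<Longrightarrow> norm (f z) \<le> B"
    using assms by (auto simp: good_def bounded_iff)
  then have "\<bar>f z\<bar> \<le> max 0 B" if "z \<in> states A" for z
    using that by (metis max.coboundedI2 real_norm_def)
  then show thesis by (intro that[of "max 0 B"]) simp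
qed

lemma good_cont: "good f \<Longrightarrow> continuous_on (states A) f" by (simp add: good_def)

lemma goodI: "continuous_on (states A) f \<Longrightarrow> (\<And>z. z \<in> states A \<Longrightarrow> \<bar>f z\<bar> \<le> B) \<Longrightarrow> good f"
  unfolding good_def bounded_iff by (metis imageE real_norm_def)

lemma continuous_on_strategy: "continuous_on S (\<lambda>z::'i state. snd z i a)"
  using continuous_on_product_then_coordinatewise[OF continuous_on_product_then_coordinatewise[OF
      continuous_on_snd[OF continuous_on_id]]] .

lemma continuous_on_upd: "continuous_on S (\<lambda>z::'i state. upd (snd z) \<alpha>)"
  unfolding la_update_def
  by (intro continuous_on_Pair continuous_on_const continuous_on_coordinatewise_then_product
      continuous_on_add continuous_on_mult continuous_on_diff continuous_on_strategy)

lemma continuous_on_avg: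
  assumes "continuous_on (states A) f" "\<And>i a. continuous_on (states A) (\<lambda>z. p z i a)"
  shows "continuous_on (states A) (\<lambda>z. avg (p z) f (snd z))"
  unfolding avg_def
proof (intro continuous_on_sum continuous_on_mult continuous_on_prod assms(2))
  fix \<alpha> assume "\<alpha> \<in> profs"
  then show "continuous_on (states A) (\<lambda>z. f (upd (snd z) \<alpha>))"
    by (intro continuous_on_compose2[OF assms(1) continuous_on_upd] image_subsetI upd_states snd_states)
qed

lemma avg_bound:
  assumes "p \<in> strats" "x \<in> strats" "\<And>z. z \<in> states A \<Longrightarrow> \<bar>f z\<bar> \<le> B"
  shows "\<bar>avg p f x\<bar> \<le> B"
  using avg_abs_le[OF assms(1,2), of f] avg_mono[OF assms(1,2), of "\<lambda>z. \<bar>f z\<bar>" "\<lambda>_. B"] assms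
  by (simp add: avg_const)

lemma good_P: assumes "good f" shows "good (P f)"
proof -
  obtain B where "\<And>z. z \<in> states A \<Longrightarrow> \<bar>f z\<bar> \<le> B" using goodE[OF assms] by blast
  then show ?thesis unfolding P_def using good_cont[OF assms]
    by (intro goodI[of _ B] continuous_on_avg avg_bound continuous_on_strategy) (auto simp: snd_states)
qed

lemma good_Q: assumes "good f" shows "good (Q f)"
proof -
  obtain B where B: "\<And>z. z \<in> states A \<Longrightarrow> \<bar>f z\<bar> \<le> B" using goodE[OF assms] by blast
  have "\<bar>\<Sum>j\<in>UNIV. avg (one_trem j (snd z)) f (snd z)\<bar> \<le> (\<Sum>j\<in>(UNIV::'i set). B)" if "z \<in> states A" for z
    by (rule order.trans[OF sum_abs sum_mono]) (use that B in \<open>auto intro!: avg_bound one_trem_strats snd_states\<close>)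
  moreover have "continuous_on (states A) (\<lambda>z. one_trem j (snd z) i a)" for i j a
    unfolding one_trem_def by (cases "i = j"; cases "a \<in> A i") (simp_all add: continuous_on_strategy)
  ultimately show ?thesis unfolding Q_def using good_cont[OF assms]
    by (intro goodI[of _ B] continuous_on_divide continuous_on_sum continuous_on_const continuous_on_avg)
       (auto simp: field_simps)
qed

lemma good_T: assumes "good f" "0 \<le> l" "l \<le> 1" shows "good (T l f)"
proof -
  obtain B where "\<And>z. z \<in> states A \<Longrightarrow> \<bar>f z\<bar> \<le> B" using goodE[OF assms(1)] by blast
  moreover have "continuous_on (states A) (\<lambda>z. trem l (snd z) i a)" for i a
    unfolding trem_def
    by (cases "a \<in> A i") (simp_all add: continuous_on_strategy continuous_on_mult continuous_on_add)
  ultimately show ?thesis unfolding T_def using good_cont[OF assms(1)] assms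
    by (intro goodI[of _ B] continuous_on_avg avg_bound) (auto simp: snd_states trem_strats)
qed

lemma good_Pt: "good f \<Longrightarrow> good ((P ^^ t) f)"
  by (induction t) (auto intro: good_P)

lemma good_add: "good f \<Longrightarrow> good g \<Longrightarrow> good (\<lambda>z. f z + g z)"
  unfolding good_def by (auto intro!: continuous_on_add bounded_plus_comp)

lemma good_cmult: "good f \<Longrightarrow> good (\<lambda>z. c * f z)"
  unfolding good_def
  by (auto intro!: continuous_on_mult continuous_on_const bounded_scaling simp: image_image
      dest: bounded_scaling[of _ c])

lemma good_const: "good (\<lambda>_. c)"
  by (rule goodI[of _ "\<bar>c\<bar>"]) auto

lemma good_sum: "(\<And>k. k \<in> I \<Longrightarrow> good (f k)) \<Longrightarrow> good (\<lambda>z. \<Sum>k\<in>I. f k z)"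
  by (induction I rule: infinite_finite_induct) (auto intro: good_const good_add)

lemma good_diff: "good f \<Longrightarrow> good g \<Longrightarrow> good (\<lambda>z. f z - g z)"
  unfolding good_def by (auto intro!: continuous_on_diff bounded_minus_comp)

lemma upd_unitv:
  "snd (upd x \<alpha>) i a - unitv (\<alpha> i) a = (1 - \<epsilon> * u i \<alpha>) * (x i a - unitv (\<alpha> i) a)"
  by (simp add: la_update_def algebra_simps)

lemma traj_unitv:
  assumes "\<alpha> \<in> profs" "z \<in> states A"
  shows "\<bar>snd (traj \<alpha> m z) i a - unitv (\<alpha> i) a\<bar> \<le> rate ^ m"
proof (induction m)
  case 0
  show ?case using stratsD(1,4)[OF snd_states[OF assms(2)], of i a] by (auto simp: unitv_def)
next
  case (Suc m)
  have "\<bar>1 - \<epsilon> * u i \<alpha>\<bar> \<le> rate"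
    using rate_ge[OF assms(1), of i] step_less_1[OF profsD[OF assms(1)], of i] by auto
  then have "\<bar>1 - \<epsilon> * u i \<alpha>\<bar> * \<bar>snd (traj \<alpha> m z) i a - unitv (\<alpha> i) a\<bar> \<le> rate * rate ^ m"
    using Suc rate_nonneg by (intro mult_mono) auto
  then show ?case by (simp add: traj_Suc upd_unitv abs_mult)
qed

lemma rate_power_tendsto: "(\<lambda>m. rate ^ m) \<longlonglongrightarrow> 0"
  using rate_less_1 rate_nonneg by (intro LIMSEQ_power_zero) auto

text \<open>The starting points may vary with \<open>k\<close>, since the error
  \<open>rate ^ m k\<close> does not depend on them. At least one step must be made: only then is
  the action component equal to \<alpha>.\<close>

lemma traj_tendsto_pure:
  assumes "\<alpha> \<in> profs" "\<And>k. z k \<in> states A" "filterlim m at_top sequentially" "\<And>k. 0 < m k"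
  shows "(\<lambda>k. traj \<alpha> (m k) (z k)) \<longlonglongrightarrow> pure \<alpha>"
proof -
  have "fst (traj \<alpha> (m k) (z k)) = \<alpha>" for k using assms(4)[of k] by (cases "m k") (auto simp: traj_Suc)
  then have eq: "traj \<alpha> (m k) (z k) = (\<alpha>, snd (traj \<alpha> (m k) (z k)))" for k by (metis prod.collapse)
  have "(\<lambda>k. snd (traj \<alpha> (m k) (z k)) i a) \<longlonglongrightarrow> unitv (\<alpha> i) a" for i a
  proof (rule LIM_zero_cancel, rule Lim_null_comparison)
    show "\<forall>\<^sub>F k in sequentially. norm (snd (traj \<alpha> (m k) (z k)) i a - unitv (\<alpha> i) a) \<le> rate ^ m k"
      using traj_unitv[OF assms(1,2)] by simp
    show "(\<lambda>k. rate ^ m k) \<longlonglongrightarrow> 0"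
      using filterlim_compose[OF rate_power_tendsto assms(3)] .
  qed
  then have "(\<lambda>k. (\<alpha>, snd (traj \<alpha> (m k) (z k)))) \<longlonglongrightarrow> (\<alpha>, \<lambda>i. unitv (\<alpha> i))"
    by (intro tendsto_Pair tendsto_const tendsto_funI)
  then show ?thesis unfolding pure_def using eq by simp
qed

text \<open>Counterexamples with growing \<open>m\<close> would give trajectories converging to
  \<open>pure \<alpha>\<close>, against continuity of \<open>f\<close> there. This yields uniformity
  over all starting points; the finitely many profiles then share one \<open>m0\<close>.\<close>

lemma traj_close:
  assumes f: "good f" and "0 < e"
  shows "\<exists>m0. \<forall>m\<ge>m0. \<forall>\<alpha>\<in>profs. \<forall>z\<in>states A. \<bar>f (traj \<alpha> m z) - f (pure \<alpha>)\<bar> < e"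
proof -
  have single: "\<exists>m0. \<forall>m\<ge>m0. \<forall>z\<in>states A. \<bar>f (traj \<alpha> m z) - f (pure \<alpha>)\<bar> < e" if a: "\<alpha> \<in> profs" for \<alpha>
  proof (rule ccontr)
    assume "\<not> ?thesis"
    then have "\<forall>m0. \<exists>m z. m \<ge> m0 \<and> z \<in> states A \<and> e \<le> \<bar>f (traj \<alpha> m z) - f (pure \<alpha>)\<bar>"
      by (meson not_less)
    \<comment> \<open>\<open>Suc k\<close> rather than \<open>k\<close> rules out the empty
      trajectory.\<close>
    then have "\<forall>k. \<exists>m z. m \<ge> Suc k \<and> z \<in> states A \<and> e \<le> \<bar>f (traj \<alpha> m z) - f (pure \<alpha>)\<bar>" by blast
    then obtain m z where mz: "\<And>k. m k \<ge> Suc k" "\<And>k. z k \<in> states A"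
        "\<And>k. e \<le> \<bar>f (traj \<alpha> (m k) (z k)) - f (pure \<alpha>)\<bar>"
      by metis
    have "filterlim m at_top sequentially"
      by (rule filterlim_at_top_mono[OF filterlim_Suc]) (use mz in auto)
    moreover have "0 < m k" for k using mz(1)[of k] by simp
    ultimately have "(\<lambda>k. traj \<alpha> (m k) (z k)) \<longlonglongrightarrow> pure \<alpha>"
      using a mz by (intro traj_tendsto_pure)
    then have "(\<lambda>k. f (traj \<alpha> (m k) (z k))) \<longlonglongrightarrow> f (pure \<alpha>)"
      using mz a by (intro continuous_on_tendsto_compose[OF good_cont[OF f]])
        (auto simp: pure_in_states traj_states)
    then have "(\<lambda>k. \<bar>f (traj \<alpha> (m k) (z k)) - f (pure \<alpha>)\<bar>) \<longlonglongrightarrow> \<bar>f (pure \<alpha>) - f (pure \<alpha>)\<bar>"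
      by (intro tendsto_rabs tendsto_diff tendsto_const)
    then have "e \<le> \<bar>f (pure \<alpha>) - f (pure \<alpha>)\<bar>"
      by (rule LIMSEQ_le_const) (use mz in auto)
    then show False using assms by simp
  qed
  then obtain M where M: "\<And>\<alpha> m z. \<alpha> \<in> profs \<Longrightarrow> m \<ge> M \<alpha> \<Longrightarrow> z \<in> states A \<Longrightarrow> \<bar>f (traj \<alpha> m z) - f (pure \<alpha>)\<bar> < e"
    by metis
  have "M \<alpha> \<le> (\<Sum>\<alpha>\<in>profs. M \<alpha>)" if "\<alpha> \<in> profs" for \<alpha> using that by (intro member_le_sum) auto
  then show ?thesis using M by (intro exI[of _ "\<Sum>\<alpha>\<in>profs. M \<alpha>"]) (meson order.trans)
qed

text \<open>The point is uniformity in \<open>t\<close>. From a state with small gap, \<alpha> is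
  repeated \<open>t\<close> times except on an event of probability at most gap / (1 - rate), which
  costs at most \<open>2 * B\<close>; on the main event the trajectory is only longer, so
  \<open>f\<close> is still close to its value at \<open>pure \<alpha>\<close>.\<close>

lemma Pt_near_pure:
  assumes f: "good f" and e: "0 < e"
  shows "\<exists>m0. \<forall>m\<ge>m0. \<forall>\<alpha>\<in>profs. \<forall>z\<in>states A. \<forall>t. \<bar>(P ^^ t) f (traj \<alpha> m z) - f (pure \<alpha>)\<bar> < e"
proof -
  obtain B where B: "0 \<le> B" "\<And>z. z \<in> states A \<Longrightarrow> \<bar>f z\<bar> \<le> B" using goodE[OF f] by blast
  obtain m1 where m1: "\<And>m \<alpha> z. \<lbrakk>m \<ge> m1; \<alpha> \<in> profs; z \<in> states A\<rbrakk> \<Longrightarrow> \<bar>f (traj \<alpha> m z) - f (pure \<alpha>)\<bar> < e / 2"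
    using traj_close[OF f, of "e / 2"] e by auto
  have "(\<lambda>m. rate ^ m * CARD('i) / (1 - rate) * (2 * B)) \<longlonglongrightarrow> 0 * CARD('i) / (1 - rate) * (2 * B)"
    using rate_less_1 rate_power_tendsto by (intro tendsto_divide tendsto_mult_right tendsto_const) auto
  then have "eventually (\<lambda>m. rate ^ m * CARD('i) / (1 - rate) * (2 * B) < e / 2) sequentially"
    by (rule order_tendstoD) (use e in simp)
  then obtain m2 where m2: "\<And>m. m \<ge> m2 \<Longrightarrow> rate ^ m * CARD('i) / (1 - rate) * (2 * B) < e / 2"
    by (auto simp: eventually_sequentially)
  have "\<bar>(P ^^ t) f (traj \<alpha> m z) - f (pure \<alpha>)\<bar> < e"
    if m: "m \<ge> max m1 m2" and a: "\<alpha> \<in> profs" and z: "z \<in> states A" for m \<alpha> z t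
  proof -
    let ?y = "traj \<alpha> m z" and ?c = "f (pure \<alpha>)"
    let ?g = "\<lambda>z. \<bar>f z - ?c\<bar>"
    have y: "?y \<in> states A" using a z by (rule traj_states)
    have g: "?g z \<le> 2 * B" if "z \<in> states A" for z
      using B(2)[OF that] B(2)[OF pure_in_states[OF a]] by linarith
    have "\<bar>(P ^^ t) f ?y - ?c\<bar> = \<bar>(P ^^ t) (\<lambda>z. f z - ?c) ?y\<bar>"
      using y by (simp add: Pt_diff Pt_const)
    also have "\<dots> \<le> (P ^^ t) ?g ?y" by (rule Pt_abs_le[OF y])
    also have "\<dots> \<le> (1 - stay \<alpha> t ?y) * (2 * B) + stay \<alpha> t ?y * ?g (traj \<alpha> t ?y)"
      using g by (intro Pt_le_stay[OF a y])
    also have "\<dots> \<le> gap \<alpha> ?y / (1 - rate) * (2 * B) + 1 * ?g (traj \<alpha> t ?y)"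
      using stay_ge_gap[OF a y, of t] stay_le_1[OF a y, of t] B(1)
      by (intro add_mono mult_right_mono) auto
    also have "\<dots> \<le> rate ^ m * CARD('i) / (1 - rate) * (2 * B) + ?g (traj \<alpha> (m + t) z)"
    proof -
      have "gap \<alpha> ?y \<le> rate ^ m * CARD('i)"
        using gap_traj[OF a z, of m] gap_le[OF z, of \<alpha>] rate_nonneg
        by (meson mult_left_mono order.trans zero_le_power)
      then show ?thesis using B rate_less_1
        by (auto simp: traj_add intro!: mult_right_mono divide_right_mono)
    qed
    also have "\<dots> < e / 2 + e / 2" using m m2 m1[OF _ a z, of "m + t"] by (intro add_strict_mono) auto
    finally show ?thesis by simp
  qed
  then show ?thesis by blast
qed

text \<open>The profile depends on \<open>z\<close> and \<open>m\<close>, the constants do not. The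
  bound \<open>c \<le> 1\<close> makes \<open>1 - c\<close> usable as a contraction factor.\<close>

lemma stay_uniform:
  "\<exists>c>0. c \<le> 1 \<and> (\<exists>m0. \<forall>m\<ge>m0. \<forall>z\<in>states A. \<exists>\<alpha>\<in>profs. c \<le> stay \<alpha> m z)"
proof -
  let ?b = "1 / real (\<Sum>i\<in>UNIV. card (A i))"
  have "0 < (\<Sum>i\<in>UNIV. card (A i))" by (intro sum_pos) (auto simp: card_gt_0_iff)
  then have "0 < ?b" by (simp del: of_nat_sum)
  from stay_uniform_ge[OF this] obtain c m0 where c: "c > 0"
    "\<And>m \<alpha> z. \<lbrakk>m \<ge> m0; \<alpha> \<in> profs; z \<in> states A; \<forall>i. ?b \<le> snd z i (\<alpha> i)\<rbrakk> \<Longrightarrow> c \<le> stay \<alpha> m z" by blast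
  have "\<exists>\<alpha>\<in>profs. min c 1 \<le> stay \<alpha> m z" if "m \<ge> m0" "z \<in> states A" for m z
    using exists_likely_profile[OF that(2)] c(2)[OF that(1) _ that(2)] by (meson min.coboundedI1)
  then show ?thesis using c(1) by (intro exI[of _ "min c 1"] conjI exI[of _ m0] allI ballI impI) auto
qed

text \<open>Doeblin-type argument over blocks of \<open>m\<close> steps. With probability at least
  \<open>c\<close> a block ends near a pure state, where two iterates differ by less than
  \<open>2 * d\<close>; otherwise the previous bound applies. The recursion b' = (1 - c) b + 2 d has
  the fixed point \<open>2 * d / c\<close>.\<close>

lemma Pt_uniformly_Cauchy:
  assumes f: "good f" shows "uniformly_Cauchy_on (states A) (\<lambda>t. (P ^^ t) f)"
proof (rule uniformly_Cauchy_onI)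
  fix e :: real assume e: "0 < e"
  obtain B where B: "0 \<le> B" "\<And>z. z \<in> states A \<Longrightarrow> \<bar>f z\<bar> \<le> B" using goodE[OF f] by blast
  obtain c m0 where c: "0 < c" "c \<le> 1"
    and m0: "\<And>m z. \<lbrakk>m \<ge> m0; z \<in> states A\<rbrakk> \<Longrightarrow> \<exists>\<alpha>\<in>profs. c \<le> stay \<alpha> m z"
    using stay_uniform by blast
  \<comment> \<open>Chosen so that the fixed point \<open>2 * d / c\<close> of the recursion equals
    \<open>e / 4\<close>.\<close>
  define d where "d = e * c / 8"
  have d: "0 < d" using e c by (simp add: d_def)
  obtain m1 where m1: "\<And>m \<alpha> z t. \<lbrakk>m \<ge> m1; \<alpha> \<in> profs; z \<in> states A\<rbrakk> \<Longrightarrow>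
      \<bar>(P ^^ t) f (traj \<alpha> m z) - f (pure \<alpha>)\<bar> < d"
    using Pt_near_pure[OF f d] by blast
  define m where "m = max m0 m1"
  have iter: "\<bar>(P ^^ t) f z - (P ^^ t') f z\<bar> \<le> (1 - c) ^ k * (2 * B) + 2 * d / c"
    if "t \<ge> k * m" "t' \<ge> k * m" "z \<in> states A" for k t t' z
    using that
  proof (induction k arbitrary: t t' z)
    case 0
    have "\<bar>(P ^^ t) f z\<bar> \<le> B" for t using 0(3) B(2) by (rule Pt_bound)
    from this[of t] this[of t'] have "\<bar>(P ^^ t) f z - (P ^^ t') f z\<bar> \<le> 2 * B" by linarith
    moreover have "0 \<le> 2 * d / c" using c d by simp
    ultimately show ?case by simp
  next
    case (Suc k)
    define s s' where "s = t - m" and "s' = t' - m"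
    have ss: "t = m + s" "t' = m + s'" "s \<ge> k * m" "s' \<ge> k * m"
      using Suc.prems by (auto simp: s_def s'_def)
    let ?g = "\<lambda>z. \<bar>(P ^^ s) f z - (P ^^ s') f z\<bar>"
    let ?b = "(1 - c) ^ k * (2 * B) + 2 * d / c"
    obtain \<alpha> where a: "\<alpha> \<in> profs" "c \<le> stay \<alpha> m z"
      using m0[of m z] Suc.prems by (auto simp: m_def)
    have b: "0 \<le> ?b" using B c d by simp
    have "(P ^^ t) f z - (P ^^ t') f z = (P ^^ m) (\<lambda>z. (P ^^ s) f z - (P ^^ s') f z) z"
      by (simp add: ss funpow_add Pt_diff)
    then have "\<bar>(P ^^ t) f z - (P ^^ t') f z\<bar> \<le> (P ^^ m) ?g z"
      using Pt_abs_le[OF Suc.prems(3)] by simp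
    also have "\<dots> \<le> (1 - stay \<alpha> m z) * ?b + stay \<alpha> m z * ?g (traj \<alpha> m z)"
      using Suc.IH[OF ss(3,4)] by (intro Pt_le_stay[OF a(1) Suc.prems(3)])
    also have "\<dots> \<le> (1 - c) * ?b + 1 * (2 * d)"
    proof (intro add_mono mult_right_mono mult_mono)
      show "?g (traj \<alpha> m z) \<le> 2 * d"
        using m1[OF _ a(1) Suc.prems(3), of m s] m1[OF _ a(1) Suc.prems(3), of m s']
        unfolding m_def by linarith
    qed (use a b stay_le_1[OF a(1) Suc.prems(3)] in auto)
    also have "\<dots> = (1 - c) ^ Suc k * (2 * B) + 2 * d / c"
      using c by (simp add: field_simps)
    finally show ?case .
  qed
  have "(\<lambda>k. (1 - c) ^ k * (2 * B)) \<longlonglongrightarrow> 0 * (2 * B)"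
    using c by (intro tendsto_mult_right LIMSEQ_power_zero) auto
  then have "eventually (\<lambda>k. (1 - c) ^ k * (2 * B) < e / 2) sequentially"
    by (rule order_tendstoD) (use e in simp)
  then obtain k where k: "(1 - c) ^ k * (2 * B) < e / 2" by (auto simp: eventually_sequentially)
  have dc: "2 * d / c = e / 4" using c by (simp add: d_def)
  have "dist ((P ^^ t) f z) ((P ^^ t') f z) < e" if "t \<ge> k * m" "t' \<ge> k * m" "z \<in> states A" for t t' z
    using iter[OF that] k e unfolding dc dist_real_def by linarith
  then show "\<exists>M. \<forall>z\<in>states A. \<forall>t\<ge>M. \<forall>t'\<ge>M. dist ((P ^^ t) f z) ((P ^^ t') f z) < e" by blast
qed

section \<open>Harmonic limits and absorption probabilities\<close>

definition H :: "('i state \<Rightarrow> real) \<Rightarrow> 'i state \<Rightarrow> real" where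
  "H f z = lim (\<lambda>t. (P ^^ t) f z)"

lemma Pt_uniform_limit: "good f \<Longrightarrow> uniform_limit (states A) (\<lambda>t. (P ^^ t) f) (H f) sequentially"
  using Cauchy_uniformly_convergent[OF Pt_uniformly_Cauchy]
  unfolding uniformly_convergent_uniform_limit_iff H_def .

lemma Pt_tendsto: "good f \<Longrightarrow> z \<in> states A \<Longrightarrow> (\<lambda>t. (P ^^ t) f z) \<longlonglongrightarrow> H f z"
  by (rule tendsto_uniform_limitI[OF Pt_uniform_limit])

lemma good_H: assumes "good f" shows "good (H f)"
proof -
  obtain B where B: "\<And>z. z \<in> states A \<Longrightarrow> \<bar>f z\<bar> \<le> B" using goodE[OF assms] by blast
  have "\<bar>H f z\<bar> \<le> B" if z: "z \<in> states A" for z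
    by (rule LIMSEQ_le_const2[OF tendsto_rabs[OF Pt_tendsto[OF assms z]]])
       (use Pt_bound[OF z B] in auto)
  moreover have "continuous_on (states A) (H f)"
    by (rule uniform_limit_theorem[OF _ Pt_uniform_limit[OF assms]])
       (auto intro!: always_eventually good_cont good_Pt assms)
  ultimately show ?thesis by (intro goodI)
qed

text \<open>At each state \<open>P\<close> is a finite weighted sum of point evaluations, so
  pointwise limits pass through it.\<close>

lemma P_H: assumes "good f" "z \<in> states A" shows "P (H f) z = H f z"
proof -
  have "(\<lambda>t. P ((P ^^ t) f) z) \<longlonglongrightarrow> P (H f) z"
    unfolding P_def[of _ z] avg_def using assms
    by (intro tendsto_sum tendsto_mult tendsto_const Pt_tendsto upd_states) (auto simp: snd_states)
  moreover have "(\<lambda>t. P ((P ^^ t) f) z) \<longlonglongrightarrow> H f z"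
    using LIMSEQ_Suc[OF Pt_tendsto[OF assms]] by simp
  ultimately show ?thesis by (rule LIMSEQ_unique)
qed

text \<open>Pure states are absorbing: all weight sits on \<alpha>, and the update moves each unit
  vector towards itself.\<close>

lemma P_pure:
  assumes "\<alpha> \<in> profs" shows "P f (pure \<alpha>) = f (pure \<alpha>)"
proof -
  have "(\<Prod>i\<in>UNIV. unitv (\<alpha> i) (\<beta> i)) = (if \<beta> = \<alpha> then 1 else 0)" for \<beta> :: "'i \<Rightarrow> nat"
    by (auto simp: unitv_def fun_eq_iff)
  moreover have "upd (\<lambda>i. unitv (\<alpha> i)) \<alpha> = pure \<alpha>"
    by (simp add: la_update_def pure_def)
  ultimately show ?thesis using assms
    by (simp add: P_def avg_def pure_def if_distrib[of "\<lambda>c. c * _"] sum.delta cong: if_cong)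
qed

lemma Pt_pure: "\<alpha> \<in> profs \<Longrightarrow> (P ^^ t) f (pure \<alpha>) = f (pure \<alpha>)"
  by (induction t) (auto simp: P_pure)

lemma H_pure: "s \<in> pure_states A \<Longrightarrow> H f s = f s"
  by (auto simp: H_def pure_states_eq Pt_pure)

lemma Pt_harmonic:
  assumes "\<And>z. z \<in> states A \<Longrightarrow> P h z = h z" "z \<in> states A"
  shows "(P ^^ t) h z = h z"
  using assms(2)
proof (induction t arbitrary: z)
  case (Suc t)
  then have "P ((P ^^ t) h) z = P h z" unfolding P_def[of _ z] by (intro avg_cong) (auto simp: snd_states)
  then show ?case using Suc assms by simp
qed simp

text \<open>Maximum principle with the pure states as boundary: a block of steps comes near them
  with probability at least \<open>c\<close>, so the sup norm shrinks by the factor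
  \<open>1 - c\<close> per block.\<close>

lemma harmonic_eq_0:
  assumes h: "good h" "\<And>z. z \<in> states A \<Longrightarrow> P h z = h z" "\<And>s. s \<in> pure_states A \<Longrightarrow> h s = 0"
    and "z \<in> states A"
  shows "h z = 0"
proof -
  obtain B where B: "0 \<le> B" "\<And>z. z \<in> states A \<Longrightarrow> \<bar>h z\<bar> \<le> B" using goodE[OF h(1)] by blast
  obtain c m0 where c: "0 < c" "c \<le> 1"
    and m0: "\<And>m z. \<lbrakk>m \<ge> m0; z \<in> states A\<rbrakk> \<Longrightarrow> \<exists>\<alpha>\<in>profs. c \<le> stay \<alpha> m z"
    using stay_uniform by blast
  have iter: "\<bar>h z\<bar> \<le> (1 - c) ^ k * B" if "z \<in> states A" for k z
    using that
  proof (induction k arbitrary: z)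
    case 0 then show ?case using B by simp
  next
    case (Suc k)
    let ?b = "(1 - c) ^ k * B"
    show ?case
    proof (rule field_le_epsilon)
      \<comment> \<open>The block length depends on \<open>e\<close>, but \<open>c\<close> does not;
        so \<open>e\<close> can tend to 0 while the factor \<open>1 - c\<close> is kept.\<close>
      fix e :: real assume "0 < e"
      then obtain m1 where m1: "\<And>m \<alpha> z. \<lbrakk>m \<ge> m1; \<alpha> \<in> profs; z \<in> states A\<rbrakk> \<Longrightarrow> \<bar>h (traj \<alpha> m z) - h (pure \<alpha>)\<bar> < e"
        using traj_close[OF h(1)] by blast
      define m where "m = max m0 m1"
      obtain \<alpha> where a: "\<alpha> \<in> profs" "c \<le> stay \<alpha> m z" using m0[of m z] Suc.prems by (auto simp: m_def)
      have "\<bar>h z\<bar> = \<bar>(P ^^ m) h z\<bar>" using Pt_harmonic[OF h(2)] Suc.prems by simp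
      also have "\<dots> \<le> (P ^^ m) (\<lambda>z. \<bar>h z\<bar>) z" by (rule Pt_abs_le[OF Suc.prems])
      also have "\<dots> \<le> (1 - stay \<alpha> m z) * ?b + stay \<alpha> m z * \<bar>h (traj \<alpha> m z)\<bar>"
        using Suc.IH by (intro Pt_le_stay[OF a(1) Suc.prems])
      also have "\<dots> \<le> (1 - c) * ?b + 1 * e"
      proof (intro add_mono mult_right_mono mult_mono)
        show "\<bar>h (traj \<alpha> m z)\<bar> \<le> e"
          using m1[of m \<alpha> z] a Suc.prems h(3)[of "pure \<alpha>"] by (simp add: m_def pure_states_eq)
      qed (use a B c stay_le_1[OF a(1) Suc.prems] in auto)
      finally show "\<bar>h z\<bar> \<le> (1 - c) ^ Suc k * B + e" by simp
    qed
  qed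
  have "(\<lambda>k. (1 - c) ^ k * B) \<longlonglongrightarrow> 0 * B"
    using c by (intro tendsto_mult_right LIMSEQ_power_zero) auto
  then have "\<bar>h z\<bar> \<le> 0 * B" by (rule LIMSEQ_le_const) (use iter[OF assms(4)] in auto)
  then show ?thesis by simp
qed

lemma P_diff: "P (\<lambda>z. f z - g z) z = P f z - P g z"
  by (simp add: P_def avg_diff)

lemma harmonic_eqI:
  assumes f: "good f" "\<And>z. z \<in> states A \<Longrightarrow> P f z = f z"
    and g: "good g" "\<And>z. z \<in> states A \<Longrightarrow> P g z = g z"
    and eq: "\<And>s. s \<in> pure_states A \<Longrightarrow> f s = g s" and z: "z \<in> states A"
  shows "f z = g z"
  using harmonic_eq_0[of "\<lambda>z. f z - g z" z] assms by (simp add: good_diff P_diff)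

text \<open>A continuous substitute for the indicator of \<open>s\<close> among the pure states: the
  others lie at distance at least 1. Like \<open>nbhd\<close>, it measures distance by the
  strategies only.\<close>

definition bump :: "'i state \<Rightarrow> 'i state \<Rightarrow> real" where
  "bump s z = max 0 (1 - strat_dist A (snd z) (snd s))"

definition absorb :: "'i state \<Rightarrow> 'i state \<Rightarrow> real" where
  "absorb s = H (bump s)"

lemma continuous_on_strat_dist: "continuous_on S (\<lambda>z::'i state. strat_dist A (snd z) x)"
  unfolding strat_dist_def
  by (intro continuous_on_real_sqrt continuous_on_sum continuous_on_power continuous_on_diff
      continuous_on_const continuous_on_strategy)

lemma strat_dist_nonneg: "0 \<le> strat_dist A x y"
  unfolding strat_dist_def by (intro real_sqrt_ge_zero sum_nonneg) auto

lemma strat_dist_self [simp]: "strat_dist A x x = 0" by (simp add: strat_dist_def)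

text \<open>A single player whose actions differ already contributes 1. This separation fixes the
  width of \<open>bump\<close> and the bound 1/2 on \<delta>.\<close>

lemma strat_dist_pure:
  assumes "s \<in> pure_states A" "s' \<in> pure_states A" "s \<noteq> s'"
  shows "1 \<le> strat_dist A (snd s) (snd s')"
proof -
  obtain \<alpha> \<beta> where ab: "s = pure \<alpha>" "s' = pure \<beta>" "\<alpha> \<in> profs" "\<beta> \<in> profs" using assms by (auto simp: pure_states_eq)
  then obtain i where i: "\<alpha> i \<noteq> \<beta> i" using assms(3) by (metis ext)
  have "1 = (snd s i (\<alpha> i) - snd s' i (\<alpha> i))\<^sup>2" using i ab by (simp add: pure_def unitv_def)
  also have "\<dots> \<le> (\<Sum>a\<in>A i. (snd s i a - snd s' i a)\<^sup>2)"
    using ab(3) by (intro member_le_sum) (auto simp: profsD)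
  also have "\<dots> \<le> (\<Sum>i\<in>UNIV. \<Sum>a\<in>A i. (snd s i a - snd s' i a)\<^sup>2)"
    by (intro member_le_sum[of i UNIV "\<lambda>i. \<Sum>a\<in>A i. (snd s i a - snd s' i a)\<^sup>2"] sum_nonneg) auto
  finally show ?thesis unfolding strat_dist_def by simp
qed

lemma good_bump: "good (bump s)"
  unfolding bump_def
  by (intro goodI[of _ 1] continuous_on_max continuous_on_diff continuous_on_const continuous_on_strat_dist)
     (use strat_dist_nonneg in auto)

lemma good_absorb: "good (absorb s)" unfolding absorb_def by (rule good_H[OF good_bump])

lemma P_absorb: "z \<in> states A \<Longrightarrow> P (absorb s) z = absorb s z"
  unfolding absorb_def by (rule P_H[OF good_bump])

lemma absorb_pure:
  assumes "s \<in> pure_states A" "s' \<in> pure_states A"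
  shows "absorb s s' = (if s' = s then 1 else 0)"
  using strat_dist_pure[OF assms(2,1)] assms by (auto simp: absorb_def H_pure bump_def)

lemma absorb_nonneg: assumes "z \<in> states A" shows "0 \<le> absorb s z"
proof -
  have "0 \<le> (P ^^ t) (bump s) z" for t
    using Pt_mono[of "\<lambda>_. 0" "bump s" z t] Pt_const[OF assms] assms by (simp add: bump_def)
  then show ?thesis unfolding absorb_def
    by (intro LIMSEQ_le_const[OF Pt_tendsto[OF good_bump assms]]) auto
qed

lemma P_sum_absorb: "z \<in> states A \<Longrightarrow>
    P (\<lambda>z. \<Sum>s\<in>I. c s * absorb s z) z = (\<Sum>s\<in>I. c s * absorb s z)"
  using P_absorb by (simp add: P_def avg_sum avg_cmult)

text \<open>Both sides are good and harmonic and have the same boundary values on the pure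
  states.\<close>

lemma H_expand:
  assumes "good f" "z \<in> states A"
  shows "H f z = (\<Sum>s\<in>pure_states A. f s * absorb s z)"
proof (rule harmonic_eqI[OF good_H[OF assms(1)] P_H[OF assms(1)] _ P_sum_absorb _ assms(2)])
  show "good (\<lambda>z. \<Sum>s\<in>pure_states A. f s * absorb s z)"
    by (intro good_sum good_cmult good_absorb)
  show "H f s = (\<Sum>s'\<in>pure_states A. f s' * absorb s' s)" if "s \<in> pure_states A" for s
  proof -
    have "(\<Sum>s'\<in>pure_states A. f s' * absorb s' s) = (\<Sum>s'\<in>pure_states A. if s' = s then f s else 0)"
      using that by (intro sum.cong) (auto simp: absorb_pure)
    then show ?thesis using that by (simp add: H_pure)
  qed
qed auto

lemma sum_absorb: "z \<in> states A \<Longrightarrow> (\<Sum>s\<in>pure_states A. absorb s z) = 1"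
  using H_expand[OF good_const[of 1], of z] Pt_const[of z _ 1] by (simp add: H_def)

text \<open>One update lifts every own probability to at least \<open>1 - rate\<close>, whatever
  \<open>x\<close> was. From there \<alpha> is repeated with positive probability until
  \<open>absorb (pure \<alpha>)\<close> is at least 1/2.\<close>

lemma absorb_upd_pos:
  assumes x: "x \<in> strats" and a: "\<alpha> \<in> profs"
  shows "0 < absorb (pure \<alpha>) (upd x \<alpha>)"
proof -
  let ?z = "upd x \<alpha>" and ?h = "absorb (pure \<alpha>)"
  have z: "?z \<in> states A" using x a by (rule upd_states)
  define b where "b = 1 - rate"
  have b: "0 < b" using rate_less_1 by (simp add: b_def)
  have "b \<le> snd ?z i (\<alpha> i)" for i
  proof -
    have "1 - snd ?z i (\<alpha> i) \<le> rate * (1 - x i (\<alpha> i))" by (rule upd_own_ge[OF x a])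
    also have "\<dots> \<le> rate * 1" using rate_nonneg stratsD[OF x] by (intro mult_left_mono) auto
    finally show ?thesis by (simp add: b_def)
  qed
  then obtain c m0 where c: "0 < c" "\<And>m. m \<ge> m0 \<Longrightarrow> c \<le> stay \<alpha> m ?z"
    using stay_uniform_ge[OF b] a z by blast
  obtain m1 where m1: "\<And>m. m \<ge> m1 \<Longrightarrow> \<bar>?h (traj \<alpha> m ?z) - ?h (pure \<alpha>)\<bar> < 1 / 2"
    using traj_close[OF good_absorb, of "1 / 2"] a z by fastforce
  define m where "m = max m0 m1"
  have "?h (pure \<alpha>) = 1" using a by (simp add: absorb_pure pure_states_eq)
  moreover have "\<bar>?h (traj \<alpha> m ?z) - ?h (pure \<alpha>)\<bar> < 1 / 2" using m1[of m] by (simp add: m_def)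
  ultimately have "1 / 2 \<le> ?h (traj \<alpha> m ?z)" by linarith
  then have "c * (1 / 2) \<le> stay \<alpha> m ?z * ?h (traj \<alpha> m ?z)"
    using c(2)[of m] c(1) stay_nonneg[OF a z, of m] unfolding m_def by (intro mult_mono) auto
  also have "\<dots> \<le> (P ^^ m) ?h ?z" by (rule Pt_stay_le[OF a z absorb_nonneg])
  also have "\<dots> = ?h ?z" by (rule Pt_harmonic[OF P_absorb z])
  finally show ?thesis using c(1) by simp
qed

end

subsection \<open>Invariant measures of Markov kernels\<close>

text \<open>The indicator of a nonempty closed set is the pointwise limit of continuous functions of
  the distance to it, and the closed sets are an intersection-stable generator of the Borel
  sets.\<close>

lemma measure_eq_if_integral_bounded_continuous_eq:
  fixes M N :: "'a::metric_space measure"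
  assumes M: "sets M = sets borel" "prob_space M" and N: "sets N = sets borel" "prob_space N"
    and eq: "\<And>f::'a \<Rightarrow> real. continuous_on UNIV f \<Longrightarrow> (\<And>x. \<bar>f x\<bar> \<le> 1) \<Longrightarrow> integral\<^sup>L M f = integral\<^sup>L N f"
  shows "M = N"
proof -
  interpret M: prob_space M by fact
  interpret N: prob_space N by fact
  \<comment> \<open>The empty set is treated apart because \<open>infdist\<close> to it is 0 by
    convention.\<close>
  have closed_eq: "measure M F = measure N F" if F: "closed F" "F \<noteq> {}" for F
  proof -
    define g where "g n x = max 0 (1 - real n * infdist x F)" for n x
    have g_cont: "continuous_on UNIV (g n)" for n
      unfolding g_def by (intro continuous_intros continuous_on_infdist)
    have g_bd: "\<bar>g n x\<bar> \<le> 1" for n x unfolding g_def using infdist_nonneg[of x F] by auto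
    have g_meas: "g n \<in> borel_measurable borel" for n
      by (intro borel_measurable_continuous_onI g_cont)
    have g_lim: "(\<lambda>n. g n x) \<longlonglongrightarrow> indicator F x" for x
    proof (cases "x \<in> F")
      case True
      then show ?thesis by (simp add: g_def)
    next
      case False
      then have d: "0 < infdist x F"
        using F in_closed_iff_infdist_zero[of F x] infdist_nonneg[of x F] by (simp add: less_le)
      obtain n0 where n0: "1 < real n0 * infdist x F" using reals_Archimedean3[OF d] by blast
      have "g n x = 0" if "n \<ge> n0" for n
      proof -
        have "real n0 * infdist x F \<le> real n * infdist x F" using that d by (intro mult_right_mono) auto
        then show ?thesis using n0 by (simp add: g_def)
      qed
      then have "\<forall>\<^sub>F n in sequentially. g n x = 0" by (auto simp: eventually_sequentially)
      then show ?thesis using False by (simp add: tendsto_eventually)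
    qed
    have lim: "(\<lambda>n. integral\<^sup>L R (g n)) \<longlonglongrightarrow> measure R F"
      if R: "sets R = sets borel" "prob_space R" for R
    proof -
      interpret R: prob_space R by fact
      have "(\<lambda>n. integral\<^sup>L R (g n)) \<longlonglongrightarrow> integral\<^sup>L R (indicator F)"
      proof (rule integral_dominated_convergence[where w="\<lambda>_. 1"])
        show "g n \<in> borel_measurable R" for n using g_meas R measurable_cong_sets by blast
        show "indicat_real F \<in> borel_measurable R" using F R by (intro borel_measurable_indicator) auto
      qed (use g_lim g_bd in auto)
      moreover have "space R = UNIV" using R sets_eq_imp_space_eq by fastforce
      ultimately show ?thesis by simp
    qed
    have "integral\<^sup>L M (g n) = integral\<^sup>L N (g n)" for n by (rule eq[OF g_cont g_bd])
    then show ?thesis using lim[OF M] lim[OF N] LIMSEQ_unique by fastforce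
  qed
  show ?thesis
  proof (rule measure_eqI_generator_eq[where E="Collect closed" and \<Omega>=UNIV and A="\<lambda>_. UNIV"])
    show "Int_stable (Collect (closed :: 'a set \<Rightarrow> bool))" by (auto simp: Int_stable_def)
    show "emeasure M X = emeasure N X" if "X \<in> Collect closed" for X
      using closed_eq[of X] that by (cases "X = {}") (auto simp: M.emeasure_eq_measure N.emeasure_eq_measure)
    show "sets M = sigma_sets UNIV (Collect closed)" "sets N = sigma_sets UNIV (Collect closed)"
      using M N by (simp_all add: borel_eq_closed)
  qed auto
qed

text \<open>Measurability of \<open>K\<close> is known on \<open>S\<close> only. A Dirac measure in
  place of \<open>K z\<close> off \<open>S\<close> gives a measurable kernel on the whole space, and
  the change is invisible to \<mu> because \<open>S\<close> has full measure. So \<nu> is the law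
  after one step from \<mu>.\<close>

lemma bind_pmf_kernel:
  fixes K :: "'a::topological_space \<Rightarrow> 'a pmf"
  assumes mu: "sets \<mu> = sets borel" "prob_space \<mu>" and S: "S \<in> sets borel" "emeasure \<mu> S = 1"
    and meas: "\<And>D. D \<in> sets borel \<Longrightarrow>
      (\<lambda>z. indicator S z * measure_pmf.prob (K z) D) \<in> borel_measurable borel"
  defines "\<kappa> \<equiv> \<lambda>z. if z \<in> S then distr (measure_pmf (K z)) borel (\<lambda>x. x) else return borel z"
  defines "\<nu> \<equiv> \<mu> \<bind> \<kappa>"
  shows "sets \<nu> = sets borel" "prob_space \<nu>"
    "\<And>D. D \<in> sets borel \<Longrightarrow> emeasure \<nu> D = (\<integral>\<^sup>+ z. emeasure (measure_pmf (K z)) D \<partial>\<mu>)"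
    "\<And>f::'a \<Rightarrow> real. f \<in> borel_measurable borel \<Longrightarrow> (\<And>x. \<bar>f x\<bar> \<le> B) \<Longrightarrow>
       integral\<^sup>L \<nu> f = (\<integral>z. indicator S z * measure_pmf.expectation (K z) f \<partial>\<mu>)"
proof -
  interpret prob_space \<mu> by fact
  have space: "space \<mu> = UNIV" using mu sets_eq_imp_space_eq by fastforce
  have AE_S: "AE z in \<mu>. z \<in> S"
    using S mu by (intro AE_prob_1) (simp_all add: emeasure_eq_measure)
  have kS: "emeasure (\<kappa> z) D = emeasure (measure_pmf (K z)) D" if "z \<in> S" "D \<in> sets borel" for z D
    using that by (simp add: \<kappa>_def emeasure_distr)
  have sets_k: "sets (\<kappa> z) = sets borel" for z by (simp add: \<kappa>_def)
  have prob_k: "prob_space (\<kappa> z)" for z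
    unfolding \<kappa>_def by (auto intro!: measure_pmf.prob_space_distr prob_space_return)
  have em: "(\<lambda>z. emeasure (\<kappa> z) D) \<in> borel_measurable borel" if D: "D \<in> sets borel" for D
  proof -
    have "(\<lambda>z. emeasure (\<kappa> z) D) =
        (\<lambda>z. ennreal (indicator S z * measure_pmf.prob (K z) D + indicator (- S) z * indicator D z))"
      using D by (intro ext) (auto simp: \<kappa>_def emeasure_distr measure_pmf.emeasure_eq_measure
          indicator_def split: if_splits)
    also have "\<dots> \<in> borel_measurable borel"
    proof (intro measurable_compose[OF _ measurable_ennreal] borel_measurable_add meas[OF D])
      show "(\<lambda>z. indicator (- S) z * indicator D z :: real) \<in> borel_measurable borel"
        using S D by (intro borel_measurable_times borel_measurable_indicator) auto
    qed
    finally show ?thesis .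
  qed
  have k_meas: "\<kappa> \<in> measurable \<mu> (subprob_algebra borel)"
  proof (rule measurable_subprob_algebra)
    show "subprob_space (\<kappa> z)" for z
      using prob_k prob_space_imp_subprob_space by blast
    show "sets (\<kappa> z) = sets borel" for z by (rule sets_k)
    show "(\<lambda>z. emeasure (\<kappa> z) D) \<in> borel_measurable \<mu>" if "D \<in> sets borel" for D
      using em[OF that] mu measurable_cong_sets by blast
  qed
  show sets_nu: "sets \<nu> = sets borel"
    unfolding \<nu>_def by (rule sets_bind[OF sets_k]) (simp add: space)
  show "emeasure \<nu> D = (\<integral>\<^sup>+ z. emeasure (measure_pmf (K z)) D \<partial>\<mu>)" if D: "D \<in> sets borel" for D
  proof -
    have "emeasure \<nu> D = (\<integral>\<^sup>+ z. emeasure (\<kappa> z) D \<partial>\<mu>)"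
      unfolding \<nu>_def by (rule emeasure_bind[OF _ k_meas D]) (simp add: space)
    also have "\<dots> = (\<integral>\<^sup>+ z. emeasure (measure_pmf (K z)) D \<partial>\<mu>)"
      using AE_S by (intro nn_integral_cong_AE) (auto simp: kS D)
    finally show ?thesis .
  qed
  have "emeasure \<nu> UNIV = (\<integral>\<^sup>+ z. emeasure (\<kappa> z) UNIV \<partial>\<mu>)"
    unfolding \<nu>_def by (rule emeasure_bind[OF _ k_meas]) (simp_all add: space)
  also have "\<dots> = 1"
    using prob_space.emeasure_space_1[OF prob_k] sets_eq_imp_space_eq[OF sets_k] emeasure_space_1 by simp
  finally show "prob_space \<nu>"
    by (intro prob_spaceI) (simp add: sets_eq_imp_space_eq[OF sets_nu])
  show "integral\<^sup>L \<nu> f = (\<integral>z. indicator S z * measure_pmf.expectation (K z) f \<partial>\<mu>)"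
    if f: "f \<in> borel_measurable borel" "\<And>x. \<bar>f x\<bar> \<le> B" for f :: "'a \<Rightarrow> real"
  proof -
    have "integral\<^sup>L \<nu> f = (\<integral>z. integral\<^sup>L (\<kappa> z) f \<partial>\<mu>)"
      unfolding \<nu>_def
      by (rule integral_bind[where K=borel and B=B and B'=1])
         (use f k_meas finite_measure_axioms prob_space.emeasure_space_1[OF prob_k] in auto)
    also have "\<dots> = (\<integral>z. indicator S z * measure_pmf.expectation (K z) f \<partial>\<mu>)"
    proof (rule integral_cong_AE)
      have "(\<lambda>z. integral\<^sup>L (\<kappa> z) f) \<in> borel_measurable \<mu>"
        by (rule measurable_compose[OF k_meas]) (use f in measurable)
      then show m: "(\<lambda>z. integral\<^sup>L (\<kappa> z) f) \<in> borel_measurable \<mu>" .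
      have "(\<lambda>z. indicator S z * measure_pmf.expectation (K z) f) = (\<lambda>z. indicator S z * integral\<^sup>L (\<kappa> z) f)"
        using f by (auto simp: \<kappa>_def fun_eq_iff indicator_def integral_distr)
      then show "(\<lambda>z. indicator S z * measure_pmf.expectation (K z) f) \<in> borel_measurable \<mu>"
        using m S mu by simp
      show "AE z in \<mu>. integral\<^sup>L (\<kappa> z) f = indicator S z * measure_pmf.expectation (K z) f"
        using AE_S f by (auto simp: \<kappa>_def integral_distr)
    qed
    finally show ?thesis .
  qed
qed

text \<open>Invariance, stated for sets, says that \<mu> coincides with its law after one step; then
  integrals of bounded Borel functions coincide too.\<close>

lemma invariant_measure_integral:
  fixes K :: "'a::topological_space \<Rightarrow> 'a pmf" and f :: "'a \<Rightarrow> real"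
  assumes mu: "sets \<mu> = sets borel" "prob_space \<mu>" and S: "S \<in> sets borel" "emeasure \<mu> S = 1"
    and meas: "\<And>D. D \<in> sets borel \<Longrightarrow>
      (\<lambda>z. indicator S z * measure_pmf.prob (K z) D) \<in> borel_measurable borel"
    and inv: "invariant_measure K \<mu>" and f: "f \<in> borel_measurable borel" "\<And>x. \<bar>f x\<bar> \<le> B"
  shows "integral\<^sup>L \<mu> f = (\<integral>z. indicator S z * measure_pmf.expectation (K z) f \<partial>\<mu>)"
proof -
  note b = bind_pmf_kernel[where K=K, OF mu S, OF meas]
  define \<nu> where "\<nu> = \<mu> \<bind> (\<lambda>z. if z \<in> S then distr (measure_pmf (K z)) borel (\<lambda>x. x) else return borel z)"
  have "\<mu> = \<nu>"
    by (rule measure_eqI) (use b(1,3) mu inv in \<open>auto simp: \<nu>_def invariant_measure_def\<close>)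
  moreover have "integral\<^sup>L \<nu> f = (\<integral>z. indicator S z * measure_pmf.expectation (K z) f \<partial>\<mu>)"
    unfolding \<nu>_def by (rule b(4)) (use f in auto)
  ultimately show ?thesis by simp
qed

text \<open>Continuous test functions suffice to identify \<mu> with its law after one step; this is
  the form in which a weak limit delivers invariance.\<close>

lemma invariant_measureI_continuous:
  fixes K :: "'a::metric_space \<Rightarrow> 'a pmf"
  assumes mu: "sets \<mu> = sets borel" "prob_space \<mu>" and S: "S \<in> sets borel" "emeasure \<mu> S = 1"
    and meas: "\<And>D. D \<in> sets borel \<Longrightarrow>
      (\<lambda>z. indicator S z * measure_pmf.prob (K z) D) \<in> borel_measurable borel"
    and inv: "\<And>f::'a \<Rightarrow> real. continuous_on UNIV f \<Longrightarrow> (\<And>x. \<bar>f x\<bar> \<le> 1) \<Longrightarrow>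
      integral\<^sup>L \<mu> f = (\<integral>z. indicator S z * measure_pmf.expectation (K z) f \<partial>\<mu>)"
  shows "invariant_measure K \<mu>"
proof -
  note b = bind_pmf_kernel[where K=K, OF mu S, OF meas]
  define \<nu> where "\<nu> = \<mu> \<bind> (\<lambda>z. if z \<in> S then distr (measure_pmf (K z)) borel (\<lambda>x. x) else return borel z)"
  have "\<mu> = \<nu>"
  proof (rule measure_eq_if_integral_bounded_continuous_eq[OF mu])
    show "sets \<nu> = sets borel" "prob_space \<nu>" using b(1,2) by (simp_all add: \<nu>_def)
    show "integral\<^sup>L \<mu> f = integral\<^sup>L \<nu> f" if "continuous_on UNIV f" "\<And>x. \<bar>f x\<bar> \<le> 1" for f :: "'a \<Rightarrow> real"
    proof -
      have "integral\<^sup>L \<nu> f = (\<integral>z. indicator S z * measure_pmf.expectation (K z) f \<partial>\<mu>)"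
        unfolding \<nu>_def by (rule b(4)[where B=1]) (use that in \<open>auto intro: borel_measurable_continuous_onI\<close>)
      then show ?thesis using inv[OF that] by simp
    qed
  qed
  then show ?thesis using b(3) mu unfolding invariant_measure_def \<nu>_def[symmetric] by simp
qed

section \<open>The pmf kernels as averaging operators, and the limiting matrix\<close>

context pla
begin

definition act :: "real \<Rightarrow> ('i \<Rightarrow> nat \<Rightarrow> real) \<Rightarrow> ('i \<Rightarrow> nat) pmf" where
  "act l x = Pi_pmf UNIV 0 (\<lambda>i. bind_pmf (bernoulli_pmf l)
          (\<lambda>b. if b then pmf_of_set (A i) else embed_pmf (x i)))"

lemma pla_kernel_act: "pla_kernel A u \<epsilon> l z = map_pmf (upd (snd z)) (act l (snd z))"
  by (simp add: pla_kernel_def act_def)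

lemma pmf_embed_strat:
  assumes "x \<in> strats" shows "pmf (embed_pmf (x i)) a = x i a"
proof (rule pmf_embed_pmf)
  show "0 \<le> x i a" for a using assms by (rule stratsD)
  have "(\<integral>\<^sup>+a. ennreal (x i a) \<partial>count_space UNIV) = (\<integral>\<^sup>+a. ennreal (x i a) * indicator (A i) a \<partial>count_space UNIV)"
    using stratsD(2)[OF assms] by (intro nn_integral_cong) (auto simp: indicator_def)
  also have "\<dots> = (\<Sum>a\<in>A i. ennreal (x i a))"
    by (subst nn_integral_indicator_finite) auto
  also have "\<dots> = 1" using stratsD(1,3)[OF assms, of i] by (subst sum_ennreal) auto
  finally show "(\<integral>\<^sup>+a. ennreal (x i a) \<partial>count_space UNIV) = 1" .
qed

lemma set_pmf_subset_profs:
  assumes "\<And>i. set_pmf (p i) \<subseteq> A i" shows "set_pmf (Pi_pmf UNIV 0 p) \<subseteq> profs"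
proof -
  have "set_pmf (Pi_pmf UNIV 0 p) \<subseteq> PiE_dflt UNIV 0 (set_pmf \<circ> p)"
    by (rule set_Pi_pmf_subset') simp
  also have "\<dots> \<subseteq> profs" using assms by (auto simp: PiE_dflt_def profs_def)
  finally show ?thesis .
qed

lemma expectation_Pi_pmf:
  fixes g :: "('i \<Rightarrow> nat) \<Rightarrow> real"
  assumes q: "q \<in> strats" "\<And>i a. pmf (p i) a = q i a"
  shows "measure_pmf.expectation (Pi_pmf UNIV 0 p) g = (\<Sum>\<alpha>\<in>profs. (\<Prod>i\<in>UNIV. q i (\<alpha> i)) * g \<alpha>)"
    and "set_pmf (Pi_pmf UNIV 0 p) \<subseteq> profs"
proof -
  have "set_pmf (p i) \<subseteq> A i" for i using stratsD(2)[OF q(1)] q(2) by (metis set_pmf_iff subsetI)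
  then show sub: "set_pmf (Pi_pmf UNIV 0 p) \<subseteq> profs" by (rule set_pmf_subset_profs)
  have "measure_pmf.expectation (Pi_pmf UNIV 0 p) g = (\<Sum>\<alpha>\<in>profs. g \<alpha> * pmf (Pi_pmf UNIV 0 p) \<alpha>)"
    using sub by (intro integral_measure_pmf_real) auto
  also have "\<dots> = (\<Sum>\<alpha>\<in>profs. (\<Prod>i\<in>UNIV. q i (\<alpha> i)) * g \<alpha>)"
    by (intro sum.cong refl, subst pmf_Pi') (simp_all add: q(2))
  finally show "measure_pmf.expectation (Pi_pmf UNIV 0 p) g = (\<Sum>\<alpha>\<in>profs. (\<Prod>i\<in>UNIV. q i (\<alpha> i)) * g \<alpha>)" .
qed

lemma pmf_trem:
  assumes "x \<in> strats" "0 \<le> l" "l \<le> 1"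
  shows "pmf (bind_pmf (bernoulli_pmf l) (\<lambda>b. if b then pmf_of_set (A i) else embed_pmf (x i))) a = trem l x i a"
  using assms stratsD(2)[OF assms(1)]
  by (auto simp: pmf_bind pmf_embed_strat trem_def indicator_def)

lemma act_expectation:
  assumes "x \<in> strats" "0 \<le> l" "l \<le> 1"
  shows "measure_pmf.expectation (act l x) g = (\<Sum>\<alpha>\<in>profs. (\<Prod>i\<in>UNIV. trem l x i (\<alpha> i)) * g \<alpha>)"
    and "set_pmf (act l x) \<subseteq> profs"
  unfolding act_def
  by (rule expectation_Pi_pmf[OF trem_strats[OF assms] pmf_trem[OF assms]])+

lemma pla_kernel_expectation:
  assumes "z \<in> states A" "0 \<le> l" "l \<le> 1"
  shows "measure_pmf.expectation (pla_kernel A u \<epsilon> l z) f = T l f z"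
  using act_expectation(1)[OF snd_states[OF assms(1)] assms(2,3), of "\<lambda>\<alpha>. f (upd (snd z) \<alpha>)"]
  by (simp add: pla_kernel_act T_def avg_def)

lemma set_pla_kernel:
  assumes "z \<in> states A" "0 \<le> l" "l \<le> 1"
  shows "set_pmf (pla_kernel A u \<epsilon> l z) \<subseteq> states A" "finite (set_pmf (pla_kernel A u \<epsilon> l z))"
  using act_expectation(2)[OF snd_states[OF assms(1)] assms(2,3)] snd_states[OF assms(1)]
  by (auto simp: pla_kernel_act upd_states intro: finite_subset[OF _ finite_profs])

text \<open>Kernel and operator agree on \<open>states A\<close> only, so the induction carries the
  support along; its finiteness turns expectations into sums. \<open>f\<close> is generalized
  because the last step of \<open>kpow\<close> replaces it by \<open>P f\<close>.\<close>

lemma kpow_expectation: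
  assumes "z \<in> states A"
  shows "measure_pmf.expectation (kpow (pla_kernel A u \<epsilon> 0) t z) f = (P ^^ t) f z
     \<and> set_pmf (kpow (pla_kernel A u \<epsilon> 0) t z) \<subseteq> states A
     \<and> finite (set_pmf (kpow (pla_kernel A u \<epsilon> 0) t z))"
proof (induction t arbitrary: f)
  case 0
  then show ?case using assms by simp
next
  case (Suc t)
  let ?k = "kpow (pla_kernel A u \<epsilon> 0) t z"
  have IH: "measure_pmf.expectation ?k f = (P ^^ t) f z" "set_pmf ?k \<subseteq> states A" "finite (set_pmf ?k)" for f
    using Suc by auto
  have fin: "finite (set_pmf (pla_kernel A u \<epsilon> 0 y))" "set_pmf (pla_kernel A u \<epsilon> 0 y) \<subseteq> states A"
    if "y \<in> set_pmf ?k" for y using set_pla_kernel[of y 0] IH(2) that by auto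
  have "measure_pmf.expectation (?k \<bind> pla_kernel A u \<epsilon> 0) f =
      (\<Sum>y\<in>set_pmf ?k. pmf ?k y *\<^sub>R measure_pmf.expectation (pla_kernel A u \<epsilon> 0 y) f)"
    using IH fin by (intro pmf_expectation_bind) auto
  also have "\<dots> = (\<Sum>y\<in>set_pmf ?k. P f y * pmf ?k y)"
    using IH(2) by (intro sum.cong) (auto simp: pla_kernel_expectation T_0 subset_iff)
  also have "\<dots> = measure_pmf.expectation ?k (P f)"
    using IH(3) by (subst integral_measure_pmf_real) auto
  also have "\<dots> = (P ^^ Suc t) f z" by (simp add: IH funpow_swap1)
  finally show ?case using IH(3) fin by (simp add: UN_least)
qed

lemma tremble_kernel_expectation:
  assumes z: "z \<in> states A"
  shows "measure_pmf.expectation (tremble_kernel A u \<epsilon> z) f = Q f z"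
    and "set_pmf (tremble_kernel A u \<epsilon> z) \<subseteq> states A"
    and "finite (set_pmf (tremble_kernel A u \<epsilon> z))"
proof -
  let ?p = "\<lambda>j. Pi_pmf UNIV 0 (\<lambda>i. if i = j then pmf_of_set (A i) else embed_pmf (snd z i))"
  have x: "snd z \<in> strats" using z by (rule snd_states)
  have pmf: "pmf (if i = j then pmf_of_set (A i) else embed_pmf (snd z i)) a = one_trem j (snd z) i a" for i j a
    by (auto simp: one_trem_def pmf_embed_strat[OF x] indicator_def)
  note e = expectation_Pi_pmf[OF one_trem_strats[OF x] pmf]
  have fin: "finite (set_pmf (map_pmf (upd (snd z)) (?p j)))" for j
    using e(2)[of j] by (auto intro: finite_subset[OF _ finite_profs])
  have eq: "measure_pmf.expectation (map_pmf (upd (snd z)) (?p j)) f = avg (one_trem j (snd z)) f (snd z)" for j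
    unfolding avg_def using e(1)[of j "\<lambda>\<alpha>. f (upd (snd z) \<alpha>)"] by simp
  show "measure_pmf.expectation (tremble_kernel A u \<epsilon> z) f = Q f z"
    unfolding tremble_kernel_def Q_def
    by (subst pmf_expectation_bind_pmf_of_set) (use fin eq in \<open>simp_all add: sum_distrib_left divide_inverse mult.commute\<close>)
  show "set_pmf (tremble_kernel A u \<epsilon> z) \<subseteq> states A" "finite (set_pmf (tremble_kernel A u \<epsilon> z))"
    unfolding tremble_kernel_def using fin x by (auto intro!: upd_states subsetD[OF e(2)])
qed

text \<open>Probabilities become operator values of an indicator. The latter is in general not
  continuous, so the convergence of the iterates does not apply to it directly.\<close>

lemma QPt_eq:
  assumes "z \<in> states A"
  shows "QPt A u \<epsilon> t z D = Q ((P ^^ t) (indicator D)) z"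
proof -
  let ?q = "tremble_kernel A u \<epsilon> z" and ?k = "kpow (pla_kernel A u \<epsilon> 0) t"
  note q = tremble_kernel_expectation[OF assms]
  have k: "measure_pmf.expectation (?k y) f = (P ^^ t) f y" "finite (set_pmf (?k y))" if "y \<in> set_pmf ?q" for y f
    using kpow_expectation[of y t f] q(2) that by auto
  have "QPt A u \<epsilon> t z D = measure_pmf.expectation (?q \<bind> ?k) (indicator D)"
    by (simp add: QPt_def)
  also have "\<dots> = (\<Sum>y\<in>set_pmf ?q. pmf ?q y *\<^sub>R measure_pmf.expectation (?k y) (indicator D))"
    using q k(2) by (intro pmf_expectation_bind) auto
  also have "\<dots> = (\<Sum>y\<in>set_pmf ?q. (P ^^ t) (indicator D) y * pmf ?q y)"
    using k(1) by (intro sum.cong refl) (metis mult.commute real_scaleR_def)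
  also have "\<dots> = Q ((P ^^ t) (indicator D)) z"
    using q by (subst q(1)[symmetric], subst integral_measure_pmf_real) auto
  finally show ?thesis .
qed

definition limP :: "'i state \<Rightarrow> 'i state \<Rightarrow> real" where "limP s s' = Q (absorb s') s"

lemma Q_mono: "z \<in> states A \<Longrightarrow> (\<And>y. y \<in> states A \<Longrightarrow> f y \<le> g y) \<Longrightarrow> Q f z \<le> Q g z"
  unfolding Q_def by (intro divide_right_mono sum_mono avg_mono) (auto simp: one_trem_strats snd_states)

lemma Q_cong: "z \<in> states A \<Longrightarrow> (\<And>y. y \<in> states A \<Longrightarrow> f y = g y) \<Longrightarrow> Q f z = Q g z"
  by (intro antisym Q_mono) auto

lemma Q_const: "z \<in> states A \<Longrightarrow> Q (\<lambda>_. c) z = c"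
  unfolding Q_def by (simp add: avg_const one_trem_strats snd_states)

lemma Q_sum: "Q (\<lambda>y. \<Sum>k\<in>I. f k y) z = (\<Sum>k\<in>I. Q (f k) z)"
  unfolding Q_def avg_sum by (subst sum.swap) (simp add: sum_divide_distrib)

lemma Q_Pt_tendsto:
  assumes "good f" "z \<in> states A"
  shows "(\<lambda>t. Q ((P ^^ t) f) z) \<longlonglongrightarrow> Q (H f) z"
  unfolding Q_def avg_def using assms
  by (intro tendsto_divide tendsto_sum tendsto_mult tendsto_const Pt_tendsto upd_states)
     (auto simp: snd_states)

text \<open>The indicator of a neighbourhood is squeezed between two continuous functions that agree on
  the pure states, so both have the same limit.\<close>
lemma QPt_tendsto:
  assumes d: "0 < \<delta>" "\<delta> < 1 / 2" and s: "s \<in> pure_states A" and s': "s' \<in> pure_states A"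
  shows "(\<lambda>t. QPt A u \<epsilon> t s (nbhd A \<delta> s')) \<longlonglongrightarrow> limP s s'"
proof -
  define D where "D z = strat_dist A (snd z) (snd s')" for z :: "'i state"
  \<comment> \<open>\<open>lo\<close> vanishes from distance \<delta> on; \<open>hi\<close> is 1 up
    to distance \<delta> and 0 from \<open>2 * \<delta>\<close> on. With \<delta> < 1/2 the latter
    radius is below 1, so no other pure state is reached.\<close>
  define lo hi where "lo z = max 0 (1 - D z / \<delta>)" and "hi z = max 0 (min 1 (2 - D z / \<delta>))" for z
  have cont: "continuous_on (states A) D" unfolding D_def by (rule continuous_on_strat_dist)
  have D0: "0 \<le> D z / \<delta>" for z unfolding D_def using d strat_dist_nonneg by simp
  have good_lo: "good lo"
    unfolding lo_def by (intro goodI[of _ 1] continuous_on_max continuous_on_diff continuous_on_divide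
        continuous_on_const cont) (use d D0 in auto)
  have good_hi: "good hi"
    unfolding hi_def by (intro goodI[of _ 1] continuous_on_max continuous_on_min continuous_on_diff
        continuous_on_divide continuous_on_const cont) (use d in auto)
  have pure: "lo r = bump s' r" "hi r = bump s' r" if r: "r \<in> pure_states A" for r
  proof -
    consider "r = s'" | "1 \<le> D r" "r \<noteq> s'" using strat_dist_pure[OF r s'] unfolding D_def by blast
    then have "lo r = bump s' r \<and> hi r = bump s' r"
    proof cases
      case 1 then show ?thesis by (simp add: lo_def hi_def bump_def D_def)
    next
      case 2
      then have "2 \<le> D r / \<delta>" using d by (simp add: field_simps)
      then show ?thesis using 2 by (simp add: lo_def hi_def bump_def flip: D_def)
    qed
    then show "lo r = bump s' r" "hi r = bump s' r" by auto
  qed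
  have H_eq: "H f z = absorb s' z" if "good f" "\<And>r. r \<in> pure_states A \<Longrightarrow> f r = bump s' r" "z \<in> states A" for f z
  proof -
    have "H f z = (\<Sum>r\<in>pure_states A. f r * absorb r z)" by (rule H_expand[OF that(1,3)])
    also have "\<dots> = (\<Sum>r\<in>pure_states A. bump s' r * absorb r z)" using that(2) by (intro sum.cong) auto
    also have "\<dots> = H (bump s') z" by (rule H_expand[OF good_bump that(3), symmetric])
    finally show ?thesis by (simp only: absorb_def)
  qed
  have sA: "s \<in> states A" using s by (rule pure_states_subset)
  have lim: "(\<lambda>t. Q ((P ^^ t) f) s) \<longlonglongrightarrow> limP s s'" if "good f" "\<And>r. r \<in> pure_states A \<Longrightarrow> f r = bump s' r" for f
    using Q_Pt_tendsto[OF that(1) sA] Q_cong[OF sA H_eq[OF that]] by (simp add: limP_def)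
  let ?I = "indicat_real (nbhd A \<delta> s')"
  have le: "lo z \<le> ?I z" "?I z \<le> hi z" if "z \<in> states A" for z
    using that d strat_dist_nonneg[of "snd z" "snd s'"]
    by (auto simp: indicator_def nbhd_def lo_def hi_def D_def field_simps)
  show ?thesis
  proof (rule tendsto_sandwich[OF _ _ lim[OF good_lo pure(1)] lim[OF good_hi pure(2)]])
    show "\<forall>\<^sub>F t in sequentially. Q ((P ^^ t) lo) s \<le> QPt A u \<epsilon> t s (nbhd A \<delta> s')"
      unfolding QPt_eq[OF sA] by (intro always_eventually allI Q_mono[OF sA] Pt_mono le)
    show "\<forall>\<^sub>F t in sequentially. QPt A u \<epsilon> t s (nbhd A \<delta> s') \<le> Q ((P ^^ t) hi) s"
      unfolding QPt_eq[OF sA] by (intro always_eventually allI Q_mono[OF sA] Pt_mono le)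
  qed
qed

lemma hatP_eq:
  assumes "0 < \<delta>" "\<delta> < 1 / 2" "s \<in> pure_states A" "s' \<in> pure_states A"
  shows "hatP A u \<epsilon> \<delta> s s' = limP s s'"
  unfolding hatP_def by (rule limI[OF QPt_tendsto[OF assms]])

lemma limP_sum: "s \<in> pure_states A \<Longrightarrow> (\<Sum>s'\<in>pure_states A. limP s s') = 1"
  unfolding limP_def using Q_cong[OF pure_states_subset sum_absorb, of s] Q_const[OF pure_states_subset, of s]
  by (simp flip: Q_sum)

lemma limP_nonneg: "s \<in> pure_states A \<Longrightarrow> 0 \<le> limP s s'"
  unfolding limP_def using Q_mono[of s "\<lambda>_. 0" "absorb s'"] absorb_nonneg
  by (simp add: Q_const pure_states_subset)

text \<open>A tremble of \<open>j\<close> picks \<open>b\<close> with probability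
  \<open>1 / card (A j)\<close> while all others repeat their pure action; from the updated state,
  absorption in the new pure state has positive probability.\<close>

lemma limP_pos:
  assumes a: "\<alpha> \<in> profs" and b: "b \<in> A j"
  shows "0 < limP (pure \<alpha>) (pure (\<alpha>(j := b)))"
proof -
  let ?\<beta> = "\<alpha>(j := b)" and ?x = "snd (pure \<alpha>)"
  have beta: "?\<beta> \<in> profs" using a b by (simp add: profs_def)
  have x: "?x \<in> strats" using a by (simp add: snd_states pure_in_states)
  let ?h = "absorb (pure ?\<beta>)"
  have "0 < (\<Prod>i\<in>UNIV. one_trem j ?x i (?\<beta> i))"
    using b card_A_pos by (intro prod_pos) (auto simp: one_trem_def pure_def unitv_def)
  then have "0 < (\<Prod>i\<in>UNIV. one_trem j ?x i (?\<beta> i)) * ?h (upd ?x ?\<beta>)"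
    using absorb_upd_pos[OF x beta] by simp
  also have "\<dots> \<le> avg (one_trem j ?x) ?h ?x"
    by (rule avg_single_le[OF one_trem_strats[OF x] x absorb_nonneg beta])
  also have "\<dots> \<le> (\<Sum>j\<in>UNIV. avg (one_trem j ?x) ?h ?x)"
  proof (rule member_le_sum[of j UNIV "\<lambda>j. avg (one_trem j ?x) ?h ?x"])
    show "0 \<le> avg (one_trem k ?x) ?h ?x" for k
      using avg_mono[OF one_trem_strats[OF x] x, of "\<lambda>_. 0" ?h k] absorb_nonneg
      by (simp add: avg_const[OF one_trem_strats[OF x]])
  qed auto
  finally show ?thesis unfolding limP_def Q_def by simp
qed

end

subsection \<open>Invariant measures for small perturbations\<close>

text \<open>Bolzano-Weierstrass, one coordinate at a time: a further subsequence keeps the limits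
  already obtained.\<close>

lemma finite_convergent_subsequence:
  fixes v :: "nat \<Rightarrow> 'a \<Rightarrow> real"
  assumes "finite I" "\<And>k s. s \<in> I \<Longrightarrow> \<bar>v k s\<bar> \<le> B"
  shows "\<exists>r q. strict_mono (r :: nat \<Rightarrow> nat) \<and> (\<forall>s\<in>I. (\<lambda>k. v (r k) s) \<longlonglongrightarrow> q s)"
  using assms
proof (induction I rule: finite_induct)
  case empty
  show ?case by (intro exI[of _ id]) (auto simp: strict_mono_def)
next
  case (insert s I)
  then obtain r q where r: "strict_mono (r :: nat \<Rightarrow> nat)" and q: "\<forall>s\<in>I. (\<lambda>k. v (r k) s) \<longlonglongrightarrow> q s"
    by (metis insertI2)
  have "bounded (range (\<lambda>k. v (r k) s))"
    unfolding bounded_iff using insert.prems[of s] by (intro exI[of _ B]) auto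
  then obtain l r' where r': "strict_mono r'" "((\<lambda>k. v (r k) s) \<circ> r') \<longlonglongrightarrow> l"
    using bounded_imp_convergent_subsequence by blast
  have "(\<lambda>k. v ((r \<circ> r') k) t) \<longlonglongrightarrow> (q(s := l)) t" if "t \<in> insert s I" for t
  proof (cases "t = s")
    case True
    then show ?thesis using r'(2) by (simp add: o_def)
  next
    case False
    then have "((\<lambda>k. v (r k) t) \<circ> r') \<longlonglongrightarrow> q t"
      using that q by (intro LIMSEQ_subseq_LIMSEQ[OF _ r'(1)]) auto
    then show ?thesis using False by (simp add: o_def)
  qed
  then show ?case using strict_mono_o[OF r r'(1)] by blast
qed

context pla
begin

lemma closed_states: "closed (states A)"
proof -
  have cont: "continuous_on UNIV (\<lambda>z::'i state. fst z i)" for i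
    by (rule continuous_on_product_then_coordinatewise[OF continuous_on_fst[OF continuous_on_id]])
  have 1: "closed {z::'i state. fst z i \<in> A i}" for i
    using closed_vimage[OF finite_imp_closed[OF finA] cont, of i] by (simp add: vimage_def)
  have "states A = (\<Inter>i. {z. fst z i \<in> A i}) \<inter> (\<Inter>i. \<Inter>a. {z. 0 \<le> snd z i a})
      \<inter> (\<Inter>i. \<Inter>a\<in>- A i. {z. snd z i a = 0}) \<inter> (\<Inter>i. {z. sum (snd z i) (A i) = 1})"
    by (auto simp: states_def prob_simplex_def)
  also have "closed \<dots>"
    by (intro closed_Int closed_INT ballI 1 closed_Collect_le closed_Collect_eq continuous_on_strategy
        continuous_on_const continuous_on_sum)
  finally show ?thesis .
qed

lemma states_borel [measurable]: "states A \<in> sets borel"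
  using closed_states by (rule borel_closed)

lemma borel_measurable_avg:
  assumes "f \<in> borel_measurable borel" "\<And>i a. continuous_on UNIV (\<lambda>z. p z i a)"
  shows "(\<lambda>z::'i state. avg (p z) f (snd z)) \<in> borel_measurable borel"
  unfolding avg_def
  by (intro borel_measurable_sum borel_measurable_times borel_measurable_prod
      measurable_compose[OF borel_measurable_continuous_onI[OF continuous_on_upd] assms(1)]
      borel_measurable_continuous_onI[OF assms(2)])

lemma continuous_on_trem:
  assumes "continuous_on S (\<lambda>z. x z i a)" shows "continuous_on S (\<lambda>z. trem l (x z) i a)"
  unfolding trem_def using assms
  by (cases "a \<in> A i") (simp_all add: continuous_on_mult continuous_on_add)

lemma pla_kernel_prob_measurable:
  assumes "D \<in> sets borel" "0 \<le> l" "l \<le> 1"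
  shows "(\<lambda>z. indicator (states A) z * measure_pmf.prob (pla_kernel A u \<epsilon> l z) D) \<in> borel_measurable borel"
proof -
  have "(\<lambda>z. indicator (states A) z * measure_pmf.prob (pla_kernel A u \<epsilon> l z) D) =
      (\<lambda>z. indicator (states A) z * T l (indicator D) z)"
    using pla_kernel_expectation[OF _ assms(2,3), of _ "indicator D"]
    by (auto simp: fun_eq_iff indicator_def)
  also have "\<dots> \<in> borel_measurable borel"
    unfolding T_def using assms
    by (intro borel_measurable_times borel_measurable_avg borel_measurable_indicator states_borel
        continuous_on_trem continuous_on_strategy)
  finally show ?thesis .
qed

section \<open>Stationarity tested on functions\<close>

definition invar :: "real \<Rightarrow> 'i state measure \<Rightarrow> bool" where
  "invar l \<mu> \<longleftrightarrow> sets \<mu> = sets borel \<and> prob_space \<mu> \<and> emeasure \<mu> (states A) = 1 \<and>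
     invariant_measure (pla_kernel A u \<epsilon> l) \<mu>"

text \<open>Good functions are controlled on \<open>states A\<close> only; the indicator cuts off
  the rest, a null set for the measures considered.\<close>

definition L :: "'i state measure \<Rightarrow> ('i state \<Rightarrow> real) \<Rightarrow> real" where
  "L \<mu> f = (\<integral>z. indicator (states A) z * f z \<partial>\<mu>)"

lemma good_measurable: "good f \<Longrightarrow> (\<lambda>z. indicator (states A) z * f z) \<in> borel_measurable borel"
  using borel_measurable_continuous_on_indicator[OF states_borel good_cont] by simp

lemma good_integrable:
  assumes "good f" "invar l \<mu>" shows "integrable \<mu> (\<lambda>z. indicator (states A) z * f z)"
proof -
  interpret prob_space \<mu> using assms by (simp add: invar_def)
  obtain B where B: "0 \<le> B" "\<And>z. z \<in> states A \<Longrightarrow> \<bar>f z\<bar> \<le> B" using goodE[OF assms(1)] by blast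
  have "(\<lambda>z. indicator (states A) z * f z) \<in> borel_measurable \<mu>"
    using good_measurable[OF assms(1)] assms(2) measurable_cong_sets unfolding invar_def by blast
  moreover have "norm (indicator (states A) z * f z) \<le> B" for z
    using B by (cases "z \<in> states A") auto
  ultimately show ?thesis by (intro integrable_const_bound[of _ B]) auto
qed

lemma L_diff: "\<lbrakk>good f; good g; invar l \<mu>\<rbrakk> \<Longrightarrow> L \<mu> (\<lambda>z. f z - g z) = L \<mu> f - L \<mu> g"
  unfolding L_def by (simp add: right_diff_distrib good_integrable)

lemma L_cmult: "L \<mu> (\<lambda>z. c * f z) = c * L \<mu> f"
  unfolding L_def by (simp add: mult.left_commute)

lemma L_cong: "(\<And>z. z \<in> states A \<Longrightarrow> f z = g z) \<Longrightarrow> L \<mu> f = L \<mu> g"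
  unfolding L_def by (intro arg_cong[of _ _ "integral\<^sup>L \<mu>"] ext) (simp add: indicator_def)

lemma L_const: assumes "invar l \<mu>" shows "L \<mu> (\<lambda>_. c) = c"
proof -
  interpret prob_space \<mu> using assms by (simp add: invar_def)
  have "measure \<mu> (states A) = 1" using assms by (simp add: invar_def measure_def)
  moreover have "states A \<in> sets \<mu>" using assms by (simp add: invar_def)
  ultimately show ?thesis unfolding L_def by simp
qed

lemma L_sum: "\<lbrakk>\<And>k. k \<in> I \<Longrightarrow> good (f k); invar l \<mu>\<rbrakk> \<Longrightarrow> L \<mu> (\<lambda>z. \<Sum>k\<in>I. f k z) = (\<Sum>k\<in>I. L \<mu> (f k))"
  unfolding L_def sum_distrib_left by (intro Bochner_Integration.integral_sum good_integrable)

lemma L_mono: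
  "\<lbrakk>good f; good g; invar l \<mu>; \<And>z. z \<in> states A \<Longrightarrow> f z \<le> g z\<rbrakk> \<Longrightarrow> L \<mu> f \<le> L \<mu> g"
  unfolding L_def by (intro integral_mono good_integrable) (auto simp: indicator_def)

lemma L_bound:
  assumes f: "good f" "invar l \<mu>" "\<And>z. z \<in> states A \<Longrightarrow> \<bar>f z\<bar> \<le> B"
  shows "\<bar>L \<mu> f\<bar> \<le> B"
proof -
  have "f z \<le> B" "- B \<le> f z" if "z \<in> states A" for z using f(3)[OF that] by auto
  then have "L \<mu> f \<le> L \<mu> (\<lambda>_. B)" "L \<mu> (\<lambda>_. - B) \<le> L \<mu> f"
    by (auto intro!: L_mono[OF _ _ f(2)] f(1) good_const)
  then show ?thesis using L_const[OF f(2)] by auto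
qed

text \<open>Stationarity in dual form. Extending \<open>f\<close> by 0 makes it a bounded Borel
  function on the whole type, as the integral form of invariance requires; on states
  \<open>T l\<close> does not see the change.\<close>

lemma L_T:
  assumes f: "good f" and mu: "invar l \<mu>" and l: "0 \<le> l" "l \<le> 1"
  shows "L \<mu> (T l f) = L \<mu> f"
proof -
  obtain B where B: "0 \<le> B" "\<And>z. z \<in> states A \<Longrightarrow> \<bar>f z\<bar> \<le> B" using goodE[OF f] by blast
  let ?g = "\<lambda>z. indicator (states A) z * f z"
  have "integral\<^sup>L \<mu> ?g = (\<integral>z. indicator (states A) z * measure_pmf.expectation (pla_kernel A u \<epsilon> l z) ?g \<partial>\<mu>)"
  proof (rule invariant_measure_integral[where S="states A"])
    show "\<bar>?g z\<bar> \<le> B" for z using B by (cases "z \<in> states A") auto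
  qed (use mu l f in \<open>auto simp: invar_def intro: pla_kernel_prob_measurable good_measurable\<close>)
  also have "\<dots> = L \<mu> (\<lambda>z. measure_pmf.expectation (pla_kernel A u \<epsilon> l z) ?g)" by (simp add: L_def)
  also have "\<dots> = L \<mu> (T l f)"
  proof (rule L_cong)
    fix z assume z: "z \<in> states A"
    have "T l ?g z = T l f z"
      unfolding T_def using snd_states[OF z] by (intro avg_cong) auto
    then show "measure_pmf.expectation (pla_kernel A u \<epsilon> l z) ?g = T l f z"
      using pla_kernel_expectation[OF z l] by simp
  qed
  finally show ?thesis by (simp add: L_def)
qed

text \<open>To first order in \<open>l\<close> at most one agent trembles.\<close>
lemma T_expansion:
  fixes B l :: real
  assumes z: "z \<in> states A" and B: "\<And>z. z \<in> states A \<Longrightarrow> \<bar>f z\<bar> \<le> B" and l: "0 \<le> l" "l \<le> 1"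
  shows "\<bar>T l f z - P f z - l * CARD('i) * (Q f z - P f z)\<bar> \<le> card profs * (CARD('i)\<^sup>2 * B) * l\<^sup>2"
proof -
  let ?x = "snd z" and ?n = "real CARD('i)"
  have x: "?x \<in> strats" using z by (rule snd_states)
  define b where "b i = 1 / real (card (A i))" for i
  define R where "R \<alpha> = (\<Prod>i\<in>UNIV. (1 - l) * ?x i (\<alpha> i) + l * b i) - (\<Prod>i\<in>UNIV. ?x i (\<alpha> i))
     - l * (\<Sum>j\<in>UNIV. (b j - ?x j (\<alpha> j)) * (\<Prod>i\<in>UNIV - {j}. ?x i (\<alpha> i)))" for \<alpha>
  have R: "\<bar>R \<alpha>\<bar> \<le> ?n\<^sup>2 * l\<^sup>2" if "\<alpha> \<in> profs" for \<alpha>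
  proof -
    have "b i \<le> 1" "0 \<le> b i" for i using card_A_pos[of i] by (auto simp: b_def)
    then show ?thesis unfolding R_def
      using prod_linear_expansion[of UNIV "\<lambda>i. ?x i (\<alpha> i)" b l] stratsD(1,4)[OF x] l by simp
  qed
  \<comment> \<open>The derivative of the weight at \<open>l = 0\<close> is the sum of the
    one-tremble weights minus \<open>n\<close> times the plain weight.\<close>
  have w: "(\<Prod>i\<in>UNIV. trem l ?x i (\<alpha> i)) =
      (\<Prod>i\<in>UNIV. ?x i (\<alpha> i)) + l * ((\<Sum>j\<in>UNIV. \<Prod>i\<in>UNIV. one_trem j ?x i (\<alpha> i)) - ?n * (\<Prod>i\<in>UNIV. ?x i (\<alpha> i))) + R \<alpha>"
    if "\<alpha> \<in> profs" for \<alpha>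
  proof -
    have a: "(\<Prod>i\<in>UNIV. trem l ?x i (\<alpha> i)) = (\<Prod>i\<in>UNIV. (1 - l) * ?x i (\<alpha> i) + l * b i)"
      using profsD[OF that] by (intro prod.cong) (auto simp: trem_def b_def)
    have "(\<Prod>i\<in>UNIV. one_trem j ?x i (\<alpha> i)) = b j * (\<Prod>i\<in>UNIV - {j}. ?x i (\<alpha> i))" for j
    proof -
      have "(\<Prod>i\<in>UNIV. one_trem j ?x i (\<alpha> i)) = one_trem j ?x j (\<alpha> j) * (\<Prod>i\<in>UNIV - {j}. one_trem j ?x i (\<alpha> i))"
        by (rule prod.remove) auto
      also have "(\<Prod>i\<in>UNIV - {j}. one_trem j ?x i (\<alpha> i)) = (\<Prod>i\<in>UNIV - {j}. ?x i (\<alpha> i))"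
        by (intro prod.cong) (auto simp: one_trem_def)
      finally show ?thesis using profsD[OF that] by (simp add: one_trem_def b_def)
    qed
    moreover have "(\<Prod>i\<in>UNIV. ?x i (\<alpha> i)) = ?x j (\<alpha> j) * (\<Prod>i\<in>UNIV - {j}. ?x i (\<alpha> i))" for j
      by (rule prod.remove) auto
    ultimately have "(b j - ?x j (\<alpha> j)) * (\<Prod>i\<in>UNIV - {j}. ?x i (\<alpha> i)) =
        (\<Prod>i\<in>UNIV. one_trem j ?x i (\<alpha> i)) - (\<Prod>i\<in>UNIV. ?x i (\<alpha> i))" for j
      by (simp add: left_diff_distrib)
    then show ?thesis unfolding a R_def by (simp add: sum_subtractf)
  qed
  have "T l f z = (\<Sum>\<alpha>\<in>profs. ((\<Prod>i\<in>UNIV. ?x i (\<alpha> i)) + l * ((\<Sum>j\<in>UNIV. \<Prod>i\<in>UNIV. one_trem j ?x i (\<alpha> i))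
      - ?n * (\<Prod>i\<in>UNIV. ?x i (\<alpha> i))) + R \<alpha>) * f (upd ?x \<alpha>))"
    unfolding T_def avg_def by (intro sum.cong) (simp_all add: w)
  also have "\<dots> = P f z + l * ((\<Sum>\<alpha>\<in>profs. \<Sum>j\<in>UNIV. (\<Prod>i\<in>UNIV. one_trem j ?x i (\<alpha> i)) * f (upd ?x \<alpha>)) - ?n * P f z)
      + (\<Sum>\<alpha>\<in>profs. R \<alpha> * f (upd ?x \<alpha>))"
    unfolding P_def avg_def
    by (simp add: distrib_right left_diff_distrib right_diff_distrib sum.distrib sum_subtractf
        sum_distrib_left sum_distrib_right mult.assoc)
  also have "(\<Sum>\<alpha>\<in>profs. \<Sum>j\<in>UNIV. (\<Prod>i\<in>UNIV. one_trem j ?x i (\<alpha> i)) * f (upd ?x \<alpha>)) = ?n * Q f z"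
    unfolding Q_def avg_def by (subst sum.swap) simp
  finally have "T l f z - P f z - l * ?n * (Q f z - P f z) = (\<Sum>\<alpha>\<in>profs. R \<alpha> * f (upd ?x \<alpha>))"
    by (simp add: algebra_simps)
  also have "\<bar>\<dots>\<bar> \<le> (\<Sum>\<alpha>\<in>profs. ?n\<^sup>2 * l\<^sup>2 * B)"
    by (rule order.trans[OF sum_abs], intro sum_mono, unfold abs_mult, intro mult_mono)
       (auto intro!: R B upd_states x)
  finally show ?thesis by (simp add: algebra_simps)
qed

text \<open>Order 0 cancels: invariance gives \<open>L \<mu> (T l h) = L \<mu> h\<close>, and
  \<open>P h = h\<close>. What is left is \<open>l * n\<close> times the difference, bounded by a
  multiple of \<open>l\<^sup>2\<close>, so one power of \<open>l\<close> can be divided out.\<close>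

lemma L_Q_approx:
  assumes h: "good h" "\<And>z. z \<in> states A \<Longrightarrow> P h z = h z"
  shows "\<exists>C. \<forall>l \<mu>. 0 < l \<longrightarrow> l \<le> 1 \<longrightarrow> invar l \<mu> \<longrightarrow> \<bar>L \<mu> h - L \<mu> (Q h)\<bar> \<le> C * l"
proof -
  obtain B where B: "0 \<le> B" "\<And>z. z \<in> states A \<Longrightarrow> \<bar>h z\<bar> \<le> B" using goodE[OF h(1)] by blast
  define C where "C = card profs * (CARD('i)\<^sup>2 * B)"
  have n: "1 \<le> real CARD('i)" by (simp add: Suc_leI)
  have "\<bar>L \<mu> h - L \<mu> (Q h)\<bar> \<le> C * l" if l: "0 < l" "l \<le> 1" and mu: "invar l \<mu>" for l \<mu>
  proof -
    let ?g = "\<lambda>z. T l h z - h z - l * CARD('i) * (Q h z - h z)"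
    have gT: "good (T l h)" using h l by (intro good_T) auto
    have gd: "good (\<lambda>z. l * CARD('i) * (Q h z - h z))" using h by (intro good_cmult good_diff good_Q)
    have "\<bar>L \<mu> ?g\<bar> \<le> C * l\<^sup>2"
    proof (rule L_bound[OF _ mu])
      show "good ?g" using h by (intro good_diff[OF good_diff[OF gT]] gd)
      show "\<bar>?g z\<bar> \<le> C * l\<^sup>2" if "z \<in> states A" for z
        using T_expansion[where f=h and l=l, OF that B(2)] l h(2)[OF that] by (simp add: C_def)
    qed
    also have "L \<mu> ?g = L \<mu> (T l h) - L \<mu> h - l * CARD('i) * (L \<mu> (Q h) - L \<mu> h)"
      using h by (simp add: L_diff[OF _ _ mu] good_diff gT gd L_cmult good_Q)
    also have "\<dots> = l * CARD('i) * (L \<mu> h - L \<mu> (Q h))"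
      using L_T[OF h(1) mu] l by (simp add: algebra_simps)
    finally have "l * CARD('i) * \<bar>L \<mu> h - L \<mu> (Q h)\<bar> \<le> C * l\<^sup>2" using l by (simp add: abs_mult)
    then have "CARD('i) * \<bar>L \<mu> h - L \<mu> (Q h)\<bar> \<le> C * l"
      using l by (simp add: power2_eq_square mult.left_commute mult.assoc)
    moreover have "1 * \<bar>L \<mu> h - L \<mu> (Q h)\<bar> \<le> CARD('i) * \<bar>L \<mu> h - L \<mu> (Q h)\<bar>"
      using n by (intro mult_right_mono) auto
    ultimately show ?thesis by simp
  qed
  then show ?thesis by blast
qed

text \<open>Without harmonicity the first-order term stays; it is bounded by
  \<open>2 * n * B * l\<close>.\<close>

lemma L_P_approx:
  fixes B l :: real
  assumes f: "good f" and B: "0 \<le> B" "\<And>z. z \<in> states A \<Longrightarrow> \<bar>f z\<bar> \<le> B"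
    and l: "0 < l" "l \<le> 1" and mu: "invar l \<mu>"
  shows "\<bar>L \<mu> f - L \<mu> (P f)\<bar> \<le> (card profs * (CARD('i)\<^sup>2 * B) + 2 * CARD('i) * B) * l"
proof -
  let ?C = "card profs * (CARD('i)\<^sup>2 * B)"
  let ?g = "\<lambda>z. T l f z - P f z"
  have gT: "good (T l f)" using f l by (intro good_T) auto
  have "\<bar>L \<mu> ?g\<bar> \<le> (?C + 2 * CARD('i) * B) * l"
  proof (rule L_bound[OF _ mu])
    show "good ?g" using f by (intro good_diff gT good_P)
    fix z assume z: "z \<in> states A"
    have "\<bar>P f z\<bar> \<le> B" unfolding P_def using B(2) snd_states[OF z] by (intro avg_bound)
    moreover have "\<bar>Q f z\<bar> \<le> B"
      using Q_mono[OF z, of f "\<lambda>_. B"] Q_mono[OF z, of "\<lambda>_. - B" f] B(2) Q_const[OF z]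
      by (auto simp: abs_le_iff minus_le_iff)
    ultimately have "\<bar>Q f z - P f z\<bar> \<le> 2 * B" by linarith
    then have "\<bar>l * CARD('i) * (Q f z - P f z)\<bar> \<le> l * CARD('i) * (2 * B)"
      using l by (simp add: abs_mult mult_left_mono)
    moreover have "\<bar>T l f z - P f z - l * CARD('i) * (Q f z - P f z)\<bar> \<le> ?C * l\<^sup>2"
      using T_expansion[where f=f and l=l, OF z B(2)] l by simp
    moreover have "?C * l\<^sup>2 \<le> ?C * l"
      using l B by (intro mult_left_mono) (auto simp: power2_eq_square mult_le_cancel_left1)
    moreover have "(?C + 2 * CARD('i) * B) * l = ?C * l + l * CARD('i) * (2 * B)"
      by (simp add: algebra_simps)
    ultimately show "\<bar>T l f z - P f z\<bar> \<le> (?C + 2 * CARD('i) * B) * l" by linarith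
  qed
  then show ?thesis using L_T[OF f mu] l by (simp add: L_diff[OF gT good_P[OF f] mu])
qed

text \<open>The order of choices matters: uniform convergence fixes \<open>t\<close> from
  \<open>e\<close> alone, and then \<open>l\<close> is taken so small that \<open>t\<close>
  accumulated errors of order \<open>l\<close> stay below \<open>e / 2\<close>.\<close>

lemma L_H_approx:
  assumes f: "good f" and e: "0 < e"
  shows "\<exists>d>0. \<forall>l \<mu>. 0 < l \<longrightarrow> l < d \<longrightarrow> l \<le> 1 \<longrightarrow> invar l \<mu> \<longrightarrow> \<bar>L \<mu> f - L \<mu> (H f)\<bar> < e"
proof -
  obtain B where B: "0 \<le> B" "\<And>z. z \<in> states A \<Longrightarrow> \<bar>f z\<bar> \<le> B" using goodE[OF f] by blast
  define C where "C = card profs * (CARD('i)\<^sup>2 * B) + 2 * CARD('i) * B"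
  have C: "0 \<le> C" using B by (simp add: C_def)
  have iter: "\<bar>L \<mu> f - L \<mu> ((P ^^ t) f)\<bar> \<le> t * C * l" if l: "0 < l" "l \<le> 1" and mu: "invar l \<mu>" for l \<mu> t
  proof (induction t)
    case (Suc t)
    have "\<bar>L \<mu> ((P ^^ t) f) - L \<mu> (P ((P ^^ t) f))\<bar> \<le> C * l"
      unfolding C_def by (rule L_P_approx[OF good_Pt[OF f] B(1) _ l mu]) (rule Pt_bound[OF _ B(2)])
    then show ?case using Suc by (simp add: algebra_simps)
  qed simp
  have "\<forall>\<^sub>F t in sequentially. \<forall>z\<in>states A. dist ((P ^^ t) f z) (H f z) < e / 2"
    using Pt_uniform_limit[OF f] half_gt_zero[OF e] unfolding uniform_limit_iff by blast
  then obtain t where t: "\<And>z. z \<in> states A \<Longrightarrow> \<bar>(P ^^ t) f z - H f z\<bar> \<le> e / 2"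
    unfolding eventually_sequentially dist_real_def by (metis less_imp_le order_refl)
  \<comment> \<open>The added 1 keeps the threshold meaningful when
    \<open>t * C = 0\<close>.\<close>
  have "\<bar>L \<mu> f - L \<mu> (H f)\<bar> < e" if l: "0 < l" "l < e / (2 * (t * C + 1))" "l \<le> 1" and mu: "invar l \<mu>" for l \<mu>
  proof -
    have "\<bar>L \<mu> (\<lambda>z. (P ^^ t) f z - H f z)\<bar> \<le> e / 2"
      by (rule L_bound[OF _ mu t]) (intro good_diff good_Pt good_H f)
    then have 1: "\<bar>L \<mu> ((P ^^ t) f) - L \<mu> (H f)\<bar> \<le> e / 2"
      by (simp add: L_diff[OF _ _ mu] good_Pt good_H f)
    have tC: "0 < t * C + 1" using C by (simp add: add_nonneg_pos)
    have "t * C * l \<le> (t * C + 1) * l" using l by (simp add: algebra_simps)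
    also have "\<dots> < e / 2" using l(2) tC by (simp add: field_simps)
    finally show ?thesis using iter[OF l(1,3) mu, of t] 1 by linarith
  qed
  moreover have "0 < e / (2 * (t * C + 1))" using e C by (simp add: add_nonneg_pos)
  ultimately show ?thesis by blast
qed

section \<open>Invariant distributions of the limiting matrix\<close>

definition invar_dist :: "('i state \<Rightarrow> real) \<Rightarrow> bool" where
  "invar_dist \<pi> \<longleftrightarrow> (\<forall>s\<in>pure_states A. 0 \<le> \<pi> s) \<and> (\<Sum>s\<in>pure_states A. \<pi> s) = 1 \<and>
     (\<forall>s'\<in>pure_states A. (\<Sum>s\<in>pure_states A. \<pi> s * limP s s') = \<pi> s')"

text \<open>Taking positive parts gives an inequality in every coordinate. The rows of
  \<open>limP\<close> sum to 1, so both sides have the same total and no inequality is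
  strict.\<close>

lemma positive_part_invariant:
  assumes v: "\<And>s'. s' \<in> pure_states A \<Longrightarrow> (\<Sum>s\<in>pure_states A. v s * limP s s') = v s'"
    and s': "s' \<in> pure_states A"
  shows "(\<Sum>s\<in>pure_states A. max 0 (v s) * limP s s') = max 0 (v s')"
proof -
  let ?S = "pure_states A"
  have le: "max 0 (v s') \<le> (\<Sum>s\<in>?S. max 0 (v s) * limP s s')" if "s' \<in> ?S" for s'
  proof -
    have "v s' \<le> (\<Sum>s\<in>?S. max 0 (v s) * limP s s')"
      unfolding v[OF that, symmetric] by (intro sum_mono mult_right_mono) (auto simp: limP_nonneg)
    moreover have "0 \<le> (\<Sum>s\<in>?S. max 0 (v s) * limP s s')"
      by (intro sum_nonneg mult_nonneg_nonneg) (auto simp: limP_nonneg)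
    ultimately show ?thesis by simp
  qed
  have "(\<Sum>s'\<in>?S. \<Sum>s\<in>?S. max 0 (v s) * limP s s') = (\<Sum>s\<in>?S. max 0 (v s) * (\<Sum>s'\<in>?S. limP s s'))"
    unfolding sum_distrib_left by (rule sum.swap)
  also have "\<dots> = (\<Sum>s\<in>?S. max 0 (v s))" by (intro sum.cong) (auto simp: limP_sum)
  finally have "(\<Sum>s'\<in>?S. (\<Sum>s\<in>?S. max 0 (v s) * limP s s') - max 0 (v s')) = 0"
    by (simp add: sum_subtractf)
  then have "\<forall>s'\<in>?S. (\<Sum>s\<in>?S. max 0 (v s) * limP s s') - max 0 (v s') = 0"
    using le by (subst (asm) sum_nonneg_eq_0_iff) auto
  then show ?thesis using s' by simp
qed

text \<open>Positivity spreads by changes of one player's action at a time: the players in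
  \<open>J\<close> have been moved from \<alpha> to \<beta>, and moving one more is a transition of
  positive probability.\<close>

lemma invariant_support_full:
  assumes w: "\<And>s. s \<in> pure_states A \<Longrightarrow> 0 \<le> w s"
      "\<And>s'. s' \<in> pure_states A \<Longrightarrow> (\<Sum>s\<in>pure_states A. w s * limP s s') = w s'"
    and s: "s \<in> pure_states A" "0 < w s" and s': "s' \<in> pure_states A"
  shows "0 < w s'"
proof -
  obtain \<alpha> \<beta> where ab: "s = pure \<alpha>" "s' = pure \<beta>" "\<alpha> \<in> profs" "\<beta> \<in> profs"
    using s s' by (auto simp: pure_states_eq)
  have "0 < w (pure (override_on \<alpha> \<beta> J))" if "finite J" for J
    using that
  proof (induction J rule: finite_induct)
    case empty
    then show ?case using s ab by simp
  next
    case (insert j J)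
    let ?g = "override_on \<alpha> \<beta> J"
    have g: "?g \<in> profs" using ab by (auto simp: profs_def override_on_def)
    have eq: "override_on \<alpha> \<beta> (insert j J) = ?g(j := \<beta> j)" by (auto simp: override_on_def)
    have g': "?g(j := \<beta> j) \<in> profs" using g ab by (auto simp: profs_def)
    have "0 < w (pure ?g) * limP (pure ?g) (pure (?g(j := \<beta> j)))"
      using insert.IH limP_pos[OF g profsD[OF ab(4)]] by simp
    also have "\<dots> \<le> (\<Sum>s\<in>pure_states A. w s * limP s (pure (?g(j := \<beta> j))))"
      using g w(1) limP_nonneg
      by (intro member_le_sum[of "pure ?g" _ "\<lambda>s. w s * limP s (pure (?g(j := \<beta> j)))"] mult_nonneg_nonneg)
         (auto simp: pure_states_eq)
    also have "\<dots> = w (pure (?g(j := \<beta> j)))" using g' by (intro w(2)) (auto simp: pure_states_eq)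
    finally show ?case unfolding eq .
  qed
  from this[of UNIV] show ?thesis using ab by (simp add: override_on_def)
qed

text \<open>If \<open>p - q\<close> were positive somewhere, its positive part would be a nonzero
  invariant vector, hence positive everywhere, and the totals of \<open>p\<close> and
  \<open>q\<close> could not both be 1.\<close>

lemma invar_dist_unique:
  assumes p: "invar_dist p" and q: "invar_dist q" and s: "s \<in> pure_states A"
  shows "p s = q s"
proof -
  let ?S = "pure_states A"
  have le: "p s \<le> q s" if p: "invar_dist p" and q: "invar_dist q" and s: "s \<in> ?S" for p q s
  proof (rule ccontr)
    assume "\<not> p s \<le> q s"
    then have pos: "0 < max 0 (p s - q s)" by simp
    have inv: "(\<Sum>s\<in>?S. (p s - q s) * limP s s') = p s' - q s'" if "s' \<in> ?S" for s'
      using p q that by (simp add: invar_dist_def left_diff_distrib sum_subtractf)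
    have "0 < max 0 (p s' - q s')" if "s' \<in> ?S" for s'
      by (rule invariant_support_full[OF _ positive_part_invariant[OF inv] s pos that]) auto
    then have "q s' < p s'" if "s' \<in> ?S" for s' using that by (metis diff_gt_0_iff_gt less_max_iff_disj less_irrefl)
    then have "(\<Sum>s'\<in>?S. q s') < (\<Sum>s'\<in>?S. p s')" using s by (intro sum_strict_mono) auto
    then show False using p q by (simp add: invar_dist_def)
  qed
  show ?thesis using le[OF p q s] le[OF q p s] by simp
qed

text \<open>\<open>Q\<close> need not preserve harmonicity, so \<open>H\<close> is applied once
  more. For h = \<open>absorb s'\<close> the integrals of h, Q h and H (Q h) get close to each
  other, and the expansion of the last one over the pure states is the current vector multiplied by
  \<open>limP\<close>.\<close>

lemma subsequential_limit:
  assumes mu: "\<And>k. invar (l k) (\<mu> k)" and l: "\<And>k. 0 < l k" "\<And>k. l k \<le> 1" "l \<longlonglongrightarrow> 0"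
  shows "\<exists>r q. strict_mono (r::nat \<Rightarrow> nat) \<and> invar_dist q \<and>
     (\<forall>s\<in>pure_states A. (\<lambda>k. L (\<mu> (r k)) (absorb s)) \<longlonglongrightarrow> q s)"
proof -
  let ?S = "pure_states A"
  let ?p = "\<lambda>k s. L (\<mu> k) (absorb s)"
  have p0: "0 \<le> ?p k s" for k s
    using L_mono[OF good_const good_absorb mu, of 0 s k] absorb_nonneg L_const[OF mu, of k 0] by simp
  have psum: "(\<Sum>s\<in>?S. ?p k s) = 1" for k
  proof -
    have "(\<Sum>s\<in>?S. ?p k s) = L (\<mu> k) (\<lambda>z. \<Sum>s\<in>?S. absorb s z)"
      by (rule L_sum[OF good_absorb mu, symmetric])
    also have "\<dots> = L (\<mu> k) (\<lambda>_. 1)" by (rule L_cong[OF sum_absorb])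
    finally show ?thesis using L_const[OF mu] by simp
  qed
  have "\<bar>?p k s\<bar> \<le> 1" if "s \<in> ?S" for k s
    using member_le_sum[of s ?S "?p k"] that p0 psum by simp
  then obtain r q where r: "strict_mono r" and q: "\<forall>s\<in>?S. (\<lambda>k. ?p (r k) s) \<longlonglongrightarrow> q s"
    using finite_convergent_subsequence[of ?S ?p 1] by fastforce
  have lr: "(\<lambda>k. l (r k)) \<longlonglongrightarrow> 0" using LIMSEQ_subseq_LIMSEQ[OF l(3) r] by (simp add: o_def)
  have "invar_dist q"
    unfolding invar_dist_def
  proof (intro conjI ballI)
    show "0 \<le> q s" if "s \<in> ?S" for s using q that p0[of _ s] by (intro LIMSEQ_le_const[of "\<lambda>k. ?p (r k) s" "q s"]) auto
    have "(\<lambda>k. \<Sum>s\<in>?S. ?p (r k) s) \<longlonglongrightarrow> (\<Sum>s\<in>?S. q s)" using q by (intro tendsto_sum) auto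
    then show "(\<Sum>s\<in>?S. q s) = 1" unfolding psum by (simp add: LIMSEQ_const_iff)
    fix s' assume s': "s' \<in> ?S"
    let ?h = "absorb s'"
    obtain C where C: "\<And>l \<mu>. \<lbrakk>0 < l; l \<le> 1; invar l \<mu>\<rbrakk> \<Longrightarrow> \<bar>L \<mu> ?h - L \<mu> (Q ?h)\<bar> \<le> C * l"
      using L_Q_approx[OF good_absorb P_absorb] by metis
    have gQ: "good (Q ?h)" by (intro good_Q good_absorb)
    have 1: "(\<lambda>k. L (\<mu> (r k)) ?h - L (\<mu> (r k)) (Q ?h)) \<longlonglongrightarrow> 0"
    proof (rule Lim_null_comparison)
      show "\<forall>\<^sub>F k in sequentially. norm (L (\<mu> (r k)) ?h - L (\<mu> (r k)) (Q ?h)) \<le> C * l (r k)"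
        using C[OF l(1,2) mu] by simp
      show "(\<lambda>k. C * l (r k)) \<longlonglongrightarrow> 0" using tendsto_mult_right_zero[OF lr] .
    qed
    have 2: "(\<lambda>k. L (\<mu> (r k)) (Q ?h) - L (\<mu> (r k)) (H (Q ?h))) \<longlonglongrightarrow> 0"
    proof (rule LIMSEQ_I)
      fix e :: real assume "0 < e"
      then obtain d where d: "d > 0" "\<And>l \<mu>. \<lbrakk>0 < l; l < d; l \<le> 1; invar l \<mu>\<rbrakk> \<Longrightarrow> \<bar>L \<mu> (Q ?h) - L \<mu> (H (Q ?h))\<bar> < e"
        using L_H_approx[OF gQ] by metis
      have "\<forall>\<^sub>F k in sequentially. l (r k) < d" using order_tendstoD(2)[OF lr d(1)] .
      then have "\<forall>\<^sub>F k in sequentially. norm (L (\<mu> (r k)) (Q ?h) - L (\<mu> (r k)) (H (Q ?h)) - 0) < e"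
        by eventually_elim (use d(2)[OF l(1) _ l(2) mu] in simp)
      then show "\<exists>N. \<forall>k\<ge>N. norm (L (\<mu> (r k)) (Q ?h) - L (\<mu> (r k)) (H (Q ?h)) - 0) < e"
        by (simp add: eventually_sequentially)
    qed
    have "L (\<mu> k) (H (Q ?h)) = (\<Sum>s\<in>?S. ?p k s * limP s s')" for k
    proof -
      have "L (\<mu> k) (H (Q ?h)) = L (\<mu> k) (\<lambda>z. \<Sum>s\<in>?S. Q ?h s * absorb s z)"
        by (rule L_cong[OF H_expand[OF gQ]])
      also have "\<dots> = (\<Sum>s\<in>?S. L (\<mu> k) (\<lambda>z. Q ?h s * absorb s z))"
        by (rule L_sum[OF good_cmult[OF good_absorb] mu])
      finally show ?thesis unfolding L_cmult limP_def by (simp add: mult.commute)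
    qed
    then have "(\<lambda>k. L (\<mu> (r k)) (H (Q ?h))) \<longlonglongrightarrow> (\<Sum>s\<in>?S. q s * limP s s')"
      using q by (auto intro!: tendsto_sum tendsto_mult)
    from tendsto_add[OF tendsto_add[OF 1 2] this]
    have "(\<lambda>k. ?p (r k) s') \<longlonglongrightarrow> (\<Sum>s\<in>?S. q s * limP s s')" by simp
    then show "(\<Sum>s\<in>?S. q s * limP s s') = q s'" using q s' LIMSEQ_unique by blast
  qed
  then show ?thesis using r q by blast
qed

text \<open>A sequence staying away from \<open>\<pi> s\<close> would have a subsequence whose
  limits form an invariant distribution, and the only one is \<pi>.\<close>

lemma absorb_tendsto:
  assumes mu: "\<And>l. 0 < l \<Longrightarrow> l \<le> 1 \<Longrightarrow> invar l (\<mu> l)" and pi: "invar_dist \<pi>" and s: "s \<in> pure_states A"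
  shows "((\<lambda>l. L (\<mu> l) (absorb s)) \<longlongrightarrow> \<pi> s) (at_right 0)"
proof (rule tendsto_at_right_sequentially[of 0 1])
  fix l :: "nat \<Rightarrow> real"
  assume l: "\<And>k. 0 < l k" "\<And>k. l k < 1" "l \<longlonglongrightarrow> 0"
  show "(\<lambda>k. L (\<mu> (l k)) (absorb s)) \<longlonglongrightarrow> \<pi> s"
  proof (rule ccontr)
    assume "\<not> ?thesis"
    then obtain e where e: "0 < e" "\<forall>N. \<exists>k\<ge>N. \<not> dist (L (\<mu> (l k)) (absorb s)) (\<pi> s) < e"
      unfolding lim_sequentially by blast
    then obtain m where m: "\<And>N. m N \<ge> N" "\<And>N. \<not> dist (L (\<mu> (l (m N))) (absorb s)) (\<pi> s) < e" by metis
    have "filterlim m at_top sequentially"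
      by (rule filterlim_at_top_mono[OF filterlim_ident]) (use m in auto)
    then have lm: "(\<lambda>N. l (m N)) \<longlonglongrightarrow> 0" using filterlim_compose[OF l(3)] by blast
    obtain r q where r: "strict_mono (r::nat \<Rightarrow> nat)" "invar_dist q"
        "\<forall>s\<in>pure_states A. (\<lambda>k. L (\<mu> (l (m (r k)))) (absorb s)) \<longlonglongrightarrow> q s"
      using subsequential_limit[of "\<lambda>N. l (m N)" "\<lambda>N. \<mu> (l (m N))"] mu l lm by (auto simp: less_imp_le)
    then have "(\<lambda>k. L (\<mu> (l (m (r k)))) (absorb s)) \<longlonglongrightarrow> \<pi> s"
      using s invar_dist_unique[OF r(2) pi s] by auto
    then obtain k where "dist (L (\<mu> (l (m (r k)))) (absorb s)) (\<pi> s) < e"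
      using e(1) unfolding lim_sequentially by blast
    then show False using m by blast
  qed
qed simp

lemma L_tendsto:
  assumes mu: "\<And>l. 0 < l \<Longrightarrow> l \<le> 1 \<Longrightarrow> invar l (\<mu> l)" and pi: "invar_dist \<pi>" and f: "good f"
  shows "((\<lambda>l. L (\<mu> l) f) \<longlongrightarrow> (\<Sum>s\<in>pure_states A. \<pi> s * f s)) (at_right 0)"
proof -
  have ev1: "\<forall>\<^sub>F l in at_right 0. 0 < l \<and> l \<le> (1::real)"
    unfolding eventually_at_right_field by (intro exI[of _ 1]) auto
  have 1: "((\<lambda>l. L (\<mu> l) f - L (\<mu> l) (H f)) \<longlongrightarrow> 0) (at_right 0)"
  proof (rule tendstoI)
    fix e :: real assume "0 < e"
    then obtain d where d: "d > 0" "\<And>l \<mu>. \<lbrakk>0 < l; l < d; l \<le> 1; invar l \<mu>\<rbrakk> \<Longrightarrow> \<bar>L \<mu> f - L \<mu> (H f)\<bar> < e"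
      using L_H_approx[OF f] by metis
    have "\<forall>\<^sub>F l in at_right 0. l < d" using d(1) unfolding eventually_at_right_field by auto
    with ev1 show "\<forall>\<^sub>F l in at_right 0. dist (L (\<mu> l) f - L (\<mu> l) (H f)) 0 < e"
      by eventually_elim (use d(2) mu in auto)
  qed
  have "\<forall>\<^sub>F l in at_right 0. (\<Sum>s\<in>pure_states A. L (\<mu> l) (absorb s) * f s) = L (\<mu> l) (H f)"
    using ev1
  proof eventually_elim
    case (elim l)
    then have inv: "invar l (\<mu> l)" using mu by simp
    have "L (\<mu> l) (H f) = L (\<mu> l) (\<lambda>z. \<Sum>s\<in>pure_states A. f s * absorb s z)"
      by (rule L_cong[OF H_expand[OF f]])
    also have "\<dots> = (\<Sum>s\<in>pure_states A. L (\<mu> l) (\<lambda>z. f s * absorb s z))"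
      by (rule L_sum[OF good_cmult[OF good_absorb] inv])
    finally show ?case unfolding L_cmult by (simp add: mult.commute)
  qed
  moreover have "((\<lambda>l. \<Sum>s\<in>pure_states A. L (\<mu> l) (absorb s) * f s) \<longlongrightarrow> (\<Sum>s\<in>pure_states A. \<pi> s * f s)) (at_right 0)"
    using absorb_tendsto[OF mu pi] by (intro tendsto_sum tendsto_mult tendsto_const)
  ultimately have "((\<lambda>l. L (\<mu> l) (H f)) \<longlongrightarrow> (\<Sum>s\<in>pure_states A. \<pi> s * f s)) (at_right 0)"
    by (rule Lim_transform_eventually[rotated])
  from tendsto_add[OF 1 this] show ?thesis by simp
qed

end

subsection \<open>Existence of invariant measures\<close>

text \<open>Equal to 1 on [0,1] and 0 outside (-1/2, 3/2). This interval has length 2, so translates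
  by different even integers are never positive at the same point.\<close>

definition tent :: "real \<Rightarrow> real" where "tent y = max 0 (min 1 (2 - \<bar>2 * y - 1\<bar>))"

lemma tent_nonneg: "0 \<le> tent y" and tent_le_1: "tent y \<le> 1" by (auto simp: tent_def)

lemma tent_eq_1: "0 \<le> y \<Longrightarrow> y \<le> 1 \<Longrightarrow> tent y = 1"
  by (auto simp: tent_def abs_if)

lemma tent_eq_0: "y \<le> - 1 / 2 \<or> 3 / 2 \<le> y \<Longrightarrow> tent y = 0"
  by (auto simp: tent_def abs_if)

lemma continuous_on_tent: "continuous_on S f \<Longrightarrow> continuous_on S (\<lambda>x. tent (f x))"
  unfolding tent_def by (intro continuous_intros)

lemma sum_tent_le_1:
  assumes "finite I" "inj_on (k :: 'a \<Rightarrow> nat) I"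
  shows "(\<Sum>i\<in>I. tent (y - 2 * real (k i))) \<le> 1"
proof (cases "\<exists>i\<in>I. tent (y - 2 * real (k i)) \<noteq> 0")
  case False
  then show ?thesis by (simp add: sum.neutral)
next
  case True
  then obtain i where i: "i \<in> I" "tent (y - 2 * real (k i)) \<noteq> 0" by blast
  have yi: "- 1 / 2 < y - 2 * real (k i)" "y - 2 * real (k i) < 3 / 2"
    using i(2) tent_eq_0 by (meson not_le)+
  have "tent (y - 2 * real (k j)) = 0" if "j \<in> I - {i}" for j
  proof (rule tent_eq_0)
    have "k j \<noteq> k i" using assms(2) i(1) that by (auto dest: inj_onD)
    then have "real (k j) + 1 \<le> real (k i) \<or> real (k i) + 1 \<le> real (k j)" by linarith
    then show "y - 2 * real (k j) \<le> - 1 / 2 \<or> 3 / 2 \<le> y - 2 * real (k j)" using yi by linarith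
  qed
  then have "(\<Sum>j\<in>I. tent (y - 2 * real (k j))) = tent (y - 2 * real (k i))"
    using assms(1) i(1) by (simp add: sum.remove)
  then show ?thesis using tent_le_1 by simp
qed

section \<open>Real codes for action histories\<close>

context pla
begin

definition idx :: "('i \<Rightarrow> nat) \<Rightarrow> nat" where
  "idx = (SOME f. bij_betw f profs {0..<card profs})"

lemma bij_idx: "bij_betw idx profs {0..<card profs}"
  unfolding idx_def by (rule someI_ex[OF ex_bij_betw_finite_nat[OF finite_profs]])

lemma inj_idx: "inj_on idx profs" using bij_idx by (rule bij_betw_imp_inj_on)

lemma idx_less: "\<alpha> \<in> profs \<Longrightarrow> idx \<alpha> < card profs"
  using bij_betwE[OF bij_idx] by auto

lemma card_profs_pos: "0 < card profs" using profs_ne by (simp add: card_gt_0_iff)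

text \<open>An action history is coded as a real number in a base that leaves gaps between the
  digits, so that the last action and the preceding history depend continuously on the code.\<close>
definition enc :: "('i \<Rightarrow> nat) \<Rightarrow> real \<Rightarrow> real" where
  "enc \<alpha> c = (c + 2 * real (idx \<alpha>)) / (2 * real (card profs))"

text \<open>Inverse of the branch \<open>enc \<alpha>\<close>. On codes of histories in [0,1]
  extended by another profile it misses [0,1] by at least 1, which is beyond the support of
  \<open>tent\<close>.\<close>

abbreviation shift :: "('i \<Rightarrow> nat) \<Rightarrow> real \<Rightarrow> real" where
  "shift \<alpha> c \<equiv> 2 * real (card profs) * c - 2 * real (idx \<alpha>)"

lemma shift_enc: "shift \<beta> (enc \<alpha> c) = c + 2 * real (idx \<alpha>) - 2 * real (idx \<beta>)"
  using profs_ne by (simp add: enc_def)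

lemma enc_bounds:
  assumes "\<alpha> \<in> profs" "0 \<le> c" "c \<le> 1" shows "0 \<le> enc \<alpha> c" "enc \<alpha> c \<le> 1"
proof -
  have "real (idx \<alpha>) + 1 \<le> real (card profs)" using idx_less[OF assms(1)] by linarith
  then show "enc \<alpha> c \<le> 1" using assms card_profs_pos by (simp add: enc_def)
  show "0 \<le> enc \<alpha> c" using assms by (simp add: enc_def)
qed

lemma shift_enc_disjoint:
  assumes "\<alpha> \<in> profs" "\<beta> \<in> profs" "\<alpha> \<noteq> \<beta>" "0 \<le> c" "c \<le> 1"
  shows "shift \<beta> (enc \<alpha> c) \<le> - 1 \<or> 2 \<le> shift \<beta> (enc \<alpha> c)"
proof -
  have "idx \<alpha> \<noteq> idx \<beta>" using inj_idx assms by (auto dest: inj_onD)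
  then have "real (idx \<alpha>) + 1 \<le> real (idx \<beta>) \<or> real (idx \<beta>) + 1 \<le> real (idx \<alpha>)" by linarith
  then show ?thesis unfolding shift_enc using assms by linarith
qed

lemma tent_shift_enc:
  assumes "\<alpha> \<in> profs" "\<beta> \<in> profs" "0 \<le> c" "c \<le> 1"
  shows "tent (shift \<beta> (enc \<alpha> c)) = (if \<beta> = \<alpha> then 1 else 0)"
proof (cases "\<beta> = \<alpha>")
  case True
  then show ?thesis using assms tent_eq_1[of c] by (simp add: shift_enc)
next
  case False
  then show ?thesis using shift_enc_disjoint[OF assms(1,2) _ assms(3,4)] tent_eq_0[of "shift \<beta> (enc \<alpha> c)"] by auto
qed

text \<open>The strategy of a player as a continuous function of the coded history is the fixed point
  of a contraction on the bounded continuous functions.\<close>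
lemma coded_strategy_exists:
  "\<exists>g::real \<Rightarrow> real. continuous_on UNIV g \<and>
     (\<forall>c. g c = (\<Sum>\<alpha>\<in>profs. tent (shift \<alpha> c) *
        ((1 - \<epsilon> * u i \<alpha>) * g (shift \<alpha> c) + \<epsilon> * u i \<alpha> * unitv (\<alpha> i) a)))"
proof -
  define G where "G g c = (\<Sum>\<alpha>\<in>profs. tent (shift \<alpha> c) *
        ((1 - \<epsilon> * u i \<alpha>) * g (shift \<alpha> c) + \<epsilon> * u i \<alpha> * unitv (\<alpha> i) a))" for g :: "real \<Rightarrow> real" and c
  have s: "0 \<le> \<epsilon> * u i \<alpha>" "\<epsilon> * u i \<alpha> \<le> 1" if "\<alpha> \<in> profs" for \<alpha>
    using step_pos[OF profsD[OF that], of i] step_less_1[OF profsD[OF that], of i] by auto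
  \<comment> \<open>At most one \<open>tent\<close> is positive at each \<open>c\<close>, so
    sup-norm bounds are not multiplied by the number of profiles; the contraction factor
    \<open>rate\<close> rests on this.\<close>
  have sum_le: "(\<Sum>\<alpha>\<in>profs. tent (shift \<alpha> c) * b) \<le> b" if "0 \<le> b" for b c
    using mult_right_mono[OF sum_tent_le_1[OF finite_profs inj_idx, of "2 * real (card profs) * c"] that]
    by (simp flip: sum_distrib_right)
  have mem: "G (apply_bcontfun g) \<in> bcontfun" for g
  proof -
    have "continuous_on UNIV (G (apply_bcontfun g))"
      unfolding G_def
      by (intro continuous_intros continuous_on_tent continuous_on_compose2[OF continuous_on_apply_bcontfun[of UNIV g]])
         auto
    moreover obtain B where B: "\<And>c. \<bar>apply_bcontfun g c\<bar> \<le> B"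
      using bounded_apply_bcontfun[of g] by (auto simp: bounded_iff)
    have "\<bar>G (apply_bcontfun g) c\<bar> \<le> B + 1" for c
    proof -
      have B0: "0 \<le> B" using B[of 0] by linarith
      have "\<bar>G (apply_bcontfun g) c\<bar> \<le> (\<Sum>\<alpha>\<in>profs. tent (shift \<alpha> c) * (B + 1))"
        unfolding G_def
      proof (rule order.trans[OF sum_abs sum_mono])
        fix \<alpha> assume a: "\<alpha> \<in> profs"
        have "\<bar>(1 - \<epsilon> * u i \<alpha>) * apply_bcontfun g (shift \<alpha> c)\<bar> \<le> 1 * B"
          unfolding abs_mult using s[OF a] B by (intro mult_mono) auto
        moreover have "\<bar>\<epsilon> * u i \<alpha> * unitv (\<alpha> i) a\<bar> \<le> 1" using s[OF a] by (simp add: unitv_def)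
        ultimately have "\<bar>(1 - \<epsilon> * u i \<alpha>) * apply_bcontfun g (shift \<alpha> c) + \<epsilon> * u i \<alpha> * unitv (\<alpha> i) a\<bar> \<le> B + 1"
          by linarith
        then show "\<bar>tent (shift \<alpha> c) * ((1 - \<epsilon> * u i \<alpha>) * apply_bcontfun g (shift \<alpha> c) + \<epsilon> * u i \<alpha> * unitv (\<alpha> i) a)\<bar>
            \<le> tent (shift \<alpha> c) * (B + 1)"
          unfolding abs_mult using tent_nonneg by (simp add: mult_left_mono)
      qed
      also have "\<dots> \<le> B + 1" using B0 by (intro sum_le) simp
      finally show ?thesis .
    qed
    then have "bounded (range (G (apply_bcontfun g)))" unfolding bounded_iff by auto
    ultimately show ?thesis by (simp add: bcontfun_def)
  qed
  define F where "F g = Bcontfun (G (apply_bcontfun g))" for g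
  have F: "apply_bcontfun (F g) = G (apply_bcontfun g)" for g
    unfolding F_def by (rule Bcontfun_inverse[OF mem])
  have "dist (F g) (F h) \<le> rate * dist g h" for g h
  proof (rule dist_bound)
    fix c
    let ?D = "\<Sum>\<alpha>\<in>profs. tent (shift \<alpha> c) *
        ((1 - \<epsilon> * u i \<alpha>) * (apply_bcontfun g (shift \<alpha> c) - apply_bcontfun h (shift \<alpha> c)))"
    have eq: "G (apply_bcontfun g) c - G (apply_bcontfun h) c = ?D"
      unfolding G_def by (simp add: algebra_simps flip: sum_subtractf)
    have "\<bar>?D\<bar> \<le> (\<Sum>\<alpha>\<in>profs. tent (shift \<alpha> c) * (rate * dist g h))"
    proof (rule order.trans[OF sum_abs sum_mono])
      fix \<alpha> assume a: "\<alpha> \<in> profs"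
      have "\<bar>apply_bcontfun g (shift \<alpha> c) - apply_bcontfun h (shift \<alpha> c)\<bar> \<le> dist g h"
        using dist_bounded[of g _ h] by (simp add: dist_real_def)
      then have "\<bar>(1 - \<epsilon> * u i \<alpha>) * (apply_bcontfun g (shift \<alpha> c) - apply_bcontfun h (shift \<alpha> c))\<bar> \<le> rate * dist g h"
        unfolding abs_mult using s[OF a] rate_ge[OF a, of i] rate_nonneg by (intro mult_mono) auto
      then show "\<bar>tent (shift \<alpha> c) * ((1 - \<epsilon> * u i \<alpha>) * (apply_bcontfun g (shift \<alpha> c) - apply_bcontfun h (shift \<alpha> c)))\<bar>
          \<le> tent (shift \<alpha> c) * (rate * dist g h)"
        unfolding abs_mult[of "tent _"] using tent_nonneg by (simp add: mult_left_mono)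
    qed
    also have "\<dots> \<le> rate * dist g h" using rate_nonneg by (intro sum_le) simp
    finally show "dist (apply_bcontfun (F g) c) (apply_bcontfun (F h) c) \<le> rate * dist g h"
      unfolding F dist_real_def eq .
  qed
  then obtain g where "F g = g"
    using banach_fix_type[OF rate_nonneg rate_less_1, of F] by blast
  then have "apply_bcontfun g c = G (apply_bcontfun g) c" for c using F[of g] by simp
  then show ?thesis unfolding G_def
    by (intro exI[of _ "apply_bcontfun g"] conjI allI continuous_on_apply_bcontfun)
qed

text \<open>At \<open>enc \<alpha> c\<close> with \<open>c\<close> in [0,1] the tents single out
  \<alpha>, and the fixed-point equation becomes the update rule.\<close>

lemma coded_strategies_exist:
  "\<exists>\<Phi>::real \<Rightarrow> 'i \<Rightarrow> nat \<Rightarrow> real. (\<forall>i a. continuous_on UNIV (\<lambda>c. \<Phi> c i a)) \<and>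
     (\<forall>\<alpha>\<in>profs. \<forall>c. 0 \<le> c \<longrightarrow> c \<le> 1 \<longrightarrow> \<Phi> (enc \<alpha> c) = snd (upd (\<Phi> c) \<alpha>))"
proof -
  define fixp where "fixp i a g \<longleftrightarrow> continuous_on UNIV g \<and>
     (\<forall>c. g c = (\<Sum>\<alpha>\<in>profs. tent (shift \<alpha> c) *
        ((1 - \<epsilon> * u i \<alpha>) * g (shift \<alpha> c) + \<epsilon> * u i \<alpha> * unitv (\<alpha> i) a)))" for i a g
  define \<phi> where "\<phi> i a = (SOME g. fixp i a g)" for i a
  have "\<exists>g. fixp i a g" for i a unfolding fixp_def by (rule coded_strategy_exists)
  then have fixp: "fixp i a (\<phi> i a)" for i a unfolding \<phi>_def by (rule someI_ex)
  have phi: "continuous_on UNIV (\<phi> i a)"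
    "\<phi> i a c = (\<Sum>\<alpha>\<in>profs. tent (shift \<alpha> c) *
        ((1 - \<epsilon> * u i \<alpha>) * \<phi> i a (shift \<alpha> c) + \<epsilon> * u i \<alpha> * unitv (\<alpha> i) a))" for i a c
    using fixp[of i a, unfolded fixp_def] by blast+
  have "\<phi> i a (enc \<alpha> c) = (1 - \<epsilon> * u i \<alpha>) * \<phi> i a c + \<epsilon> * u i \<alpha> * unitv (\<alpha> i) a"
    if a: "\<alpha> \<in> profs" and c: "0 \<le> c" "c \<le> 1" for i a \<alpha> c
  proof -
    let ?t = "\<lambda>\<beta>. (1 - \<epsilon> * u i \<beta>) * \<phi> i a (shift \<beta> (enc \<alpha> c)) + \<epsilon> * u i \<beta> * unitv (\<beta> i) a"
    have "\<phi> i a (enc \<alpha> c) = (\<Sum>\<beta>\<in>profs. tent (shift \<beta> (enc \<alpha> c)) * ?t \<beta>)" by (rule phi(2))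
    also have "\<dots> = (\<Sum>\<beta>\<in>profs. if \<beta> = \<alpha> then ?t \<alpha> else 0)"
      using tent_shift_enc[OF a _ c] by (intro sum.cong) auto
    also have "\<dots> = ?t \<alpha>" using a by simp
    finally show ?thesis by (simp add: shift_enc)
  qed
  then show ?thesis using phi(1)
    by (intro exI[of _ "\<lambda>c i a. \<phi> i a c"]) (auto simp: la_update_def fun_eq_iff algebra_simps)
qed

text \<open>Krylov-Bogoliubov argument. \<open>C\<close> consists of the codes whose strategies are
  admissible; it is closed and the coded chain never leaves it, so the limit measure is concentrated
  on it.\<close>

lemma invariant_code_measure_exists:
  fixes \<Phi> :: "real \<Rightarrow> 'i \<Rightarrow> nat \<Rightarrow> real"
  assumes cont: "\<And>i a. continuous_on UNIV (\<lambda>c. \<Phi> c i a)"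
    and enc: "\<And>\<alpha> c. \<lbrakk>\<alpha> \<in> profs; 0 \<le> c; c \<le> 1\<rbrakk> \<Longrightarrow> \<Phi> (enc \<alpha> c) = snd (upd (\<Phi> c) \<alpha>)"
    and l: "0 \<le> l" "l \<le> 1"
  defines "C \<equiv> {c. 0 \<le> c \<and> c \<le> 1 \<and> \<Phi> c \<in> strats}"
  defines "\<kappa> \<equiv> \<lambda>c. map_pmf (\<lambda>\<alpha>. enc \<alpha> c) (act l (\<Phi> c))"
  shows "\<exists>N. real_distribution N \<and> emeasure N C = 1 \<and> C \<in> sets borel \<and> invariant_measure \<kappa> N"
proof -
  have closed_C: "closed C"
  proof -
    have "C = {c. 0 \<le> c} \<inter> {c. c \<le> 1} \<inter> (\<Inter>i. \<Inter>a. {c. 0 \<le> \<Phi> c i a})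
        \<inter> (\<Inter>i. \<Inter>a\<in>- A i. {c. \<Phi> c i a = 0}) \<inter> (\<Inter>i. {c. sum (\<Phi> c i) (A i) = 1})"
      by (auto simp: C_def strats_def prob_simplex_def)
    also have "closed \<dots>"
      by (intro closed_Int closed_INT ballI closed_Collect_le closed_Collect_eq cont
        continuous_on_const continuous_on_sum continuous_on_id)
    finally show ?thesis .
  qed
  have C_sets: "C \<in> sets borel" using closed_C by (rule borel_closed)
  have CD: "\<Phi> c \<in> strats" "0 \<le> c" "c \<le> 1" if "c \<in> C" for c using that by (auto simp: C_def)
  have enc_C: "enc \<alpha> c \<in> C" if "\<alpha> \<in> profs" "c \<in> C" for \<alpha> c
    using that CD[OF that(2)] enc_bounds[of \<alpha> c] enc[of \<alpha> c] snd_states[OF upd_states] by (auto simp: C_def)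
  obtain \<alpha>0 where a0: "\<alpha>0 \<in> profs" using profs_ne by auto
  \<comment> \<open>The code of playing \<open>\<alpha>0\<close> for ever, that is, the fixed point
    of \<open>enc \<alpha>0\<close>. Its strategy is fixed by the update, hence pure; this gives a
    starting point in \<open>C\<close>.\<close>
  define c0 where "c0 = 2 * real (idx \<alpha>0) / (2 * real (card profs) - 1)"
  have c0: "c0 \<in> C"
  proof -
    have N: "real (idx \<alpha>0) + 1 \<le> real (card profs)" using idx_less[OF a0] by linarith
    then have bounds: "0 \<le> c0" "c0 \<le> 1" by (auto simp: c0_def)
    have "c0 * (2 * real (card profs) - 1) = 2 * real (idx \<alpha>0)" using N by (simp add: c0_def)
    then have "c0 + 2 * real (idx \<alpha>0) = c0 * (2 * real (card profs))" by (simp add: algebra_simps)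
    then have "enc \<alpha>0 c0 = c0" using profs_ne unfolding enc_def by simp
    then have e: "\<Phi> c0 = snd (upd (\<Phi> c0) \<alpha>0)" using enc[OF a0 bounds] by simp
    have "\<Phi> c0 i a = unitv (\<alpha>0 i) a" for i a
    proof -
      have "\<Phi> c0 i a - unitv (\<alpha>0 i) a = (1 - \<epsilon> * u i \<alpha>0) * (\<Phi> c0 i a - unitv (\<alpha>0 i) a)"
        using upd_unitv[of "\<Phi> c0" \<alpha>0 i a] e by metis
      then have "\<epsilon> * u i \<alpha>0 * (\<Phi> c0 i a - unitv (\<alpha>0 i) a) = 0" by (simp add: algebra_simps)
      moreover have "\<epsilon> * u i \<alpha>0 \<noteq> 0" using step_pos[OF profsD[OF a0], of i] by linarith
      ultimately show ?thesis by auto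
    qed
    then have "\<Phi> c0 = snd (pure \<alpha>0)" by (auto simp: pure_def fun_eq_iff)
    then show ?thesis using bounds a0 by (simp add: C_def snd_states pure_in_states)
  qed
  \<comment> \<open>Weak convergence tests functions on the whole line, but off \<open>C\<close> the
    values of \<Phi> are not known to lie in [0,1]. Clipping makes the weights bounded, keeps them
    continuous and changes nothing on \<open>C\<close>.\<close>
  define clip where "clip c i a = max 0 (min 1 (\<Phi> c i a))" for c i a
  define K where "K f c = (\<Sum>\<alpha>\<in>profs. (\<Prod>i\<in>UNIV. trem l (clip c) i (\<alpha> i)) * f (enc \<alpha> c))" for f :: "real \<Rightarrow> real" and c
  have clip_C: "clip c = \<Phi> c" if "c \<in> C" for c
    using stratsD(1,4)[OF CD(1)[OF that]] by (simp add: clip_def fun_eq_iff)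
  have cont_clip: "continuous_on UNIV (\<lambda>c. trem l (clip c) i a)" for i a
    unfolding clip_def by (intro continuous_on_trem continuous_on_max continuous_on_min continuous_on_const cont)
  have cont_enc: "continuous_on UNIV (enc \<alpha>)" for \<alpha>
    unfolding enc_def using card_profs_pos by (intro continuous_intros) auto
  have kappa: "measure_pmf.expectation (\<kappa> c) f = K f c" "set_pmf (\<kappa> c) \<subseteq> C" "finite (set_pmf (\<kappa> c))"
    if c: "c \<in> C" for c f
  proof -
    note a = act_expectation[OF CD(1)[OF c] l]
    show "measure_pmf.expectation (\<kappa> c) f = K f c"
      unfolding \<kappa>_def K_def using a(1)[of "\<lambda>\<alpha>. f (enc \<alpha> c)"] by (simp add: clip_C[OF c])
    show "set_pmf (\<kappa> c) \<subseteq> C" "finite (set_pmf (\<kappa> c))"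
      unfolding \<kappa>_def using a(2) c by (auto intro: enc_C finite_subset[OF _ finite_profs])
  qed
  have K_meas: "K f \<in> borel_measurable borel" if "f \<in> borel_measurable borel" for f
    unfolding K_def
    by (intro borel_measurable_sum borel_measurable_times borel_measurable_prod
        borel_measurable_continuous_onI[OF cont_clip]
        measurable_compose[OF borel_measurable_continuous_onI[OF cont_enc] that])
  have K_cont: "continuous_on UNIV (K f)" if "continuous_on UNIV f" for f
    unfolding K_def
    by (intro continuous_on_sum continuous_on_mult continuous_on_prod cont_clip
        continuous_on_compose2[OF that cont_enc]) auto
  \<comment> \<open>Off \<open>C\<close> the weights need not sum to 1, whence the crude bound; weak
    convergence asks for no more than boundedness.\<close>
  have K_bound: "\<bar>K f c\<bar> \<le> card profs" if "\<And>c. \<bar>f c\<bar> \<le> 1" for f c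
  proof -
    have t: "0 \<le> trem l (clip c) i a \<and> trem l (clip c) i a \<le> 1" for i a
    proof -
      have cl: "0 \<le> clip c i a" "clip c i a \<le> 1" by (auto simp: clip_def)
      have "1 / real (card (A i)) \<le> 1" using card_A_pos[of i] by simp
      then have "(1 - l) * clip c i a + l * (1 / real (card (A i))) \<le> (1 - l) * 1 + l * 1"
        using cl l by (intro add_mono mult_left_mono) auto
      then show ?thesis using cl l by (auto simp: trem_def)
    qed
    have "\<bar>K f c\<bar> \<le> (\<Sum>\<alpha>\<in>profs. 1)"
      unfolding K_def
    proof (rule order.trans[OF sum_abs sum_mono])
      fix \<alpha> assume "\<alpha> \<in> profs"
      have "\<bar>\<Prod>i\<in>UNIV. trem l (clip c) i (\<alpha> i)\<bar> \<le> 1"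
        unfolding abs_prod using t by (intro prod_le_1) auto
      then show "\<bar>(\<Prod>i\<in>UNIV. trem l (clip c) i (\<alpha> i)) * f (enc \<alpha> c)\<bar> \<le> 1"
        unfolding abs_mult using that by (intro mult_le_one) auto
    qed
    then show ?thesis by simp
  qed
  define p where "p t = kpow \<kappa> t c0" for t
  have p: "set_pmf (p t) \<subseteq> C \<and> finite (set_pmf (p t))" for t
  proof (induction t)
    case (Suc t)
    then show ?case using kappa(2,3) by (auto simp: p_def subset_iff)
  qed (simp add: p_def c0)
  have p_Suc: "measure_pmf.expectation (p (Suc t)) f = measure_pmf.expectation (p t) (K f)" for t f
  proof -
    have "measure_pmf.expectation (p (Suc t)) f = (\<Sum>c\<in>set_pmf (p t). pmf (p t) c *\<^sub>R measure_pmf.expectation (\<kappa> c) f)"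
      unfolding p_def kpow.simps using p[of t] kappa(3) by (intro pmf_expectation_bind) (auto simp: p_def)
    also have "\<dots> = (\<Sum>c\<in>set_pmf (p t). K f c * pmf (p t) c)"
      using p[of t] kappa(1) by (intro sum.cong) auto
    also have "\<dots> = measure_pmf.expectation (p t) (K f)"
      using p[of t] by (subst integral_measure_pmf_real) auto
    finally show ?thesis .
  qed
  define q where "q n = pmf_of_set {..n} \<bind> p" for n :: nat
  have q_exp: "measure_pmf.expectation (q n) f = (\<Sum>t\<le>n. measure_pmf.expectation (p t) f) / Suc n" for n f
    unfolding q_def using p by (subst pmf_expectation_bind_pmf_of_set) (auto simp: sum_distrib_left divide_inverse mult.commute)
  have q_C: "set_pmf (q n) \<subseteq> C" for n unfolding q_def using p by auto
  define \<nu> where "\<nu> n = distr (measure_pmf (q n)) borel (\<lambda>x. x)" for n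
  have nu: "real_distribution (\<nu> n)" for n
    unfolding real_distribution_def real_distribution_axioms_def \<nu>_def
    by (auto intro!: measure_pmf.prob_space_distr)
  have nu_int: "integral\<^sup>L (\<nu> n) f = measure_pmf.expectation (q n) f" if "f \<in> borel_measurable borel" for n and f :: "real \<Rightarrow> real"
    unfolding \<nu>_def using that by (subst integral_distr) auto
  have "tight \<nu>"
    unfolding tight_def
  proof (intro conjI allI impI nu)
    fix e :: real assume e: "0 < e"
    \<comment> \<open>Tightness is formulated with half-open intervals; starting at -1 keeps the
      code 0 inside.\<close>
    have "measure (\<nu> n) {-1<..1} = 1" for n
    proof -
      have "measure (\<nu> n) {-1<..1} = measure_pmf.prob (q n) {-1<..1}"
        unfolding \<nu>_def by (subst measure_distr) auto
      also have "\<dots> = 1"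
        using q_C[of n] by (subst measure_pmf.prob_eq_1) (auto simp: AE_measure_pmf_iff C_def subset_iff intro: less_le_trans[of _ 0])
      finally show ?thesis .
    qed
    then show "\<exists>a b. a < b \<and> (\<forall>n. 1 - e < measure (\<nu> n) {a<..b})"
      using e by (intro exI[of _ "-1"] exI[of _ 1]) simp
  qed
  from tight_imp_convergent_subsubsequence[OF this strict_mono_id]
  obtain r N where r: "strict_mono (r::nat \<Rightarrow> nat)" and N: "real_distribution N" and w: "weak_conv_m (\<nu> \<circ> r) N"
    by (auto simp: o_def)
  interpret N: real_distribution N by (rule N)
  have conv: "(\<lambda>n. integral\<^sup>L (\<nu> (r n)) f) \<longlonglongrightarrow> integral\<^sup>L N f"
    if "continuous_on UNIV f" "\<And>c. \<bar>f c\<bar> \<le> B" for f :: "real \<Rightarrow> real" and B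
  proof -
    have "(\<lambda>n. integral\<^sup>L ((\<nu> \<circ> r) n) f) \<longlonglongrightarrow> integral\<^sup>L N f"
      by (rule weak_conv_imp_integral_bdd_continuous_conv[OF _ N w, where B=B])
         (use that nu in \<open>auto simp: continuous_on_eq_continuous_at\<close>)
    then show ?thesis by simp
  qed
  have AE_C: "AE c in N. c \<in> C"
  proof -
    \<comment> \<open>Continuous, bounded and zero exactly on the closed nonempty set
      \<open>C\<close>: its integral is 0 along the sequence, hence also in the limit.\<close>
    define g where "g c = min 1 (infdist c C)" for c
    have g: "continuous_on UNIV g" "\<And>c. \<bar>g c\<bar> \<le> 1"
      unfolding g_def by (intro continuous_intros continuous_on_infdist) (auto simp: infdist_nonneg)
    have gm: "g \<in> borel_measurable borel" by (rule borel_measurable_continuous_onI[OF g(1)])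
    have "integral\<^sup>L (\<nu> n) g = 0" for n
    proof -
      have "measure_pmf.expectation (q n) g = measure_pmf.expectation (q n) (\<lambda>_. 0)"
        using q_C[of n] by (intro integral_cong_AE) (auto simp: AE_measure_pmf_iff g_def subset_iff)
      then show ?thesis using nu_int[OF gm] by simp
    qed
    then have "integral\<^sup>L N g = 0" using conv[OF g] by (simp add: LIMSEQ_const_iff)
    moreover have "integrable N g"
      using g gm by (intro N.integrable_const_bound[of _ 1]) auto
    ultimately have "AE c in N. g c = 0"
      by (subst (asm) integral_nonneg_eq_0_iff_AE) (auto simp: g_def infdist_nonneg)
    then show ?thesis
    proof eventually_elim
      case (elim c)
      then have "infdist c C = 0" by (auto simp: g_def min_def split: if_splits)
      then show ?case using in_closed_iff_infdist_zero[OF closed_C, of c] c0 by blast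
    qed
  qed
  have em_C: "emeasure N C = 1"
    using AE_C C_sets N.prob_eq_1[of C] by (simp add: N.emeasure_eq_measure)
  have "invariant_measure \<kappa> N"
  proof (rule invariant_measureI_continuous[OF _ _ C_sets em_C])
    show "sets N = sets borel" "prob_space N" by (auto intro: N.prob_space_axioms)
    show "(\<lambda>c. indicator C c * measure_pmf.prob (\<kappa> c) D) \<in> borel_measurable borel" if D: "D \<in> sets borel" for D
    proof -
      have "(\<lambda>c. indicator C c * measure_pmf.prob (\<kappa> c) D) = (\<lambda>c. indicator C c * K (indicator D) c)"
        using kappa(1)[of _ "indicator D"] by (auto simp: fun_eq_iff indicator_def)
      also have "\<dots> \<in> borel_measurable borel"
        using D C_sets by (intro borel_measurable_times K_meas borel_measurable_indicator)
      finally show ?thesis .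
    qed
    fix f :: "real \<Rightarrow> real" assume f: "continuous_on UNIV f" "\<And>c. \<bar>f c\<bar> \<le> 1"
    have fm: "f \<in> borel_measurable borel" by (rule borel_measurable_continuous_onI[OF f(1)])
    have Kfm: "K f \<in> borel_measurable borel" by (rule K_meas[OF fm])
    \<comment> \<open>Telescoping leaves two boundary terms divided by n + 1.\<close>
    have diff: "integral\<^sup>L (\<nu> n) (K f) - integral\<^sup>L (\<nu> n) f =
        (measure_pmf.expectation (p (Suc n)) f - measure_pmf.expectation (p 0) f) / Suc n" for n
    proof -
      have "integral\<^sup>L (\<nu> n) (K f) - integral\<^sup>L (\<nu> n) f =
          (\<Sum>t\<le>n. measure_pmf.expectation (p (Suc t)) f - measure_pmf.expectation (p t) f) / Suc n"
        unfolding nu_int[OF fm] nu_int[OF Kfm] q_exp p_Suc by (simp add: sum_subtractf diff_divide_distrib)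
      then show ?thesis
        using sum_lessThan_telescope[of "\<lambda>t. measure_pmf.expectation (p t) f" "Suc n"]
        by (simp only: lessThan_Suc_atMost)
    qed
    have exp_bd: "\<bar>measure_pmf.expectation (p t) f\<bar> \<le> 1" for t
    proof -
      have "integrable (measure_pmf (p t)) (\<lambda>c. \<bar>f c\<bar>)"
        using p[of t] by (intro integrable_measure_pmf_finite) auto
      then have "measure_pmf.expectation (p t) (\<lambda>c. \<bar>f c\<bar>) \<le> 1"
        using f(2) by (intro measure_pmf.integral_le_const) auto
      then show ?thesis using integral_abs_bound[of "measure_pmf (p t)" f] by linarith
    qed
    have "(\<lambda>n. integral\<^sup>L (\<nu> n) (K f) - integral\<^sup>L (\<nu> n) f) \<longlonglongrightarrow> 0"
    proof (rule Lim_null_comparison)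
      show "\<forall>\<^sub>F n in sequentially. norm (integral\<^sup>L (\<nu> n) (K f) - integral\<^sup>L (\<nu> n) f) \<le> 2 * inverse (real (Suc n))"
      proof (intro always_eventually allI)
        fix n
        have "\<bar>measure_pmf.expectation (p (Suc n)) f - measure_pmf.expectation (p 0) f\<bar> \<le> 2"
          using exp_bd[of "Suc n"] exp_bd[of 0] by linarith
        then show "norm (integral\<^sup>L (\<nu> n) (K f) - integral\<^sup>L (\<nu> n) f) \<le> 2 * inverse (real (Suc n))"
          unfolding diff by (simp add: divide_inverse abs_mult mult_right_mono)
      qed
      show "(\<lambda>n. 2 * inverse (real (Suc n))) \<longlonglongrightarrow> 0"
        using tendsto_mult_right_zero[OF LIMSEQ_inverse_real_of_nat] .
    qed
    from LIMSEQ_subseq_LIMSEQ[OF this r]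
    have "(\<lambda>n. integral\<^sup>L (\<nu> (r n)) (K f) - integral\<^sup>L (\<nu> (r n)) f) \<longlonglongrightarrow> 0" by (simp add: o_def)
    moreover have "(\<lambda>n. integral\<^sup>L (\<nu> (r n)) (K f) - integral\<^sup>L (\<nu> (r n)) f) \<longlonglongrightarrow> integral\<^sup>L N (K f) - integral\<^sup>L N f"
      using conv[OF K_cont[OF f(1)] K_bound[OF f(2)]] conv[OF f] by (intro tendsto_diff)
    ultimately have "integral\<^sup>L N f = integral\<^sup>L N (K f)" using LIMSEQ_unique by fastforce
    also have "\<dots> = (\<integral>c. indicator C c * K f c \<partial>N)"
      using AE_C Kfm C_sets by (intro integral_cong_AE) (auto simp: indicator_def)
    also have "\<dots> = (\<integral>c. indicator C c * measure_pmf.expectation (\<kappa> c) f \<partial>N)"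
      using kappa(1) by (intro arg_cong[of _ _ "integral\<^sup>L N"] ext) (auto simp: indicator_def)
    finally show "integral\<^sup>L N f = (\<integral>c. indicator C c * measure_pmf.expectation (\<kappa> c) f \<partial>N)" .
  qed
  then show ?thesis using N em_C C_sets by blast
qed

text \<open>On codes in \<open>C\<close>, decoding by \<Psi> intertwines the two chains: a coded
  step followed by decoding has the law of a learning step from the decoded point. Borel
  measurability of \<Psi> is enough here.\<close>

lemma invar_exists:
  assumes l: "0 \<le> l" "l \<le> 1" shows "\<exists>\<mu>. invar l \<mu>"
proof -
  obtain \<Phi> :: "real \<Rightarrow> 'i \<Rightarrow> nat \<Rightarrow> real" where cont: "\<And>i a. continuous_on UNIV (\<lambda>c. \<Phi> c i a)"
    and enc: "\<And>\<alpha> c. \<lbrakk>\<alpha> \<in> profs; 0 \<le> c; c \<le> 1\<rbrakk> \<Longrightarrow> \<Phi> (enc \<alpha> c) = snd (upd (\<Phi> c) \<alpha>)"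
    using coded_strategies_exist by blast
  define C where "C = {c. 0 \<le> c \<and> c \<le> 1 \<and> \<Phi> c \<in> strats}"
  define \<kappa> where "\<kappa> = (\<lambda>c. map_pmf (\<lambda>\<alpha>. enc \<alpha> c) (act l (\<Phi> c)))"
  obtain N where N: "real_distribution N" "emeasure N C = 1" "C \<in> sets borel" "invariant_measure \<kappa> N"
    using invariant_code_measure_exists[OF cont enc l] unfolding C_def \<kappa>_def by blast
  interpret N: real_distribution N by (rule N)
  \<comment> \<open>Reads off the last profile by testing which branch the code belongs to; at
    \<open>enc \<alpha> c\<close> with \<open>c\<close> in [0,1] exactly one test succeeds.\<close>
  define dg where "dg c i = (\<Sum>\<alpha>\<in>profs. if 0 \<le> shift \<alpha> c \<and> shift \<alpha> c \<le> 1 then \<alpha> i else 0)" for c i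
  define \<Psi> where "\<Psi> c = (dg c, \<Phi> c)" for c
  have dg_enc: "dg (enc \<alpha> c) = \<alpha>" if "\<alpha> \<in> profs" "0 \<le> c" "c \<le> 1" for \<alpha> c
  proof
    fix i
    have "dg (enc \<alpha> c) i = (\<Sum>\<beta>\<in>profs. if \<beta> = \<alpha> then \<alpha> i else 0)"
      unfolding dg_def
    proof (rule sum.cong[OF refl])
      fix \<beta> assume b: "\<beta> \<in> profs"
      show "(if 0 \<le> shift \<beta> (enc \<alpha> c) \<and> shift \<beta> (enc \<alpha> c) \<le> 1 then \<beta> i else 0) = (if \<beta> = \<alpha> then \<alpha> i else 0)"
      proof (cases "\<beta> = \<alpha>")
        case True
        then show ?thesis using that by (simp add: shift_enc)
      next
        case False
        then show ?thesis using shift_enc_disjoint[OF that(1) b _ that(2,3)] by auto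
      qed
    qed
    then show "dg (enc \<alpha> c) i = \<alpha> i" using that by simp
  qed
  have Psi_enc: "\<Psi> (enc \<alpha> c) = upd (\<Phi> c) \<alpha>" if "\<alpha> \<in> profs" "0 \<le> c" "c \<le> 1" for \<alpha> c
    using dg_enc[OF that] enc[OF that] by (simp add: \<Psi>_def prod_eq_iff)
  have "(\<lambda>c. if 0 \<le> shift \<alpha> c \<and> shift \<alpha> c \<le> 1 then \<alpha> i else 0) \<in> borel_measurable borel" for \<alpha> :: "'i \<Rightarrow> nat" and i
    by measurable
  then have "(\<lambda>c. dg c i) \<in> borel_measurable borel" for i
    unfolding dg_def by (intro borel_measurable_sum)
  then have "\<Psi> \<in> borel_measurable borel"
    unfolding \<Psi>_def
    by (intro borel_measurable_Pair measurable_coordinatewise_then_product borel_measurable_continuous_onI[OF cont])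
  then have Psi: "\<Psi> \<in> measurable N borel" by simp
  have C: "\<Phi> c \<in> strats" "0 \<le> c" "c \<le> 1" if "c \<in> C" for c using that by (auto simp: C_def)
  have AE_C: "AE c in N. c \<in> C" using N(2,3) by (intro N.AE_prob_1) (simp add: N.emeasure_eq_measure)
  have kernel: "emeasure (measure_pmf (\<kappa> c)) (\<Psi> -` D) = emeasure (measure_pmf (pla_kernel A u \<epsilon> l (\<Psi> c))) D" if "c \<in> C" for c D
  proof -
    have "map_pmf \<Psi> (\<kappa> c) = pla_kernel A u \<epsilon> l (\<Psi> c)"
      unfolding \<kappa>_def pla_kernel_act map_pmf_comp
      using act_expectation(2)[OF C(1)[OF that] l] Psi_enc[OF _ C(2,3)[OF that]]
      by (intro map_pmf_cong) (auto simp: \<Psi>_def)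
    then show ?thesis by (metis emeasure_map_pmf)
  qed
  define \<mu> where "\<mu> = distr N borel \<Psi>"
  have inv: "emeasure \<mu> D = (\<integral>\<^sup>+ c. emeasure (measure_pmf (pla_kernel A u \<epsilon> l (\<Psi> c))) D \<partial>N)" if D: "D \<in> sets borel" for D
  proof -
    have D': "\<Psi> -` D \<in> sets N" using measurable_sets[OF Psi D] by simp
    have "emeasure \<mu> D = emeasure N (\<Psi> -` D)" unfolding \<mu>_def using D Psi by (simp add: emeasure_distr)
    also have "\<dots> = (\<integral>\<^sup>+ c. emeasure (measure_pmf (\<kappa> c)) (\<Psi> -` D) \<partial>N)"
      using N(4) D' unfolding invariant_measure_def by blast
    also have "\<dots> = (\<integral>\<^sup>+ c. emeasure (measure_pmf (pla_kernel A u \<epsilon> l (\<Psi> c))) D \<partial>N)"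
      using AE_C by (intro nn_integral_cong_AE) (auto simp: kernel)
    finally show ?thesis .
  qed
  have mu: "sets \<mu> = sets borel" "prob_space \<mu>"
    unfolding \<mu>_def using Psi by (auto intro: N.prob_space_distr)
  interpret mu: prob_space \<mu> by (rule mu)
  \<comment> \<open>Membership in \<open>C\<close> says nothing about the decoded profile, so \<Psi>
    need not map \<open>C\<close> into the states. But one kernel step always lands in
    \<open>states A\<close>, and by \<open>inv\<close> this already gives full measure.\<close>
  have states: "emeasure \<mu> (states A) = 1"
  proof -
    have "emeasure (measure_pmf (pla_kernel A u \<epsilon> l (\<Psi> c))) (states A) = 1" if "c \<in> C" for c
    proof -
      have "set_pmf (pla_kernel A u \<epsilon> l (\<Psi> c)) \<subseteq> states A"
        unfolding pla_kernel_act \<Psi>_def using act_expectation(2)[OF C(1)[OF that] l] upd_states[OF C(1)[OF that]] by auto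
      then show ?thesis by (simp add: measure_pmf.emeasure_eq_measure measure_pmf.prob_eq_1 AE_measure_pmf_iff subset_eq)
    qed
    then have "emeasure \<mu> (states A) = (\<integral>\<^sup>+ c. 1 \<partial>N)"
      unfolding inv[OF states_borel] using AE_C by (intro nn_integral_cong_AE) auto
    then show ?thesis using N.emeasure_space_1 by simp
  qed
  have AE_states: "AE z in \<mu>. z \<in> states A"
    using states mu(1) by (intro mu.AE_prob_1) (simp add: mu.emeasure_eq_measure)
  have "invariant_measure (pla_kernel A u \<epsilon> l) \<mu>"
    unfolding invariant_measure_def
  proof
    fix D assume "D \<in> sets \<mu>"
    then have D: "D \<in> sets borel" using mu by simp
    let ?k = "\<lambda>z. ennreal (indicator (states A) z * measure_pmf.prob (pla_kernel A u \<epsilon> l z) D)"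
    have km: "?k \<in> borel_measurable borel"
      by (rule measurable_compose[OF pla_kernel_prob_measurable[OF D l] measurable_ennreal])
    have "(\<integral>\<^sup>+ z. emeasure (measure_pmf (pla_kernel A u \<epsilon> l z)) D \<partial>\<mu>) = (\<integral>\<^sup>+ z. ?k z \<partial>\<mu>)"
      using AE_states by (intro nn_integral_cong_AE) (auto simp: measure_pmf.emeasure_eq_measure)
    also have "\<dots> = (\<integral>\<^sup>+ c. ?k (\<Psi> c) \<partial>N)"
      unfolding \<mu>_def by (rule nn_integral_distr[OF Psi]) (use km in simp)
    also have "\<dots> = (\<integral>\<^sup>+ c. emeasure (measure_pmf (pla_kernel A u \<epsilon> l (\<Psi> c))) D \<partial>N)"
    proof (rule nn_integral_cong_AE)
      have "AE c in N. \<Psi> c \<in> states A"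
        using AE_states unfolding \<mu>_def by (subst (asm) AE_distr_iff[OF Psi]) auto
      then show "AE c in N. ?k (\<Psi> c) = emeasure (measure_pmf (pla_kernel A u \<epsilon> l (\<Psi> c))) D"
        by eventually_elim (simp add: measure_pmf.emeasure_eq_measure)
    qed
    finally show "emeasure \<mu> D = (\<integral>\<^sup>+ z. emeasure (measure_pmf (pla_kernel A u \<epsilon> l z)) D \<partial>\<mu>)"
      using inv[OF D] by simp
  qed
  then show ?thesis using mu states unfolding invar_def by blast
qed

end

theorem theorem3p1:
  fixes A :: "'i::finite \<Rightarrow> nat set"
    and u :: "'i \<Rightarrow> ('i \<Rightarrow> nat) \<Rightarrow> real"
    and \<epsilon> :: real
  assumes fin: "\<forall>i. finite (A i) \<and> A i \<noteq> {}"
    and upos: "\<forall>i \<alpha>. (\<forall>j. \<alpha> j \<in> A j) \<longrightarrow> 0 < u i \<alpha>"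
    and eps: "\<epsilon> > 0"
    and eps_small: "\<forall>i \<alpha>. (\<forall>j. \<alpha> j \<in> A j) \<longrightarrow> 0 < \<epsilon> * u i \<alpha> \<and> \<epsilon> * u i \<alpha> < 1"
  shows "\<exists>!\<pi> :: 'i state \<Rightarrow> real.
     (\<forall>z. 0 \<le> \<pi> z) \<and> (\<forall>z. z \<notin> pure_states A \<longrightarrow> \<pi> z = 0) \<and> (\<Sum>s\<in>pure_states A. \<pi> s) = 1 \<and>
     (\<forall>\<mu> :: real \<Rightarrow> 'i state measure.
        (\<forall>l. 0 < l \<and> l \<le> 1 \<longrightarrow>
           sets (\<mu> l) = sets borel \<and> prob_space (\<mu> l) \<and> emeasure (\<mu> l) (states A) = 1 \<and>
           invariant_measure (pla_kernel A u \<epsilon> l) (\<mu> l))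
        \<longrightarrow>
        (\<forall>f :: 'i state \<Rightarrow> real. continuous_on UNIV f \<and> bounded (range f) \<longrightarrow>
           ((\<lambda>l. integral\<^sup>L (\<mu> l) f) \<longlongrightarrow> (\<Sum>s\<in>pure_states A. \<pi> s * f s)) (at_right 0))
        \<and>
        (\<exists>\<delta>0 > 0. \<forall>\<delta>. 0 < \<delta> \<and> \<delta> < \<delta>0 \<longrightarrow>
           (\<forall>s\<in>pure_states A. \<forall>s'\<in>pure_states A.
              convergent (\<lambda>t. QPt A u \<epsilon> t s (nbhd A \<delta> s'))) \<and>
           (\<forall>s\<in>pure_states A. (\<Sum>s'\<in>pure_states A. hatP A u \<epsilon> \<delta> s s') = 1) \<and>
           (\<forall>s'\<in>pure_states A. (\<Sum>s\<in>pure_states A. \<pi> s * hatP A u \<epsilon> \<delta> s s') = \<pi> s')))"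
proof -
  interpret pla A u \<epsilon> by unfold_locales (use fin eps_small in auto)
  let ?S = "pure_states A"
  let ?family = "\<lambda>\<mu>. \<forall>l. 0 < l \<and> l \<le> 1 \<longrightarrow>
           sets (\<mu> l) = sets borel \<and> prob_space (\<mu> l) \<and> emeasure (\<mu> l) (states A) = 1 \<and>
           invariant_measure (pla_kernel A u \<epsilon> l) (\<mu> l)"
  have family_iff: "?family \<mu> \<longleftrightarrow> (\<forall>l. 0 < l \<and> l \<le> 1 \<longrightarrow> invar l (\<mu> l))" for \<mu>
    by (simp add: invar_def)
  obtain \<mu>0 where mu0: "\<And>l. 0 < l \<Longrightarrow> l \<le> 1 \<Longrightarrow> invar l (\<mu>0 l)"
    using invar_exists by (metis less_imp_le)
  \<comment> \<open>An invariant distribution is obtained from the family along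
    \<open>l = 1 / (n + 1)\<close>.\<close>
  obtain q where q: "invar_dist q"
    using subsequential_limit[of "\<lambda>n. inverse (real (Suc n))" "\<lambda>n. \<mu>0 (inverse (real (Suc n)))"] mu0
      LIMSEQ_inverse_real_of_nat by (auto simp: inverse_le_1_iff)
  \<comment> \<open>Extended by 0, because uniqueness is claimed for functions on the whole
    type.\<close>
  define \<pi> where "\<pi> z = (if z \<in> ?S then q z else 0)" for z
  have pi: "invar_dist \<pi>" using q by (simp add: invar_dist_def \<pi>_def cong: sum.cong)
  show ?thesis
  proof (rule ex1I[of _ \<pi>], intro conjI allI impI)
    show "0 \<le> \<pi> z" for z using q by (simp add: \<pi>_def invar_dist_def)
    show "\<pi> z = 0" if "z \<notin> ?S" for z using that by (simp add: \<pi>_def)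
    show "(\<Sum>s\<in>?S. \<pi> s) = 1" using pi by (simp add: invar_dist_def)
  next
    fix \<mu> :: "real \<Rightarrow> 'i state measure" and f :: "'i state \<Rightarrow> real"
    assume "?family \<mu>" and f: "continuous_on UNIV f \<and> bounded (range f)"
    then have mu: "invar l (\<mu> l)" if "0 < l" "l \<le> 1" for l using that unfolding family_iff by blast
    have "good f" using f by (auto simp: good_def intro: continuous_on_subset bounded_subset)
    then have lim: "((\<lambda>l. L (\<mu> l) f) \<longlongrightarrow> (\<Sum>s\<in>?S. \<pi> s * f s)) (at_right 0)"
      using mu pi by (intro L_tendsto)
    have "\<forall>\<^sub>F l in at_right 0. 0 < l \<and> l \<le> (1::real)"
      unfolding eventually_at_right_field by (intro exI[of _ 1]) auto
    then have "\<forall>\<^sub>F l in at_right 0. L (\<mu> l) f = integral\<^sup>L (\<mu> l) f"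
    proof eventually_elim
      case (elim l)
      then have inv: "sets (\<mu> l) = sets borel" "prob_space (\<mu> l)" "emeasure (\<mu> l) (states A) = 1"
        using mu unfolding invar_def by auto
      interpret prob_space "\<mu> l" by (rule inv)
      have "AE z in \<mu> l. z \<in> states A"
        using inv by (intro AE_prob_1) (simp add: emeasure_eq_measure)
      moreover have "f \<in> borel_measurable (\<mu> l)"
        using f inv borel_measurable_continuous_onI measurable_cong_sets by blast
      moreover have "states A \<in> sets (\<mu> l)" using inv by simp
      ultimately show ?case unfolding L_def by (intro integral_cong_AE) auto
    qed
    then show "((\<lambda>l. integral\<^sup>L (\<mu> l) f) \<longlongrightarrow> (\<Sum>s\<in>?S. \<pi> s * f s)) (at_right 0)"
      using lim by (rule Lim_transform_eventually[rotated])
  next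
    fix \<mu> :: "real \<Rightarrow> 'i state measure"
    have "(\<forall>s\<in>?S. \<forall>s'\<in>?S. convergent (\<lambda>t. QPt A u \<epsilon> t s (nbhd A \<delta> s'))) \<and>
        (\<forall>s\<in>?S. (\<Sum>s'\<in>?S. hatP A u \<epsilon> \<delta> s s') = 1) \<and>
        (\<forall>s'\<in>?S. (\<Sum>s\<in>?S. \<pi> s * hatP A u \<epsilon> \<delta> s s') = \<pi> s')" if d: "0 < \<delta>" "\<delta> < 1 / 2" for \<delta>
      using hatP_eq[OF d] QPt_tendsto[OF d] limP_sum pi
      by (simp add: invar_dist_def convergent_def cong: sum.cong) blast
    then show "\<exists>\<delta>0>0. \<forall>\<delta>. 0 < \<delta> \<and> \<delta> < \<delta>0 \<longrightarrow>
        (\<forall>s\<in>?S. \<forall>s'\<in>?S. convergent (\<lambda>t. QPt A u \<epsilon> t s (nbhd A \<delta> s'))) \<and>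
        (\<forall>s\<in>?S. (\<Sum>s'\<in>?S. hatP A u \<epsilon> \<delta> s s') = 1) \<and>
        (\<forall>s'\<in>?S. (\<Sum>s\<in>?S. \<pi> s * hatP A u \<epsilon> \<delta> s s') = \<pi> s')"
      by (intro exI[of _ "1 / 2"]) auto
  next
    fix \<rho> :: "'i state \<Rightarrow> real"
    assume rho: "(\<forall>z. 0 \<le> \<rho> z) \<and> (\<forall>z. z \<notin> ?S \<longrightarrow> \<rho> z = 0) \<and> (\<Sum>s\<in>?S. \<rho> s) = 1 \<and>
     (\<forall>\<mu> :: real \<Rightarrow> 'i state measure. ?family \<mu> \<longrightarrow>
        (\<forall>f :: 'i state \<Rightarrow> real. continuous_on UNIV f \<and> bounded (range f) \<longrightarrow>
           ((\<lambda>l. integral\<^sup>L (\<mu> l) f) \<longlongrightarrow> (\<Sum>s\<in>?S. \<rho> s * f s)) (at_right 0))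
        \<and>
        (\<exists>\<delta>0 > 0. \<forall>\<delta>. 0 < \<delta> \<and> \<delta> < \<delta>0 \<longrightarrow>
           (\<forall>s\<in>?S. \<forall>s'\<in>?S. convergent (\<lambda>t. QPt A u \<epsilon> t s (nbhd A \<delta> s'))) \<and>
           (\<forall>s\<in>?S. (\<Sum>s'\<in>?S. hatP A u \<epsilon> \<delta> s s') = 1) \<and>
           (\<forall>s'\<in>?S. (\<Sum>s\<in>?S. \<rho> s * hatP A u \<epsilon> \<delta> s s') = \<rho> s')))"
    \<comment> \<open>The condition on \<rho> yields information only when it is applied to an
      actual family.\<close>
    have fam: "?family \<mu>0" unfolding family_iff using mu0 by blast
    obtain \<delta>0 where d0: "0 < \<delta>0" "\<forall>\<delta>. 0 < \<delta> \<and> \<delta> < \<delta>0 \<longrightarrow>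
           (\<forall>s\<in>?S. \<forall>s'\<in>?S. convergent (\<lambda>t. QPt A u \<epsilon> t s (nbhd A \<delta> s'))) \<and>
           (\<forall>s\<in>?S. (\<Sum>s'\<in>?S. hatP A u \<epsilon> \<delta> s s') = 1) \<and>
           (\<forall>s'\<in>?S. (\<Sum>s\<in>?S. \<rho> s * hatP A u \<epsilon> \<delta> s s') = \<rho> s')"
      using rho[THEN conjunct2, THEN conjunct2, THEN conjunct2, THEN spec, of \<mu>0, THEN mp, OF fam, THEN conjunct2]
      by (elim exE conjE)
    \<comment> \<open>Below the threshold that comes with \<rho>, and below 1/2, where
      \<open>hatP\<close> equals \<open>limP\<close>.\<close>
    define \<delta> where "\<delta> = min \<delta>0 (1 / 2) / 2"
    have d: "0 < \<delta>" "\<delta> < \<delta>0" "\<delta> < 1 / 2" using d0(1) by (auto simp: \<delta>_def min_def)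
    have "\<forall>s'\<in>?S. (\<Sum>s\<in>?S. \<rho> s * hatP A u \<epsilon> \<delta> s s') = \<rho> s'"
      using d0(2)[THEN spec, of \<delta>] d by simp
    moreover have "\<forall>s\<in>?S. 0 \<le> \<rho> s" using rho[THEN conjunct1] by blast
    moreover note rho0 = rho[THEN conjunct2, THEN conjunct1]
    moreover note rho[THEN conjunct2, THEN conjunct2, THEN conjunct1]
    ultimately have "invar_dist \<rho>"
      using hatP_eq[OF d(1,3)] by (simp add: invar_dist_def cong: sum.cong)
    then have "\<rho> s = \<pi> s" if "s \<in> ?S" for s using invar_dist_unique pi that by blast
    then show "\<rho> = \<pi>" using rho0 unfolding \<pi>_def by metis
  qed
qed

end
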